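(* For every groupoid $G$, the $*$-category $\mathbf{URep}_G$ of unitary representations of $G$ and intertwiners is a Hilbert $*$-category.
   Context: Let $\mathbf{Hilb}$ be the $*$-category of complex Hilbert spaces and bounded linear maps (involution given by adjoints). Regard a (small) groupoid $G$ as a $*$-category with $g^*=g^{-1}$. A unitary representation of $G$ is a $*$-functor $G\to\mathbf{Hilb}$, i.e. a functor $F$ with $F(g^* )=F(g)^*$ (equivalently, each $F(g)$ is unitary); an intertwiner is a natural transformation between such functors. $\mathbf{URep}_G$ has these as objects and morphisms, with involution given componentwise by adjoints. A $*$-category is a category equipped with a choice of morphism $f^*\colon Y\to X$ for each morphism $f\colon X\to Y$ such that $1^*=1$, $(gf)^*=f^*g^*$ and $(f^* )^*=f$. A morphism $f$ is an isometry if $f^*f=1$, a coisometry if $ff^*=1$, and unitary if both. In a $*$-category with a zero object, a binary product $(r_1\colon X\to X_1,\ r_2\colon X\to X_2)$ is orthonormal if $r_1,r_2$ are coisometries and $r_1r_2^*=0$. A pre-Hilbert $*$-category is a $*$-category with a zero object, in which every pair of objects has an orthonormal product (written $X_1\oplus X_2$), every morphism has a kernel that is an isometry, and, for each object $X$, the diagonal $X\to X\oplus X$ (with both components $1$) is a kernel of some morphism. It is known that every pre-Hilbert $*$-category $\mathbf{C}$ is canonically enriched in rational vector spaces, with $(f+g)^*=f^*+g^*$, orthonormal products being biproducts. For each object $A$, the Hermitian elements ($a^*=a$) of $\mathbf{C}(A,A)$ are partially ordered by: $f\le g$ iff $g-f=h^*h$ for some morphism $h\colon A\to X$. A morphism $f$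 is a contraction if $f^*f\le 1$. A directed set is a non-empty preordered set in which every pair of elements has an upper bound. A codirected diagram $(f_{j\le k}\colon X_k\to X_j)_{j,k\in J}$ consists of objects $X_j$ indexed by a directed set $J$ and morphisms $f_{j\le k}\colon X_k\to X_j$ for $j\le k$ with $f_{j\le j}=1$ and $f_{j\le k}f_{k\le l}=f_{j\le l}$. A cone on it is a family $(g_j\colon Y\to X_j)_{j\in J}$ with $f_{j\le k}g_k=g_j$ for all $j\le k$. Given a codirected diagram of contractions in $\mathbf{C}$, an $\ell^2$-cone is a cone $(g_j\colon Y\to X_j)_{j\in J}$ such that the increasing net $(g_j^*g_j)_{j\in J}$ in $\mathbf{C}(Y,Y)$ is bounded above. An $\ell^2$-limit is an $\ell^2$-cone $(f_j\colon X\to X_j)_{j\in J}$ such that for all $\ell^2$-cones $(g_j\colon Y\to X_j)_{j\in J}$ there is a unique morphism $g\colon Y\to X$ with $f_jg=g_j$ for all $j$, and this $g$ satisfies $g^*g=\sup_{j\in J}g_j^*g_j$ (in particular this least upper bound exists). A Hilbert $*$-category is a pre-Hilbert $*$-category that has $\ell^2$-limits of all codirected diagrams of contractions. *)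

theory Defs
  imports "HOL-Analysis.Analysis" "HOL-Algebra.Module" "HOL-Library.Equipollence"
begin

section \<open>Categories, groupoids and star-categories\<close>

record ('o, 'm) category =
  Obj :: "'o set"
  Arr :: "'m set"
  Dom :: "'m \<Rightarrow> 'o"
  Cod :: "'m \<Rightarrow> 'o"
  Ident :: "'o \<Rightarrow> 'm"
  Comp :: "'m \<Rightarrow> 'm \<Rightarrow> 'm"

abbreviation comp_in :: "'m \<Rightarrow> ('o, 'm, 'x) category_scheme \<Rightarrow> 'm \<Rightarrow> 'm"
    (\<open>(_ \<circ>\<^bsub>_\<^esub>/ _)\<close> [56, 0, 55] 55) where
  "g \<circ>\<^bsub>C\<^esub> f \<equiv> Comp C g f"

definition Hom :: "('o, 'm, 'x) category_scheme \<Rightarrow> 'o \<Rightarrow> 'o \<Rightarrow> 'm set" where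
  "Hom C X Y = {f \<in> Arr C. Dom C f = X \<and> Cod C f = Y}"

locale category =
  fixes C :: "('o, 'm, 'x) category_scheme"
  assumes Dom_closed: "f \<in> Arr C \<Longrightarrow> Dom C f \<in> Obj C"
    and Cod_closed: "f \<in> Arr C \<Longrightarrow> Cod C f \<in> Obj C"
    and Ident_closed: "X \<in> Obj C \<Longrightarrow> Ident C X \<in> Hom C X X"
    and Comp_closed: "f \<in> Hom C X Y \<Longrightarrow> g \<in> Hom C Y Z \<Longrightarrow> g \<circ>\<^bsub>C\<^esub> f \<in> Hom C X Z"
    and Ident_left: "f \<in> Hom C X Y \<Longrightarrow> Ident C Y \<circ>\<^bsub>C\<^esub> f = f"
    and Ident_right: "f \<in> Hom C X Y \<Longrightarrow> f \<circ>\<^bsub>C\<^esub> Ident C X = f"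
    and Comp_assoc: "f \<in> Hom C W X \<Longrightarrow> g \<in> Hom C X Y \<Longrightarrow> h \<in> Hom C Y Z
      \<Longrightarrow> (h \<circ>\<^bsub>C\<^esub> g) \<circ>\<^bsub>C\<^esub> f = h \<circ>\<^bsub>C\<^esub> (g \<circ>\<^bsub>C\<^esub> f)"

definition is_inverse :: "('o, 'm, 'x) category_scheme \<Rightarrow> 'm \<Rightarrow> 'm \<Rightarrow> bool" where
  "is_inverse C f h \<longleftrightarrow> h \<in> Hom C (Cod C f) (Dom C f)
     \<and> h \<circ>\<^bsub>C\<^esub> f = Ident C (Dom C f) \<and> f \<circ>\<^bsub>C\<^esub> h = Ident C (Cod C f)"

locale groupoid = category G for G :: "('o, 'm, 'x) category_scheme" +
  assumes invertible: "f \<in> Arr G \<Longrightarrow> \<exists>h. is_inverse G f h"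

record ('o, 'm) star_category = "('o, 'm) category" +
  Star :: "'m \<Rightarrow> 'm"

locale star_category = category C for C :: "('o, 'm, 'x) star_category_scheme" +
  assumes Star_closed: "f \<in> Hom C X Y \<Longrightarrow> Star C f \<in> Hom C Y X"
    and Star_Ident: "X \<in> Obj C \<Longrightarrow> Star C (Ident C X) = Ident C X"
    and Star_Comp: "f \<in> Hom C X Y \<Longrightarrow> g \<in> Hom C Y Z
      \<Longrightarrow> Star C (g \<circ>\<^bsub>C\<^esub> f) = Star C f \<circ>\<^bsub>C\<^esub> Star C g"
    and Star_Star: "f \<in> Hom C X Y \<Longrightarrow> Star C (Star C f) = f"

definition groupoid_star_category :: "('o, 'm) category \<Rightarrow> ('o, 'm) star_category" where
  "groupoid_star_category G =
     \<lparr>Obj = Obj G, Arr = Arr G, Dom = Dom G, Cod = Cod G, Ident = Ident G, Comp = Comp G,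
      Star = (\<lambda>g. THE h. is_inverse G g h)\<rparr>"

definition isometry_arr :: "('o, 'm, 'x) star_category_scheme \<Rightarrow> 'm \<Rightarrow> bool" where
  "isometry_arr C f \<longleftrightarrow> f \<in> Arr C \<and> Star C f \<circ>\<^bsub>C\<^esub> f = Ident C (Dom C f)"

definition coisometry_arr :: "('o, 'm, 'x) star_category_scheme \<Rightarrow> 'm \<Rightarrow> bool" where
  "coisometry_arr C f \<longleftrightarrow> f \<in> Arr C \<and> f \<circ>\<^bsub>C\<^esub> Star C f = Ident C (Cod C f)"

section \<open>Pre-Hilbert star-categories\<close>

definition zero_object :: "('o, 'm, 'x) category_scheme \<Rightarrow> 'o \<Rightarrow> bool" where
  "zero_object C Z \<longleftrightarrow> Z \<in> Obj C
     \<and> (\<forall>X \<in> Obj C. (\<exists>!f. f \<in> Hom C X Z) \<and> (\<exists>!f. f \<in> Hom C Z X))"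

definition zero_arr :: "('o, 'm, 'x) category_scheme \<Rightarrow> 'm \<Rightarrow> bool" where
  "zero_arr C f \<longleftrightarrow> f \<in> Arr C \<and>
     (\<exists>Z a b. zero_object C Z \<and> a \<in> Hom C (Dom C f) Z \<and> b \<in> Hom C Z (Cod C f) \<and> f = b \<circ>\<^bsub>C\<^esub> a)"

definition binary_product ::
    "('o, 'm, 'x) category_scheme \<Rightarrow> 'o \<Rightarrow> 'o \<Rightarrow> 'o \<Rightarrow> 'm \<Rightarrow> 'm \<Rightarrow> bool" where
  "binary_product C X1 X2 P r1 r2 \<longleftrightarrow> r1 \<in> Hom C P X1 \<and> r2 \<in> Hom C P X2 \<and>
     (\<forall>Y f1 f2. f1 \<in> Hom C Y X1 \<longrightarrow> f2 \<in> Hom C Y X2 \<longrightarrow>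
        (\<exists>!h. h \<in> Hom C Y P \<and> r1 \<circ>\<^bsub>C\<^esub> h = f1 \<and> r2 \<circ>\<^bsub>C\<^esub> h = f2))"

definition orthonormal_product ::
    "('o, 'm, 'x) star_category_scheme \<Rightarrow> 'o \<Rightarrow> 'o \<Rightarrow> 'o \<Rightarrow> 'm \<Rightarrow> 'm \<Rightarrow> bool" where
  "orthonormal_product C X1 X2 P r1 r2 \<longleftrightarrow> binary_product C X1 X2 P r1 r2
     \<and> coisometry_arr C r1 \<and> coisometry_arr C r2 \<and> zero_arr C (r1 \<circ>\<^bsub>C\<^esub> Star C r2)"

definition is_kernel :: "('o, 'm, 'x) category_scheme \<Rightarrow> 'm \<Rightarrow> 'm \<Rightarrow> bool" where
  "is_kernel C f k \<longleftrightarrow> f \<in> Arr C \<and> k \<in> Arr C \<and> Cod C k = Dom C f \<and> zero_arr C (f \<circ>\<^bsub>C\<^esub> k) \<and>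
     (\<forall>Y g. g \<in> Hom C Y (Dom C f) \<longrightarrow> zero_arr C (f \<circ>\<^bsub>C\<^esub> g) \<longrightarrow>
        (\<exists>!h. h \<in> Hom C Y (Dom C k) \<and> k \<circ>\<^bsub>C\<^esub> h = g))"

text \<open>
  Orthonormal products of two given objects are unique up to a unique unitary isomorphism
  compatible with the projections, so the quantification over all of them in \<open>diagonal_kernel\<close>
  amounts to a condition on any chosen one.
\<close>

locale pre_hilbert_star_category = star_category C
  for C :: "('o, 'm, 'x) star_category_scheme" +
  assumes ex_zero_object: "\<exists>Z. zero_object C Z"
    and ex_orthonormal_product:
      "X1 \<in> Obj C \<Longrightarrow> X2 \<in> Obj C \<Longrightarrow> \<exists>P r1 r2. orthonormal_product C X1 X2 P r1 r2"
    and ex_isometric_kernel: "f \<in> Arr C \<Longrightarrow> \<exists>k. is_kernel C f k \<and> isometry_arr C k"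
    and diagonal_kernel:
      "X \<in> Obj C \<Longrightarrow> orthonormal_product C X X P r1 r2 \<Longrightarrow> d \<in> Hom C X P
       \<Longrightarrow> r1 \<circ>\<^bsub>C\<^esub> d = Ident C X \<Longrightarrow> r2 \<circ>\<^bsub>C\<^esub> d = Ident C X \<Longrightarrow> \<exists>f. is_kernel C f d"

section \<open>The order on Hermitian endomorphisms\<close>

text \<open>
  The canonical addition: \<open>f + g\<close> is the pairing \<open>h\<close> of \<open>f\<close> and \<open>g\<close> into an orthonormal product
  \<open>P\<close> of \<open>Y\<close> with itself, followed by the codiagonal \<open>n\<close>. The injections of the biproduct \<open>P\<close>
  are the adjoints of its projections. In a pre-Hilbert star-category the result does not depend
  on the choices, and every hom-set is an abelian group, so that both descriptions below
  determine unique morphisms.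
\<close>

definition arr_add :: "('o, 'm, 'x) star_category_scheme \<Rightarrow> 'm \<Rightarrow> 'm \<Rightarrow> 'm" where
  "arr_add C f g = (THE s. \<exists>P r1 r2 h n.
     orthonormal_product C (Cod C f) (Cod C f) P r1 r2 \<and>
     h \<in> Hom C (Dom C f) P \<and> r1 \<circ>\<^bsub>C\<^esub> h = f \<and> r2 \<circ>\<^bsub>C\<^esub> h = g \<and>
     n \<in> Hom C P (Cod C f) \<and> n \<circ>\<^bsub>C\<^esub> Star C r1 = Ident C (Cod C f) \<and>
     n \<circ>\<^bsub>C\<^esub> Star C r2 = Ident C (Cod C f) \<and>
     s = n \<circ>\<^bsub>C\<^esub> h)"

definition arr_diff :: "('o, 'm, 'x) star_category_scheme \<Rightarrow> 'm \<Rightarrow> 'm \<Rightarrow> 'm" where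
  "arr_diff C g f = (THE d. d \<in> Hom C (Dom C f) (Cod C f) \<and> arr_add C f d = g)"

definition Hermitian :: "('o, 'm, 'x) star_category_scheme \<Rightarrow> 'o \<Rightarrow> 'm set" where
  "Hermitian C A = {a \<in> Hom C A A. Star C a = a}"

definition herm_le :: "('o, 'm, 'x) star_category_scheme \<Rightarrow> 'o \<Rightarrow> 'm \<Rightarrow> 'm \<Rightarrow> bool" where
  "herm_le C A f g \<longleftrightarrow> f \<in> Hermitian C A \<and> g \<in> Hermitian C A
     \<and> (\<exists>X. \<exists>h \<in> Hom C A X. arr_diff C g f = Star C h \<circ>\<^bsub>C\<^esub> h)"

definition contraction :: "('o, 'm, 'x) star_category_scheme \<Rightarrow> 'm \<Rightarrow> bool" where
  "contraction C f \<longleftrightarrow> f \<in> Arr C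
     \<and> herm_le C (Dom C f) (Star C f \<circ>\<^bsub>C\<^esub> f) (Ident C (Dom C f))"

definition herm_upper_bound ::
    "('o, 'm, 'x) star_category_scheme \<Rightarrow> 'o \<Rightarrow> 'm set \<Rightarrow> 'm \<Rightarrow> bool" where
  "herm_upper_bound C A S b \<longleftrightarrow> b \<in> Hermitian C A \<and> (\<forall>a \<in> S. herm_le C A a b)"

definition herm_is_sup ::
    "('o, 'm, 'x) star_category_scheme \<Rightarrow> 'o \<Rightarrow> 'm set \<Rightarrow> 'm \<Rightarrow> bool" where
  "herm_is_sup C A S s \<longleftrightarrow> herm_upper_bound C A S s
     \<and> (\<forall>b. herm_upper_bound C A S b \<longrightarrow> herm_le C A s b)"

section \<open>Limits of codirected diagrams of contractions\<close>

locale directed_set =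
  fixes J :: "'j set" and leq :: "'j \<Rightarrow> 'j \<Rightarrow> bool"
  assumes directed_nonempty: "J \<noteq> {}"
    and directed_refl: "j \<in> J \<Longrightarrow> leq j j"
    and directed_trans: "j \<in> J \<Longrightarrow> k \<in> J \<Longrightarrow> l \<in> J \<Longrightarrow> leq j k \<Longrightarrow> leq k l \<Longrightarrow> leq j l"
    and directed_upper_bound: "j \<in> J \<Longrightarrow> k \<in> J \<Longrightarrow> \<exists>l \<in> J. leq j l \<and> leq k l"

text \<open>The transition morphism of the diagram for \<open>leq j k\<close> is \<open>f j k\<close>, from \<open>X k\<close> to \<open>X j\<close>.\<close>

locale codirected_diagram = directed_set J leq
  for C :: "('o, 'm, 'x) category_scheme" and J :: "'j set" and leq :: "'j \<Rightarrow> 'j \<Rightarrow> bool"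
    and X :: "'j \<Rightarrow> 'o" and f :: "'j \<Rightarrow> 'j \<Rightarrow> 'm" +
  assumes diagram_obj: "j \<in> J \<Longrightarrow> X j \<in> Obj C"
    and diagram_arr: "j \<in> J \<Longrightarrow> k \<in> J \<Longrightarrow> leq j k \<Longrightarrow> f j k \<in> Hom C (X k) (X j)"
    and diagram_Ident: "j \<in> J \<Longrightarrow> f j j = Ident C (X j)"
    and diagram_Comp: "j \<in> J \<Longrightarrow> k \<in> J \<Longrightarrow> l \<in> J \<Longrightarrow> leq j k \<Longrightarrow> leq k l
      \<Longrightarrow> f j k \<circ>\<^bsub>C\<^esub> f k l = f j l"

definition is_cone ::
    "('o, 'm, 'x) category_scheme \<Rightarrow> 'j set \<Rightarrow> ('j \<Rightarrow> 'j \<Rightarrow> bool) \<Rightarrow> ('j \<Rightarrow> 'o) \<Rightarrow> ('j \<Rightarrow> 'j \<Rightarrow> 'm)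
     \<Rightarrow> 'o \<Rightarrow> ('j \<Rightarrow> 'm) \<Rightarrow> bool" where
  "is_cone C J leq X f Y g \<longleftrightarrow> Y \<in> Obj C \<and> (\<forall>j \<in> J. g j \<in> Hom C Y (X j)) \<and>
     (\<forall>j \<in> J. \<forall>k \<in> J. leq j k \<longrightarrow> f j k \<circ>\<^bsub>C\<^esub> g k = g j)"

definition is_l2_cone ::
    "('o, 'm, 'x) star_category_scheme \<Rightarrow> 'j set \<Rightarrow> ('j \<Rightarrow> 'j \<Rightarrow> bool) \<Rightarrow> ('j \<Rightarrow> 'o)
     \<Rightarrow> ('j \<Rightarrow> 'j \<Rightarrow> 'm) \<Rightarrow> 'o \<Rightarrow> ('j \<Rightarrow> 'm) \<Rightarrow> bool" where
  "is_l2_cone C J leq X f Y g \<longleftrightarrow> is_cone C J leq X f Y g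
     \<and> (\<exists>b. herm_upper_bound C Y ((\<lambda>j. Star C (g j) \<circ>\<^bsub>C\<^esub> g j) ` J) b)"

definition is_l2_limit ::
    "('o, 'm, 'x) star_category_scheme \<Rightarrow> 'j set \<Rightarrow> ('j \<Rightarrow> 'j \<Rightarrow> bool) \<Rightarrow> ('j \<Rightarrow> 'o)
     \<Rightarrow> ('j \<Rightarrow> 'j \<Rightarrow> 'm) \<Rightarrow> 'o \<Rightarrow> ('j \<Rightarrow> 'm) \<Rightarrow> bool" where
  "is_l2_limit C J leq X f L p \<longleftrightarrow> is_l2_cone C J leq X f L p \<and>
     (\<forall>Y g. is_l2_cone C J leq X f Y g \<longrightarrow>
        (\<exists>!u. u \<in> Hom C Y L \<and> (\<forall>j \<in> J. p j \<circ>\<^bsub>C\<^esub> u = g j)) \<and>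
        (\<forall>u. u \<in> Hom C Y L \<longrightarrow> (\<forall>j \<in> J. p j \<circ>\<^bsub>C\<^esub> u = g j) \<longrightarrow>
           herm_is_sup C Y ((\<lambda>j. Star C (g j) \<circ>\<^bsub>C\<^esub> g j) ` J) (Star C u \<circ>\<^bsub>C\<^esub> u)))"

text \<open>
  Diagrams are indexed by small directed sets; \<open>\<I>\<close> is the collection of small index sets.
\<close>

locale hilbert_star_category = pre_hilbert_star_category C
  for \<I> :: "'j set set" and C :: "('o, 'm, 'x) star_category_scheme" +
  assumes ex_l2_limit:
    "J \<in> \<I> \<Longrightarrow> codirected_diagram C J leq X f
     \<Longrightarrow> (\<And>j k. j \<in> J \<Longrightarrow> k \<in> J \<Longrightarrow> leq j k \<Longrightarrow> contraction C (f j k))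
     \<Longrightarrow> \<exists>L p. is_l2_limit C J leq X f L p"

section \<open>Smallness\<close>

text \<open>
  The category of Hilbert spaces is formed relative to a notion of smallness: \<open>\<U>\<close> is the
  collection of sets that may carry a Hilbert space, and \<open>\<I>\<close> is the collection of sets that may
  index a diagram. All that is required is that the complex numbers are small and that, up to
  bijection, small sets are closed under subsets, binary products and products indexed by members
  of \<open>\<I>\<close>. The sets belonging to a Grothendieck universe satisfy this with \<open>\<I> = \<U>\<close>; this is the
  case of a single notion of smallness, for example the subsets of cardinality less than
  \<open>UNIV\<close> of a type of strongly inaccessible cardinality. The existence of such a type is not
  provable in HOL, but separating \<open>\<I>\<close> from \<open>\<U>\<close> gives instances without it: by
  \<open>small_sets_UNIV\<close> below, for arbitrary types \<open>'j\<close> (infinite) and \<open>'a\<close> there is a type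
  containing a copy of \<open>'a\<close> such that all of its subsets, together with all subsets of \<open>'j\<close> as
  index sets, are admissible.
\<close>

definition small_sets :: "'j set set \<Rightarrow> 'v set set \<Rightarrow> bool" where
  "small_sets \<I> \<U> \<longleftrightarrow>
     (\<exists>A \<in> \<U>. (UNIV :: complex set) \<lesssim> A) \<and>
     (\<forall>A \<in> \<U>. \<forall>B. B \<lesssim> A \<longrightarrow> B \<in> \<U>) \<and>
     (\<forall>A \<in> \<U>. \<forall>B \<in> \<U>. \<exists>D \<in> \<U>. A \<times> B \<lesssim> D) \<and>
     (\<forall>J \<in> \<I>. \<forall>A. (\<forall>j \<in> J. A j \<in> \<U>) \<longrightarrow> (\<exists>D \<in> \<U>. (\<Pi>\<^sub>E j \<in> J. A j) \<lesssim> D))"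

lemma small_sets_UNIV:
  assumes inf: "infinite (UNIV :: 'j set)"
  shows "small_sets (UNIV :: 'j set set) (UNIV :: ('j \<Rightarrow> 'a + complex) set set)"
proof -
  have "(card_of ((UNIV :: 'j set) \<times> (UNIV :: 'j set)), card_of (UNIV :: 'j set)) \<in> ordLeq"
    using card_of_Times_same_infinite[OF inf] ordIso_imp_ordLeq by blast
  then obtain p :: "'j \<times> 'j \<Rightarrow> 'j" where p: "inj p"
    unfolding card_of_ordLeq[symmetric] by auto
  have 1: "(UNIV :: complex set) \<lesssim> (UNIV :: ('j \<Rightarrow> 'a + complex) set)"
    unfolding lepoll_def
    by (rule exI[of _ "\<lambda>z _. Inr z"]) (auto simp: inj_on_def fun_eq_iff)
  have 3: "A \<lesssim> (UNIV :: ('j \<Rightarrow> 'a + complex) set)" for A :: "('j \<Rightarrow> 'j \<Rightarrow> 'a + complex) set"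
  proof -
    have "inj (\<lambda>(f :: 'j \<Rightarrow> 'j \<Rightarrow> 'a + complex) k. case inv_into UNIV p k of (a, b) \<Rightarrow> f a b)"
    proof (rule injI, intro ext)
      fix f g :: "'j \<Rightarrow> 'j \<Rightarrow> 'a + complex" and a b
      assume eq: "(\<lambda>k. case inv_into UNIV p k of (a, b) \<Rightarrow> f a b) = (\<lambda>k. case inv_into UNIV p k of (a, b) \<Rightarrow> g a b)"
      from fun_cong[OF eq, of "p (a, b)"] show "f a b = g a b"
        by (simp add: inv_into_f_f[OF p])
    qed
    then show ?thesis
      unfolding lepoll_def by (metis inj_on_subset subset_UNIV)
  qed
  obtain a b :: 'j where ab: "a \<noteq> b"
    using inf by (metis (full_types) UNIV_I ex_new_if_finite finite.emptyI finite.insertI singleton_iff)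
  have 2: "(A \<times> B) \<lesssim> (UNIV :: ('j \<Rightarrow> 'a + complex) set)"
    for A B :: "('j \<Rightarrow> 'a + complex) set"
  proof -
    have "inj_on (\<lambda>(f, g) k. if k = a then f else g) (A \<times> B)"
    proof (rule inj_onI)
      fix u v :: "('j \<Rightarrow> 'a + complex) \<times> ('j \<Rightarrow> 'a + complex)"
      assume eq: "(case u of (f, g) \<Rightarrow> \<lambda>k. if k = a then f else g)
        = (case v of (f, g) \<Rightarrow> \<lambda>k. if k = a then f else g)"
      from fun_cong[OF eq, of a] fun_cong[OF eq, of b] ab show "u = v"
        by (auto split: prod.splits)
    qed
    then have "A \<times> B \<lesssim> (UNIV :: ('j \<Rightarrow> 'j \<Rightarrow> 'a + complex) set)"
      unfolding lepoll_def by blast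
    then show ?thesis
      using 3 lepoll_trans by blast
  qed
  show ?thesis
    unfolding small_sets_def using 1 2 3 by blast
qed

section \<open>Complex Hilbert spaces\<close>

definition complex_ring :: "complex ring" where
  "complex_ring = \<lparr>carrier = UNIV, monoid.mult = (*), one = 1, zero = 0, add = (+)\<rparr>"

text \<open>
  As in \<open>HOL-Algebra.Module\<close>, the fields \<open>mult\<close> and \<open>one\<close> inherited from rings carry no meaning.
\<close>

record 'v hilb = "(complex, 'v) module" +
  hinner :: "'v \<Rightarrow> 'v \<Rightarrow> complex"

definition hnorm :: "('v, 'x) hilb_scheme \<Rightarrow> 'v \<Rightarrow> real" where
  "hnorm H x = sqrt (Re (hinner H x x))"

text \<open>
  The locale \<open>Metric_space\<close> imposes symmetry and nonnegativity also outside of the carrier,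
  hence the case distinction.
\<close>

definition hdist :: "('v, 'x) hilb_scheme \<Rightarrow> 'v \<Rightarrow> 'v \<Rightarrow> real" where
  "hdist H x y = (if x \<in> carrier H \<and> y \<in> carrier H then hnorm H (x \<ominus>\<^bsub>H\<^esub> y) else 0)"

locale hilbert_space = module complex_ring H for H :: "('v, 'x) hilb_scheme" +
  assumes hinner_add_left: "x \<in> carrier H \<Longrightarrow> y \<in> carrier H \<Longrightarrow> z \<in> carrier H
      \<Longrightarrow> hinner H (x \<oplus>\<^bsub>H\<^esub> y) z = hinner H x z + hinner H y z"
    and hinner_smult_left: "x \<in> carrier H \<Longrightarrow> y \<in> carrier H
      \<Longrightarrow> hinner H (c \<odot>\<^bsub>H\<^esub> x) y = c * hinner H x y"
    and hinner_commute: "x \<in> carrier H \<Longrightarrow> y \<in> carrier H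
      \<Longrightarrow> hinner H y x = cnj (hinner H x y)"
    and hinner_nonneg: "x \<in> carrier H \<Longrightarrow> 0 \<le> Re (hinner H x x)"
    and hinner_definite: "x \<in> carrier H \<Longrightarrow> hinner H x x = 0 \<Longrightarrow> x = \<zero>\<^bsub>H\<^esub>"
    and complete: "Metric_space.mcomplete (carrier H) (hdist H)"

definition bounded_linear_maps :: "'v hilb \<Rightarrow> 'v hilb \<Rightarrow> ('v \<Rightarrow> 'v) set" where
  "bounded_linear_maps H K = {f \<in> carrier H \<rightarrow>\<^sub>E carrier K.
     (\<forall>x \<in> carrier H. \<forall>y \<in> carrier H. f (x \<oplus>\<^bsub>H\<^esub> y) = f x \<oplus>\<^bsub>K\<^esub> f y) \<and>
     (\<forall>c. \<forall>x \<in> carrier H. f (c \<odot>\<^bsub>H\<^esub> x) = c \<odot>\<^bsub>K\<^esub> f x) \<and>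
     (\<exists>B. \<forall>x \<in> carrier H. hnorm K (f x) \<le> B * hnorm H x)}"

definition adjoint_map :: "'v hilb \<Rightarrow> 'v hilb \<Rightarrow> ('v \<Rightarrow> 'v) \<Rightarrow> ('v \<Rightarrow> 'v)" where
  "adjoint_map H K f = (THE g. g \<in> bounded_linear_maps K H \<and>
     (\<forall>x \<in> carrier H. \<forall>y \<in> carrier K. hinner K (f x) y = hinner H x (g y)))"

text \<open>A morphism is a triple consisting of its domain, the underlying map and its codomain.\<close>

definition Hilb :: "'v set set \<Rightarrow> ('v hilb, 'v hilb \<times> ('v \<Rightarrow> 'v) \<times> 'v hilb) star_category" where
  "Hilb \<U> =
     \<lparr>Obj = {H. hilbert_space H \<and> carrier H \<in> \<U>},
      Arr = {(H, f, K). hilbert_space H \<and> carrier H \<in> \<U> \<and> hilbert_space K \<and> carrier K \<in> \<U> \<and>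
               f \<in> bounded_linear_maps H K},
      Dom = (\<lambda>(H, f, K). H),
      Cod = (\<lambda>(H, f, K). K),
      Ident = (\<lambda>H. (H, restrict id (carrier H), H)),
      Comp = (\<lambda>(_, g, L) (H, f, _). (H, compose (carrier H) g f, L)),
      Star = (\<lambda>(H, f, K). (K, adjoint_map H K f, H))\<rparr>"

section \<open>Unitary representations\<close>

record ('o, 'm, 'p, 'n) star_functor =
  FObj :: "'o \<Rightarrow> 'p"
  FArr :: "'m \<Rightarrow> 'n"

text \<open>
  Functors and natural transformations are extensional, so that equality is equality on objects
  and morphisms of the domain category.
\<close>

definition star_functors :: "('o, 'm) star_category \<Rightarrow> ('p, 'n) star_category
    \<Rightarrow> ('o, 'm, 'p, 'n) star_functor set" where
  "star_functors A B = {F. FObj F \<in> Obj A \<rightarrow>\<^sub>E Obj B \<and> FArr F \<in> Arr A \<rightarrow>\<^sub>E Arr B \<and>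
     (\<forall>a \<in> Arr A. FArr F a \<in> Hom B (FObj F (Dom A a)) (FObj F (Cod A a))) \<and>
     (\<forall>X \<in> Obj A. FArr F (Ident A X) = Ident B (FObj F X)) \<and>
     (\<forall>X Y Z. \<forall>a \<in> Hom A X Y. \<forall>b \<in> Hom A Y Z.
        FArr F (b \<circ>\<^bsub>A\<^esub> a) = FArr F b \<circ>\<^bsub>B\<^esub> FArr F a) \<and>
     (\<forall>a \<in> Arr A. FArr F (Star A a) = Star B (FArr F a))}"

definition natural_transformations :: "('o, 'm) star_category \<Rightarrow> ('p, 'n) star_category
    \<Rightarrow> ('o, 'm, 'p, 'n) star_functor \<Rightarrow> ('o, 'm, 'p, 'n) star_functor \<Rightarrow> ('o \<Rightarrow> 'n) set" where
  "natural_transformations A B F F' = {t \<in> (\<Pi>\<^sub>E X \<in> Obj A. Hom B (FObj F X) (FObj F' X)).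
     \<forall>a \<in> Arr A. t (Cod A a) \<circ>\<^bsub>B\<^esub> FArr F a = FArr F' a \<circ>\<^bsub>B\<^esub> t (Dom A a)}"

definition functor_star_category :: "('o, 'm) star_category \<Rightarrow> ('p, 'n) star_category
    \<Rightarrow> (('o, 'm, 'p, 'n) star_functor,
        ('o, 'm, 'p, 'n) star_functor \<times> ('o \<Rightarrow> 'n) \<times> ('o, 'm, 'p, 'n) star_functor)
       star_category" where
  "functor_star_category A B =
     \<lparr>Obj = star_functors A B,
      Arr = {(F, t, F'). F \<in> star_functors A B \<and> F' \<in> star_functors A B \<and>
               t \<in> natural_transformations A B F F'},
      Dom = (\<lambda>(F, t, F'). F),
      Cod = (\<lambda>(F, t, F'). F'),
      Ident = (\<lambda>F. (F, \<lambda>X \<in> Obj A. Ident B (FObj F X), F)),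
      Comp = (\<lambda>(_, s, F'') (F, t, _). (F, \<lambda>X \<in> Obj A. s X \<circ>\<^bsub>B\<^esub> t X, F'')),
      Star = (\<lambda>(F, t, F'). (F', \<lambda>X \<in> Obj A. Star B (t X), F))\<rparr>"

definition URep where
  "URep \<U> G = functor_star_category (groupoid_star_category G) (Hilb \<U>)"

end

theory Submission
  imports Defs
begin

text \<open>
  Everything is pointwise in the objects \<open>x\<close> of \<open>G\<close>, except that pointwise constructions have to
  be compatible with the action of \<open>G\<close> and have to land in small sets.

  Pre-Hilbert structure. Kernels of intertwiners are invariant closed subspaces, orthonormal
  products are direct sums, and the diagonal of \<open>F\<close> is the kernel of the difference of the two
  projections of \<open>F \<oplus> F\<close>. Adjoints exist by the Riesz representation theorem, and the adjoint of
  an intertwiner of unitary representations is again an intertwiner (\<open>Star_Hom\<close>).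

  Order. The canonical addition turns out to be pointwise addition, so that \<open>f \<le> g\<close> means that
  \<open>g - f\<close> is of the form \<open>h\<^sup>* h\<close> for an intertwiner \<open>h\<close>. Clearly \<open>h\<^sup>* h\<close> is positive at every
  object. Conversely a pointwise positive intertwiner has a pointwise positive square root, and
  the family of square roots is an intertwiner, because the root is a limit of polynomials in the
  given operator and therefore commutes with the unitaries by which \<open>G\<close> acts
  (\<open>positive_intertwiner_factors\<close>). Hence \<open>f \<le> g\<close> means \<open>\<langle>f v, v\<rangle> \<le> \<langle>g v, v\<rangle>\<close> for all vectors \<open>v\<close>.
  There need be no bound that is uniform in \<open>x\<close>, and none is required.

  Limits. The limit of a codirected diagram of contractions consists at \<open>x\<close> of the threads
  \<open>(v\<^sub>j)\<close>, compatible with the transition maps, whose norms are bounded. The norms increase with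
  \<open>j\<close>, so by polarization \<open>\<langle>v, w\<rangle> = lim \<langle>v\<^sub>j, w\<^sub>j\<rangle>\<close> exists; it is a complete inner product with
  \<open>\<parallel>v\<parallel>\<^sup>2 = sup \<parallel>v\<^sub>j\<parallel>\<^sup>2\<close> (\<open>hilbert_family_threads\<close>). A cone \<open>(g\<^sub>j)\<close> sends a vector \<open>y\<close> to the thread
  \<open>(g\<^sub>j y)\<close>, which is bounded exactly because \<open>\<parallel>g\<^sub>j y\<parallel>\<^sup>2 = \<langle>g\<^sub>j\<^sup>* g\<^sub>j y, y\<rangle>\<close> is; and \<open>u\<^sup>* u\<close> is the
  supremum of the \<open>g\<^sub>j\<^sup>* g\<^sub>j\<close> since \<open>\<parallel>u y\<parallel>\<^sup>2 = sup \<parallel>g\<^sub>j y\<parallel>\<^sup>2\<close> and the order is pointwise.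

  Zero objects, products, kernels and limits are all Hilbert spaces of families of vectors. The
  locale \<open>hilbert_family\<close> and the lemmas \<open>ex_represents_family\<close> and \<open>ex1_mediating\<close> treat them
  uniformly: they provide completeness, the encoding of families as elements of a small set, the
  action of \<open>G\<close>, and the universal property.
\<close>

section \<open>Hilbert spaces on carrier sets\<close>

lemma cring_complex_ring: "cring complex_ring"
proof (rule cringI)
  show "abelian_group complex_ring"
    by (rule abelian_groupI) (auto simp: complex_ring_def intro: exI[of _ "- _"])
  show "comm_monoid complex_ring"
    by (rule comm_monoidI) (auto simp: complex_ring_def)
qed (simp add: complex_ring_def distrib_right)

lemma hdist_Metric_space_complete_iff:
  assumes "Metric_space (carrier H) (hdist H)"
  shows "Metric_space.mcomplete (carrier H) (hdist H) \<longleftrightarrow>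
    (\<forall>\<sigma>. range \<sigma> \<subseteq> carrier H \<longrightarrow>
       (\<forall>e>0. \<exists>N. \<forall>m\<ge>N. \<forall>n\<ge>N. hnorm H (\<sigma> m \<ominus>\<^bsub>H\<^esub> \<sigma> n) < e) \<longrightarrow>
       (\<exists>l\<in>carrier H. (\<lambda>n. hnorm H (\<sigma> n \<ominus>\<^bsub>H\<^esub> l)) \<longlonglongrightarrow> 0))"
proof -
  interpret Metric_space "carrier H" "hdist H" by fact
  have cau: "MCauchy \<sigma> \<longleftrightarrow> range \<sigma> \<subseteq> carrier H \<and>
      (\<forall>e>0. \<exists>N. \<forall>m\<ge>N. \<forall>n\<ge>N. hnorm H (\<sigma> m \<ominus>\<^bsub>H\<^esub> \<sigma> n) < e)" for \<sigma> :: "nat \<Rightarrow> 'a"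
    unfolding MCauchy_def by (auto simp: hdist_def image_subset_iff)
  have lim: "limitin mtopology \<sigma> l sequentially \<longleftrightarrow>
      l \<in> carrier H \<and> (\<lambda>n. hnorm H (\<sigma> n \<ominus>\<^bsub>H\<^esub> l)) \<longlonglongrightarrow> 0"
    if "range \<sigma> \<subseteq> carrier H" for \<sigma> :: "nat \<Rightarrow> 'a" and l
  proof -
    have "hdist H (\<sigma> n) l = hnorm H (\<sigma> n \<ominus>\<^bsub>H\<^esub> l)" if "l \<in> carrier H" for n
      using that \<open>range \<sigma> \<subseteq> carrier H\<close> by (auto simp: hdist_def)
    then show ?thesis
      using that unfolding limitin_metric_dist_null by (auto cong: conj_cong simp: image_subset_iff)
  qed
  show ?thesis
    unfolding mcomplete_def cau by (simp add: lim Bex_def imp_conjL cong: imp_cong)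
qed

text \<open>Hilbert spaces without completeness,
    for facts that are needed to state or prove completeness.\<close>

locale inner_product_space = module complex_ring H for H :: "('v, 'x) hilb_scheme" +
  assumes hinner_add_left: "x \<in> carrier H \<Longrightarrow> y \<in> carrier H \<Longrightarrow> z \<in> carrier H
      \<Longrightarrow> hinner H (x \<oplus>\<^bsub>H\<^esub> y) z = hinner H x z + hinner H y z"
    and hinner_smult_left: "x \<in> carrier H \<Longrightarrow> y \<in> carrier H
      \<Longrightarrow> hinner H (c \<odot>\<^bsub>H\<^esub> x) y = c * hinner H x y"
    and hinner_commute: "x \<in> carrier H \<Longrightarrow> y \<in> carrier H
      \<Longrightarrow> hinner H y x = cnj (hinner H x y)"
    and hinner_nonneg: "x \<in> carrier H \<Longrightarrow> 0 \<le> Re (hinner H x x)"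
    and hinner_definite: "x \<in> carrier H \<Longrightarrow> hinner H x x = 0 \<Longrightarrow> x = \<zero>\<^bsub>H\<^esub>"

text \<open>
  Identities between vectors are checked by pairing both sides with an arbitrary vector, which
  turns them into identities between complex numbers.
\<close>

context inner_product_space
begin

lemma smult_in [simp, intro]: "x \<in> carrier H \<Longrightarrow> c \<odot>\<^bsub>H\<^esub> x \<in> carrier H"
  by (simp add: complex_ring_def)

lemma hinner_zero_left [simp]: "y \<in> carrier H \<Longrightarrow> hinner H \<zero>\<^bsub>H\<^esub> y = 0"
  using hinner_add_left[of "\<zero>\<^bsub>H\<^esub>" "\<zero>\<^bsub>H\<^esub>" y] by simp

lemma hinner_minus_left [simp]:
  assumes "x \<in> carrier H" "y \<in> carrier H" "z \<in> carrier H"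
  shows "hinner H (x \<ominus>\<^bsub>H\<^esub> y) z = hinner H x z - hinner H y z"
proof -
  have "hinner H y z + hinner H (\<ominus>\<^bsub>H\<^esub> y) z = 0"
    using hinner_add_left[of y "\<ominus>\<^bsub>H\<^esub> y" z] assms by (simp add: r_neg)
  then show ?thesis
    using assms by (simp add: a_minus_def hinner_add_left add_eq_0_iff)
qed

lemmas hinner_left [simp] = hinner_add_left hinner_smult_left

lemma hinner_zero_right [simp]: "y \<in> carrier H \<Longrightarrow> hinner H y \<zero>\<^bsub>H\<^esub> = 0"
  by (subst hinner_commute) auto

lemma hinner_add_right [simp]:
  assumes "x \<in> carrier H" "y \<in> carrier H" "z \<in> carrier H"
  shows "hinner H z (x \<oplus>\<^bsub>H\<^esub> y) = hinner H z x + hinner H z y"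
  using assms hinner_commute[of "x \<oplus>\<^bsub>H\<^esub> y" z] hinner_commute[of x z] hinner_commute[of y z] by simp

lemma hinner_smult_right [simp]:
  assumes "x \<in> carrier H" "z \<in> carrier H"
  shows "hinner H z (c \<odot>\<^bsub>H\<^esub> x) = cnj c * hinner H z x"
  using assms hinner_commute[of "c \<odot>\<^bsub>H\<^esub> x" z] hinner_commute[of x z] by simp

lemma hinner_minus_right [simp]:
  assumes "x \<in> carrier H" "y \<in> carrier H" "z \<in> carrier H"
  shows "hinner H z (x \<ominus>\<^bsub>H\<^esub> y) = hinner H z x - hinner H z y"
  using assms hinner_commute[of "x \<ominus>\<^bsub>H\<^esub> y" z] hinner_commute[of x z] hinner_commute[of y z] by simp

lemma hinner_eqI:
  assumes "x \<in> carrier H" "y \<in> carrier H" "\<And>z. z \<in> carrier H \<Longrightarrow> hinner H x z = hinner H y z"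
  shows "x = y"
proof -
  have "hinner H (x \<ominus>\<^bsub>H\<^esub> y) (x \<ominus>\<^bsub>H\<^esub> y) = 0"
    using assms(1,2) assms(3)[of "x \<ominus>\<^bsub>H\<^esub> y"]
    by (simp del: hinner_minus_right)
  then have "x \<ominus>\<^bsub>H\<^esub> y = \<zero>\<^bsub>H\<^esub>"
    using assms(1,2) by (intro hinner_definite) auto
  then have "x = \<ominus>\<^bsub>H\<^esub> (\<ominus>\<^bsub>H\<^esub> y)"
    using assms(1,2) unfolding a_minus_def by (metis a_inv_closed minus_equality)
  then show ?thesis
    using assms(2) by simp
qed

lemma hminus_self [simp]: "x \<in> carrier H \<Longrightarrow> x \<ominus>\<^bsub>H\<^esub> x = \<zero>\<^bsub>H\<^esub>"
  by (intro hinner_eqI) auto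

lemma hminus_eq_zero_iff:
  assumes "x \<in> carrier H" "y \<in> carrier H"
  shows "x \<ominus>\<^bsub>H\<^esub> y = \<zero>\<^bsub>H\<^esub> \<longleftrightarrow> x = y"
proof
  assume *: "x \<ominus>\<^bsub>H\<^esub> y = \<zero>\<^bsub>H\<^esub>"
  show "x = y"
  proof (rule hinner_eqI)
    fix z assume "z \<in> carrier H"
    then show "hinner H x z = hinner H y z"
      using assms arg_cong[OF *, of "\<lambda>v. hinner H v z"] by simp
  qed fact+
qed (use assms in simp)

lemma hinner_self: "x \<in> carrier H \<Longrightarrow> hinner H x x = of_real ((hnorm H x)\<^sup>2)"
  using hinner_commute[of x x] hinner_nonneg[of x]
  by (auto simp: hnorm_def complex_eq_iff)

lemma hnorm_sq: "x \<in> carrier H \<Longrightarrow> (hnorm H x)\<^sup>2 = Re (hinner H x x)"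
  by (simp add: hnorm_def hinner_nonneg)

lemma hnorm_nonneg [simp]: "x \<in> carrier H \<Longrightarrow> 0 \<le> hnorm H x"
  by (simp add: hnorm_def hinner_nonneg)

lemma hnorm_eq_0: "x \<in> carrier H \<Longrightarrow> hnorm H x = 0 \<longleftrightarrow> x = \<zero>\<^bsub>H\<^esub>"
  using hinner_self[of x] hinner_definite[of x] by (auto simp: hnorm_def)

lemma hnorm_zero [simp]: "hnorm H \<zero>\<^bsub>H\<^esub> = 0"
  by (simp add: hnorm_eq_0)

lemma hnorm_smult [simp]:
  assumes "x \<in> carrier H" shows "hnorm H (c \<odot>\<^bsub>H\<^esub> x) = cmod c * hnorm H x"
proof -
  have "hinner H (c \<odot>\<^bsub>H\<^esub> x) (c \<odot>\<^bsub>H\<^esub> x) = of_real ((cmod c * hnorm H x)\<^sup>2)"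
    using assms hinner_self[of x] complex_norm_square[of c]
    by (simp add: power_mult_distrib mult_ac)
  then show ?thesis
    using assms by (simp add: hnorm_def[of H "c \<odot>\<^bsub>H\<^esub> x"] flip: of_real_mult of_real_power)
qed

lemma hnorm_minus_sq:
  assumes "x \<in> carrier H" "y \<in> carrier H"
  shows "(hnorm H (x \<ominus>\<^bsub>H\<^esub> y))\<^sup>2 = (hnorm H x)\<^sup>2 - 2 * Re (hinner H x y) + (hnorm H y)\<^sup>2"
  using assms hinner_commute[of x y] by (simp add: hnorm_sq)

lemma hnorm_add_sq:
  assumes "x \<in> carrier H" "y \<in> carrier H"
  shows "(hnorm H (x \<oplus>\<^bsub>H\<^esub> y))\<^sup>2 = (hnorm H x)\<^sup>2 + 2 * Re (hinner H x y) + (hnorm H y)\<^sup>2"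
  using assms hinner_commute[of x y] by (simp add: hnorm_sq)

lemma Cauchy_Schwarz:
  assumes "x \<in> carrier H" "y \<in> carrier H"
  shows "cmod (hinner H x y) \<le> hnorm H x * hnorm H y"
proof (cases "y = \<zero>\<^bsub>H\<^esub>")
  case False
  define c where "c = hinner H x y"
  define n where "n = hnorm H y"
  have n: "n > 0"
    using False assms hnorm_eq_0 hnorm_nonneg n_def by (metis less_eq_real_def)
  have "0 \<le> (hnorm H (x \<ominus>\<^bsub>H\<^esub> (c / of_real (n\<^sup>2)) \<odot>\<^bsub>H\<^esub> y))\<^sup>2"
    by simp
  also have "\<dots> = (hnorm H x)\<^sup>2 - (cmod c)\<^sup>2 / n\<^sup>2"
  proof -
    have "Re (hinner H x ((c / of_real (n\<^sup>2)) \<odot>\<^bsub>H\<^esub> y)) = (cmod c)\<^sup>2 / n\<^sup>2"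
      using assms c_def[symmetric] cmod_power2[of c]
      by (simp flip: of_real_power) (simp add: power2_eq_square add_divide_distrib c_def)
    moreover have "(hnorm H ((c / of_real (n\<^sup>2)) \<odot>\<^bsub>H\<^esub> y))\<^sup>2 = (cmod c)\<^sup>2 / n\<^sup>2"
      using assms n by (simp flip: n_def add: norm_divide power_mult_distrib power_divide
          norm_power field_simps)
    ultimately show ?thesis
      using assms hnorm_minus_sq[OF assms(1) smult_in[OF assms(2)], of "c / of_real (n\<^sup>2)"]
      by linarith
  qed
  finally have "(cmod c)\<^sup>2 \<le> (hnorm H x * n)\<^sup>2"
    using n by (simp add: field_simps)
  then show ?thesis
    using assms n c_def n_def by (metis hnorm_nonneg mult_nonneg_nonneg power2_le_imp_le)
qed (use assms in simp)

lemma hnorm_triangle: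
  assumes "x \<in> carrier H" "y \<in> carrier H"
  shows "hnorm H (x \<oplus>\<^bsub>H\<^esub> y) \<le> hnorm H x + hnorm H y"
proof (rule power2_le_imp_le)
  have "Re (hinner H x y) \<le> hnorm H x * hnorm H y"
    using Cauchy_Schwarz[OF assms] complex_Re_le_cmod order_trans by blast
  then show "(hnorm H (x \<oplus>\<^bsub>H\<^esub> y))\<^sup>2 \<le> (hnorm H x + hnorm H y)\<^sup>2"
    using assms by (simp add: hnorm_add_sq power2_sum)
qed (use assms in simp)

lemma hnorm_minus_commute:
  assumes "x \<in> carrier H" "y \<in> carrier H"
  shows "hnorm H (x \<ominus>\<^bsub>H\<^esub> y) = hnorm H (y \<ominus>\<^bsub>H\<^esub> x)"
  using assms hinner_commute[of x y] by (simp add: hnorm_def algebra_simps)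

lemma hnorm_triangle_minus:
  assumes "x \<in> carrier H" "y \<in> carrier H" "z \<in> carrier H"
  shows "hnorm H (x \<ominus>\<^bsub>H\<^esub> z) \<le> hnorm H (x \<ominus>\<^bsub>H\<^esub> y) + hnorm H (y \<ominus>\<^bsub>H\<^esub> z)"
proof -
  have "x \<ominus>\<^bsub>H\<^esub> z = (x \<ominus>\<^bsub>H\<^esub> y) \<oplus>\<^bsub>H\<^esub> (y \<ominus>\<^bsub>H\<^esub> z)"
    using assms by (intro hinner_eqI) auto
  then show ?thesis
    using assms hnorm_triangle[of "x \<ominus>\<^bsub>H\<^esub> y" "y \<ominus>\<^bsub>H\<^esub> z"] by simp
qed

lemma hnorm_le_add_minus:
  assumes "x \<in> carrier H" "y \<in> carrier H"
  shows "hnorm H x \<le> hnorm H y + hnorm H (x \<ominus>\<^bsub>H\<^esub> y)"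
proof -
  have "x = y \<oplus>\<^bsub>H\<^esub> (x \<ominus>\<^bsub>H\<^esub> y)"
    using assms by (intro hinner_eqI) auto
  then show ?thesis
    using assms hnorm_triangle[of y "x \<ominus>\<^bsub>H\<^esub> y"] by simp
qed

lemma Metric_space_hdist: "Metric_space (carrier H) (hdist H)"
proof
  show "hdist H x y = hdist H y x" for x y
    by (auto simp: hdist_def intro: hnorm_minus_commute)
  show "0 \<le> hdist H x y" for x y
    by (auto simp: hdist_def)
qed (auto simp: hdist_def hnorm_eq_0 hnorm_triangle_minus hminus_eq_zero_iff)

lemma tendsto_hinner:
  assumes "\<And>n. \<sigma> n \<in> carrier H" "l \<in> carrier H" "(\<lambda>n. hnorm H (\<sigma> n \<ominus>\<^bsub>H\<^esub> l)) \<longlonglongrightarrow> 0"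
    and "z \<in> carrier H"
  shows "(\<lambda>n. hinner H (\<sigma> n) z) \<longlonglongrightarrow> hinner H l z"
proof -
  have "(\<lambda>n. hinner H (\<sigma> n) z - hinner H l z) \<longlonglongrightarrow> 0"
  proof (rule Lim_null_comparison)
    show "\<forall>\<^sub>F n in sequentially. cmod (hinner H (\<sigma> n) z - hinner H l z) \<le> hnorm H (\<sigma> n
        \<ominus>\<^bsub>H\<^esub> l) * hnorm H z"
      using assms Cauchy_Schwarz
      by (intro always_eventually allI) (metis hinner_minus_left minus_closed)
    show "(\<lambda>n. hnorm H (\<sigma> n \<ominus>\<^bsub>H\<^esub> l) * hnorm H z) \<longlonglongrightarrow> 0"
      using assms(3) by (rule tendsto_mult_left_zero)
  qed
  then show ?thesis
    by (simp add: LIM_zero_iff)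
qed

lemma tendsto_hnorm:
  assumes "\<And>n. \<sigma> n \<in> carrier H" "l \<in> carrier H" "(\<lambda>n. hnorm H (\<sigma> n \<ominus>\<^bsub>H\<^esub> l)) \<longlonglongrightarrow> 0"
  shows "(\<lambda>n. hnorm H (\<sigma> n)) \<longlonglongrightarrow> hnorm H l"
proof -
  have "\<bar>hnorm H (\<sigma> n) - hnorm H l\<bar> \<le> hnorm H (\<sigma> n \<ominus>\<^bsub>H\<^esub> l)" for n
    using assms(1,2) hnorm_le_add_minus[of "\<sigma> n" l] hnorm_le_add_minus[of l "\<sigma> n"]
      hnorm_minus_commute[of "\<sigma> n" l] by fastforce
  then have "(\<lambda>n. hnorm H (\<sigma> n) - hnorm H l) \<longlonglongrightarrow> 0"
    using assms(3) by (intro Lim_null_comparison[OF _ assms(3)]) (auto intro: always_eventually)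
  then show ?thesis
    by (simp add: LIM_zero_iff)
qed

end

sublocale hilbert_space \<subseteq> inner_product_space
  by unfold_locales
    (fact hinner_add_left hinner_smult_left hinner_commute hinner_nonneg hinner_definite)+

lemma (in hilbert_space) Cauchy_converges:
  assumes "\<And>n. \<sigma> n \<in> carrier H"
    and "\<And>e. e > 0 \<Longrightarrow> \<exists>N. \<forall>m\<ge>N. \<forall>n\<ge>N. hnorm H (\<sigma> m \<ominus>\<^bsub>H\<^esub> \<sigma> n) < e"
  obtains l where "l \<in> carrier H" "(\<lambda>n. hnorm H (\<sigma> n \<ominus>\<^bsub>H\<^esub> l)) \<longlonglongrightarrow> 0"
proof -
  have "range \<sigma> \<subseteq> carrier H"
    using assms(1) by auto
  then have "\<exists>l\<in>carrier H. (\<lambda>n. hnorm H (\<sigma> n \<ominus>\<^bsub>H\<^esub> l)) \<longlonglongrightarrow> 0"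
    using complete[unfolded hdist_Metric_space_complete_iff[OF Metric_space_hdist], rule_format,
        of \<sigma>]
      assms(2) by simp
  then show thesis
    using that by blast
qed

text \<open>The axioms spelled out, with differences written as \<open>x + (-1) y\<close>.\<close>

lemma hilbert_spaceI:
  assumes zero: "\<zero>\<^bsub>H\<^esub> \<in> carrier H"
    and add: "\<And>x y. x \<in> carrier H \<Longrightarrow> y \<in> carrier H \<Longrightarrow> x \<oplus>\<^bsub>H\<^esub> y \<in> carrier H"
    and smult: "\<And>c x. x \<in> carrier H \<Longrightarrow> c \<odot>\<^bsub>H\<^esub> x \<in> carrier H"
    and assoc: "\<And>x y z. x \<in> carrier H \<Longrightarrow> y \<in> carrier H \<Longrightarrow> z \<in> carrier H \<Longrightarrow>
      (x \<oplus>\<^bsub>H\<^esub> y) \<oplus>\<^bsub>H\<^esub> z = x \<oplus>\<^bsub>H\<^esub> (y \<oplus>\<^bsub>H\<^esub> z)"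
    and comm: "\<And>x y. x \<in> carrier H \<Longrightarrow> y \<in> carrier H \<Longrightarrow> x \<oplus>\<^bsub>H\<^esub> y = y \<oplus>\<^bsub>H\<^esub> x"
    and zero_left: "\<And>x. x \<in> carrier H \<Longrightarrow> \<zero>\<^bsub>H\<^esub> \<oplus>\<^bsub>H\<^esub> x = x"
    and neg: "\<And>x. x \<in> carrier H \<Longrightarrow> (-1) \<odot>\<^bsub>H\<^esub> x \<oplus>\<^bsub>H\<^esub> x = \<zero>\<^bsub>H\<^esub>"
    and distr_l: "\<And>a b x. x \<in> carrier H \<Longrightarrow> (a + b) \<odot>\<^bsub>H\<^esub> x = a \<odot>\<^bsub>H\<^esub> x \<oplus>\<^bsub>H\<^esub> b \<odot>\<^bsub>H\<^esub> x"
    and distr_r: "\<And>a x y. x \<in> carrier H \<Longrightarrow> y \<in> carrier H \<Longrightarrow>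
      a \<odot>\<^bsub>H\<^esub> (x \<oplus>\<^bsub>H\<^esub> y) = a \<odot>\<^bsub>H\<^esub> x \<oplus>\<^bsub>H\<^esub> a \<odot>\<^bsub>H\<^esub> y"
    and smult_assoc: "\<And>a b x. x \<in> carrier H \<Longrightarrow> (a * b) \<odot>\<^bsub>H\<^esub> x = a \<odot>\<^bsub>H\<^esub> (b \<odot>\<^bsub>H\<^esub> x)"
    and smult_one: "\<And>x. x \<in> carrier H \<Longrightarrow> 1 \<odot>\<^bsub>H\<^esub> x = x"
    and ip_add: "\<And>x y z. x \<in> carrier H \<Longrightarrow> y \<in> carrier H \<Longrightarrow> z \<in> carrier H \<Longrightarrow>
      hinner H (x \<oplus>\<^bsub>H\<^esub> y) z = hinner H x z + hinner H y z"
    and ip_smult: "\<And>c x y. x \<in> carrier H \<Longrightarrow> y \<in> carrier H \<Longrightarrow>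
      hinner H (c \<odot>\<^bsub>H\<^esub> x) y = c * hinner H x y"
    and ip_commute: "\<And>x y. x \<in> carrier H \<Longrightarrow> y \<in> carrier H \<Longrightarrow> hinner H y x = cnj (hinner H x y)"
    and ip_nonneg: "\<And>x. x \<in> carrier H \<Longrightarrow> 0 \<le> Re (hinner H x x)"
    and ip_definite: "\<And>x. x \<in> carrier H \<Longrightarrow> hinner H x x = 0 \<Longrightarrow> x = \<zero>\<^bsub>H\<^esub>"
    and cauchy: "\<And>\<sigma>. (\<And>n. \<sigma> n \<in> carrier H) \<Longrightarrow>
      (\<And>e. e > 0 \<Longrightarrow> \<exists>N. \<forall>m\<ge>N. \<forall>n\<ge>N. hnorm H (\<sigma> m \<oplus>\<^bsub>H\<^esub> (-1) \<odot>\<^bsub>H\<^esub> \<sigma> n) < e) \<Longrightarrow>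
      \<exists>l\<in>carrier H. (\<lambda>n. hnorm H (\<sigma> n \<oplus>\<^bsub>H\<^esub> (-1) \<odot>\<^bsub>H\<^esub> l)) \<longlonglongrightarrow> 0"
  shows "hilbert_space H"
proof -
  have group: "abelian_group H"
  proof (rule abelian_groupI)
    show "\<exists>y\<in>carrier H. y \<oplus>\<^bsub>H\<^esub> x = \<zero>\<^bsub>H\<^esub>" if "x \<in> carrier H" for x
      using neg smult that by blast
    show "x \<oplus>\<^bsub>H\<^esub> y = y \<oplus>\<^bsub>H\<^esub> x" if "x \<in> carrier H" "y \<in> carrier H" for x y
      using comm that by blast
  qed (simp_all only: zero add assoc zero_left)
  have "module complex_ring H"
    by (rule moduleI)
      (simp_all add: group cring_complex_ring, simp_all add: complex_ring_def smult distr_l distr_r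
        smult_assoc smult_one)
  then interpret inner_product_space H
    by (rule inner_product_space.intro)
      (rule inner_product_space_axioms.intro,
        fact ip_add, fact ip_smult, fact ip_commute, fact ip_nonneg, fact ip_definite)
  have minus: "x \<ominus>\<^bsub>H\<^esub> y = x \<oplus>\<^bsub>H\<^esub> (-1) \<odot>\<^bsub>H\<^esub> y" if "x \<in> carrier H" "y \<in> carrier H" for x y
    using that by (intro hinner_eqI) auto
  show ?thesis
  proof (rule hilbert_space.intro)
    have "Metric_space.mcomplete (carrier H) (hdist H)"
      unfolding hdist_Metric_space_complete_iff[OF Metric_space_hdist]
    proof (intro allI impI)
      fix \<sigma> :: "nat \<Rightarrow> 'a"
      assume *: "range \<sigma> \<subseteq> carrier H" "\<forall>e>0. \<exists>N. \<forall>m\<ge>N. \<forall>n\<ge>N. hnorm H (\<sigma> m \<ominus>\<^bsub>H\<^esub> \<sigma> n) < e"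
      then have "\<exists>l\<in>carrier H. (\<lambda>n. hnorm H (\<sigma> n \<oplus>\<^bsub>H\<^esub> (-1) \<odot>\<^bsub>H\<^esub> l)) \<longlonglongrightarrow> 0"
        by (intro cauchy) (auto simp: image_subset_iff simp flip: minus)
      then show "\<exists>l\<in>carrier H. (\<lambda>n. hnorm H (\<sigma> n \<ominus>\<^bsub>H\<^esub> l)) \<longlonglongrightarrow> 0"
        using *(1) by (auto simp: image_subset_iff minus)
    qed
    then show "hilbert_space_axioms H"
      by (intro hilbert_space_axioms.intro ip_add ip_smult ip_commute ip_nonneg ip_definite)
  qed unfold_locales
qed


lemma (in inner_product_space) tendsto_hinner_both:
  assumes "\<And>n. \<sigma> n \<in> carrier H" "l \<in> carrier H" "(\<lambda>n. hnorm H (\<sigma> n \<ominus>\<^bsub>H\<^esub> l)) \<longlonglongrightarrow> 0"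
    and "\<And>n. \<tau> n \<in> carrier H" "m \<in> carrier H" "(\<lambda>n. hnorm H (\<tau> n \<ominus>\<^bsub>H\<^esub> m)) \<longlonglongrightarrow> 0"
  shows "(\<lambda>n. hinner H (\<sigma> n) (\<tau> n)) \<longlonglongrightarrow> hinner H l m"
proof -
  have "(\<lambda>n. hinner H (\<sigma> n) (\<tau> n \<ominus>\<^bsub>H\<^esub> m)) \<longlonglongrightarrow> 0"
  proof (rule Lim_null_comparison)
    show "\<forall>\<^sub>F n in sequentially. cmod (hinner H (\<sigma> n) (\<tau> n \<ominus>\<^bsub>H\<^esub> m)) \<le> hnorm H (\<sigma> n) * hnorm H (\<tau> n
        \<ominus>\<^bsub>H\<^esub> m)"
      by (intro always_eventually allI Cauchy_Schwarz minus_closed assms)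
    show "(\<lambda>n. hnorm H (\<sigma> n) * hnorm H (\<tau> n \<ominus>\<^bsub>H\<^esub> m)) \<longlonglongrightarrow> 0"
      using tendsto_mult[OF tendsto_hnorm[OF assms(1-3)] assms(6)] by simp
  qed
  from tendsto_add[OF this tendsto_hinner[OF assms(1-3,5)]] show ?thesis
    using assms by simp
qed

section \<open>Bounded linear maps and their adjoints\<close>

text \<open>
  Bounded linearity on the carrier, with no condition on the values outside of it; the elements of
  \<open>bounded_linear_maps\<close> are the extensional maps with this property.
\<close>

definition blin :: "'v hilb \<Rightarrow> 'v hilb \<Rightarrow> ('v \<Rightarrow> 'v) \<Rightarrow> bool" where
  "blin H K f \<longleftrightarrow> (\<forall>x\<in>carrier H. f x \<in> carrier K) \<and>
     (\<forall>x\<in>carrier H. \<forall>y\<in>carrier H. f (x \<oplus>\<^bsub>H\<^esub> y) = f x \<oplus>\<^bsub>K\<^esub> f y) \<and>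
     (\<forall>c. \<forall>x\<in>carrier H. f (c \<odot>\<^bsub>H\<^esub> x) = c \<odot>\<^bsub>K\<^esub> f x) \<and>
     (\<exists>B. \<forall>x\<in>carrier H. hnorm K (f x) \<le> B * hnorm H x)"

lemma bounded_linear_maps_iff:
  "f \<in> bounded_linear_maps H K \<longleftrightarrow> f \<in> extensional (carrier H) \<and> blin H K f"
  by (auto simp: bounded_linear_maps_def blin_def PiE_def)

lemma blin_cong:
  assumes "hilbert_space H" and eq: "\<And>x. x \<in> carrier H \<Longrightarrow> f x = g x"
  shows "blin H K f \<longleftrightarrow> blin H K g"
proof -
  interpret hilbert_space H by fact
  show ?thesis
    unfolding blin_def by (simp add: eq)
qed

lemma restrict_in_bounded_linear_maps:
  "hilbert_space H \<Longrightarrow> blin H K f \<Longrightarrow> restrict f (carrier H) \<in> bounded_linear_maps H K"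
  by (simp add: bounded_linear_maps_iff) (subst blin_cong[of H _ f], auto)

lemma blin_closed: "blin H K f \<Longrightarrow> x \<in> carrier H \<Longrightarrow> f x \<in> carrier K"
  by (simp add: blin_def)

lemma blin_add_vec: "blin H K f \<Longrightarrow> x \<in> carrier H \<Longrightarrow> y \<in> carrier H \<Longrightarrow> f (x \<oplus>\<^bsub>H\<^esub> y) = f x \<oplus>\<^bsub>K\<^esub> f y"
  by (simp add: blin_def)

lemma blin_smult_vec: "blin H K f \<Longrightarrow> x \<in> carrier H \<Longrightarrow> f (c \<odot>\<^bsub>H\<^esub> x) = c \<odot>\<^bsub>K\<^esub> f x"
  by (simp add: blin_def)

lemma blin_bound:
  assumes "hilbert_space H" "hilbert_space K" "blin H K f"
  obtains B where "B > 0" "\<And>x. x \<in> carrier H \<Longrightarrow> hnorm K (f x) \<le> B * hnorm H x"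
proof -
  interpret H: hilbert_space H by fact
  obtain B where B: "\<And>x. x \<in> carrier H \<Longrightarrow> hnorm K (f x) \<le> B * hnorm H x"
    using assms(3) unfolding blin_def by metis
  have "hnorm K (f x) \<le> (\<bar>B\<bar> + 1) * hnorm H x" if "x \<in> carrier H" for x
    by (rule order_trans[OF B[OF that]]) (use that in \<open>intro mult_right_mono, auto\<close>)
  then show thesis
    using that[of "\<bar>B\<bar> + 1"] by auto
qed

lemma (in inner_product_space) minus_conv_smult:
  "x \<in> carrier H \<Longrightarrow> y \<in> carrier H \<Longrightarrow> x \<ominus>\<^bsub>H\<^esub> y = x \<oplus>\<^bsub>H\<^esub> (-1) \<odot>\<^bsub>H\<^esub> y"
  by (intro hinner_eqI) auto

lemma blin_minus_vec:
  assumes "hilbert_space H" "hilbert_space K" "blin H K f" "x \<in> carrier H" "y \<in> carrier H"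
  shows "f (x \<ominus>\<^bsub>H\<^esub> y) = f x \<ominus>\<^bsub>K\<^esub> f y"
proof -
  interpret H: hilbert_space H by fact
  interpret K: hilbert_space K by fact
  show ?thesis
    using assms(3-5)
    by (simp add: H.minus_conv_smult K.minus_conv_smult blin_closed blin_add_vec blin_smult_vec)
qed

lemma blin_zero_vec:
  assumes "hilbert_space H" "hilbert_space K" "blin H K f"
  shows "f \<zero>\<^bsub>H\<^esub> = \<zero>\<^bsub>K\<^esub>"
proof -
  interpret H: hilbert_space H by fact
  interpret K: hilbert_space K by fact
  show ?thesis
    using blin_minus_vec[OF assms, of "\<zero>\<^bsub>H\<^esub>" "\<zero>\<^bsub>H\<^esub>"] blin_closed[OF assms(3), of "\<zero>\<^bsub>H\<^esub>"] by simp
qed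

lemma blin_id: "blin H H (\<lambda>x. x)"
  unfolding blin_def by (auto intro: exI[of _ 1])

lemma blin_zero:
  assumes "hilbert_space H" "hilbert_space K"
  shows "blin H K (\<lambda>_. \<zero>\<^bsub>K\<^esub>)"
proof -
  interpret H: hilbert_space H by fact
  interpret K: hilbert_space K by fact
  have "c \<odot>\<^bsub>K\<^esub> \<zero>\<^bsub>K\<^esub> = \<zero>\<^bsub>K\<^esub>" for c
    by (intro K.hinner_eqI) auto
  then show ?thesis
    unfolding blin_def by (auto intro: exI[of _ 0])
qed

lemma blin_comp:
  assumes "hilbert_space H" "hilbert_space K" "hilbert_space L" "blin H K f" "blin K L g"
  shows "blin H L (\<lambda>x. g (f x))"
proof -
  interpret H: hilbert_space H by fact
  interpret K: hilbert_space K by fact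
  obtain B where B: "B > 0" "\<And>x. x \<in> carrier H \<Longrightarrow> hnorm K (f x) \<le> B * hnorm H x"
    using blin_bound[OF assms(1,2,4)] by metis
  obtain C where C: "C > 0" "\<And>x. x \<in> carrier K \<Longrightarrow> hnorm L (g x) \<le> C * hnorm K x"
    using blin_bound[OF assms(2,3,5)] by metis
  have "hnorm L (g (f x)) \<le> (C * B) * hnorm H x" if "x \<in> carrier H" for x
    using C(2)[OF blin_closed[OF assms(4) that]] mult_left_mono[OF B(2)[OF that], of C] C(1)
    unfolding mult.assoc by linarith
  then show ?thesis
    using assms(4,5) unfolding blin_def by auto
qed

lemma blin_combination:
  assumes "hilbert_space H" "hilbert_space K" "blin H K f" "blin H K g"
  shows "blin H K (\<lambda>x. a \<odot>\<^bsub>K\<^esub> f x \<oplus>\<^bsub>K\<^esub> b \<odot>\<^bsub>K\<^esub> g x)"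
proof -
  interpret H: hilbert_space H by fact
  interpret K: hilbert_space K by fact
  obtain B where B: "B > 0" "\<And>x. x \<in> carrier H \<Longrightarrow> hnorm K (f x) \<le> B * hnorm H x"
    using blin_bound[OF assms(1,2,3)] by metis
  obtain C where C: "C > 0" "\<And>x. x \<in> carrier H \<Longrightarrow> hnorm K (g x) \<le> C * hnorm H x"
    using blin_bound[OF assms(1,2,4)] by metis
  have cl: "f x \<in> carrier K" "g x \<in> carrier K" if "x \<in> carrier H" for x
    using that assms blin_closed by metis+
  have "hnorm K (a \<odot>\<^bsub>K\<^esub> f x \<oplus>\<^bsub>K\<^esub> b \<odot>\<^bsub>K\<^esub> g x) \<le> (cmod a * B + cmod b * C) * hnorm H x"
    if "x \<in> carrier H" for x
  proof -
    have "hnorm K (a \<odot>\<^bsub>K\<^esub> f x \<oplus>\<^bsub>K\<^esub> b \<odot>\<^bsub>K\<^esub> g x) \<le> cmod a * hnorm K (f x) + cmod b * hnorm K (g x)"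
      using K.hnorm_triangle[of "a \<odot>\<^bsub>K\<^esub> f x" "b \<odot>\<^bsub>K\<^esub> g x"] cl[OF that] by simp
    also have "\<dots> \<le> cmod a * (B * hnorm H x) + cmod b * (C * hnorm H x)"
      by (intro add_mono mult_left_mono B C that) auto
    finally show ?thesis
      by (simp add: algebra_simps)
  qed
  note bound = this
  have add: "a \<odot>\<^bsub>K\<^esub> f (x \<oplus>\<^bsub>H\<^esub> y) \<oplus>\<^bsub>K\<^esub> b \<odot>\<^bsub>K\<^esub> g (x \<oplus>\<^bsub>H\<^esub> y) =
      (a \<odot>\<^bsub>K\<^esub> f x \<oplus>\<^bsub>K\<^esub> b \<odot>\<^bsub>K\<^esub> g x) \<oplus>\<^bsub>K\<^esub> (a \<odot>\<^bsub>K\<^esub> f y \<oplus>\<^bsub>K\<^esub> b \<odot>\<^bsub>K\<^esub> g y)"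
    if "x \<in> carrier H" "y \<in> carrier H" for x y
    using that cl[OF that(1)] cl[OF that(2)]
    by (intro K.hinner_eqI) (simp_all add: blin_add_vec[OF assms(3)] blin_add_vec[OF assms(4)]
        algebra_simps)
  have smult: "a \<odot>\<^bsub>K\<^esub> f (c \<odot>\<^bsub>H\<^esub> x) \<oplus>\<^bsub>K\<^esub> b \<odot>\<^bsub>K\<^esub> g (c \<odot>\<^bsub>H\<^esub> x) =
      c \<odot>\<^bsub>K\<^esub> (a \<odot>\<^bsub>K\<^esub> f x \<oplus>\<^bsub>K\<^esub> b \<odot>\<^bsub>K\<^esub> g x)" if "x \<in> carrier H" for c x
    using that cl[OF that]
    by (intro K.hinner_eqI) (simp_all add: blin_smult_vec[OF assms(3)] blin_smult_vec[OF assms(4)]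
        algebra_simps)
  show ?thesis
    unfolding blin_def
  proof (intro conjI ballI allI exI)
  qed (use cl in simp, rule add, assumption+, rule smult, assumption, rule bound, assumption)
qed

lemma nonneg_quadratic_imp_zero:
  fixes a b :: real
  assumes "a \<ge> 0" "\<And>t. 0 \<le> t\<^sup>2 * a + 2 * t * b"
  shows "b = 0"
proof -
  define s where "s = b / (a + 1)"
  have b: "b = s * (a + 1)"
    using \<open>a \<ge> 0\<close> by (simp add: s_def)
  have "s\<^sup>2 * (a + 2) \<le> 0"
    using assms(2)[of "- s"] unfolding b by (simp add: power2_eq_square algebra_simps)
  then show ?thesis
    using \<open>a \<ge> 0\<close> by (simp add: b mult_le_0_iff)
qed

text \<open>
  The Riesz representation theorem. The representing vector minimises the functional
  \<open>\<parallel>x\<parallel>\<^sup>2 - 2 Re (\<phi> x)\<close>; minimising sequences are Cauchy by the parallelogram law.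
\<close>

lemma (in hilbert_space) Riesz_representation:
  assumes add: "\<And>x y. x \<in> carrier H \<Longrightarrow> y \<in> carrier H \<Longrightarrow> \<phi> (x \<oplus>\<^bsub>H\<^esub> y) = \<phi> x + \<phi> y"
    and smult: "\<And>c x. x \<in> carrier H \<Longrightarrow> \<phi> (c \<odot>\<^bsub>H\<^esub> x) = c * \<phi> x"
    and bound: "\<And>x. x \<in> carrier H \<Longrightarrow> cmod (\<phi> x) \<le> B * hnorm H x"
  shows "\<exists>z\<in>carrier H. \<forall>x\<in>carrier H. \<phi> x = hinner H x z"
proof -
  define J where "J x = (hnorm H x)\<^sup>2 - 2 * Re (\<phi> x)" for x
  define d where "d = (INF x\<in>carrier H. J x)"
  have below: "- B\<^sup>2 \<le> J x" if "x \<in> carrier H" for x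
  proof -
    have "Re (\<phi> x) \<le> B * hnorm H x"
      using bound[OF that] complex_Re_le_cmod order_trans by blast
    moreover have "0 \<le> (hnorm H x - B)\<^sup>2"
      by simp
    ultimately show ?thesis
      unfolding J_def power2_diff by (simp add: mult.commute)
  qed
  have bdd: "bdd_below (J ` carrier H)"
    using below by (intro bdd_belowI2)
  have d_le: "d \<le> J x" if "x \<in> carrier H" for x
    unfolding d_def using bdd that by (rule cINF_lower)
  have "\<exists>x\<in>carrier H. J x < d + 1 / real (Suc n)" for n
    using cINF_less_iff[of "carrier H" J "d + 1 / real (Suc n)"] bdd unfolding d_def[symmetric]
    by auto
  then obtain \<sigma> where \<sigma>: "\<And>n. \<sigma> n \<in> carrier H" "\<And>n. J (\<sigma> n) < d + 1 / real (Suc n)"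
    by metis
  \<comment> \<open>The parallelogram law, with \<open>J \<ge> d\<close> at the midpoint of \<open>x\<close> and \<open>y\<close>.\<close>
  have gap: "(hnorm H (x \<ominus>\<^bsub>H\<^esub> y))\<^sup>2 \<le> 2 * (J x - d) + 2 * (J y - d)"
      if "x \<in> carrier H" "y \<in> carrier H" for x y
  proof -
    have "4 * (hnorm H ((1/2) \<odot>\<^bsub>H\<^esub> (x \<oplus>\<^bsub>H\<^esub> y)))\<^sup>2 = (hnorm H (x \<oplus>\<^bsub>H\<^esub> y))\<^sup>2"
      using that by (simp add: power_mult_distrib norm_divide power_divide)
    moreover have "Re (\<phi> ((1/2) \<odot>\<^bsub>H\<^esub> (x \<oplus>\<^bsub>H\<^esub> y))) = (Re (\<phi> x) + Re (\<phi> y)) / 2"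
      using that by (simp add: smult add)
    moreover have "d \<le> J ((1/2) \<odot>\<^bsub>H\<^esub> (x \<oplus>\<^bsub>H\<^esub> y))"
      using that by (intro d_le) auto
    ultimately show ?thesis
      using hnorm_add_sq[OF that] hnorm_minus_sq[OF that] unfolding J_def by argo
  qed
  have cau: "\<exists>N. \<forall>m\<ge>N. \<forall>n\<ge>N. hnorm H (\<sigma> m \<ominus>\<^bsub>H\<^esub> \<sigma> n) < e" if e: "e > 0" for e
  proof -
    obtain N where N: "inverse (real (Suc N)) < e\<^sup>2 / 4"
      using reals_Archimedean[of "e\<^sup>2 / 4"] e by auto
    have small: "J (\<sigma> n) - d < e\<^sup>2 / 4" if "n \<ge> N" for n
    proof -
      have "1 / real (Suc n) \<le> inverse (real (Suc N))"
        using that by (simp add: field_simps)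
      then show ?thesis
        using \<sigma>(2)[of n] N by linarith
    qed
    have "hnorm H (\<sigma> m \<ominus>\<^bsub>H\<^esub> \<sigma> n) < e" if "m \<ge> N" "n \<ge> N" for m n
    proof (rule power2_less_imp_less)
      show "(hnorm H (\<sigma> m \<ominus>\<^bsub>H\<^esub> \<sigma> n))\<^sup>2 < e\<^sup>2"
        using gap[OF \<sigma>(1)[of m] \<sigma>(1)[of n]] small[OF that(1)] small[OF that(2)] by argo
    qed (use e in simp)
    then show ?thesis
      by blast
  qed
  obtain z where z: "z \<in> carrier H" "(\<lambda>n. hnorm H (\<sigma> n \<ominus>\<^bsub>H\<^esub> z)) \<longlonglongrightarrow> 0"
    using Cauchy_converges[of \<sigma>] \<sigma>(1) cau by metis
  have phi_minus: "\<phi> (x \<ominus>\<^bsub>H\<^esub> y) = \<phi> x - \<phi> y" if "x \<in> carrier H" "y \<in> carrier H" for x y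
    using that by (simp add: minus_conv_smult add smult)
  have "(\<lambda>n. \<phi> (\<sigma> n) - \<phi> z) \<longlonglongrightarrow> 0"
  proof (rule Lim_null_comparison)
    show "\<forall>\<^sub>F n in sequentially. cmod (\<phi> (\<sigma> n) - \<phi> z) \<le> B * hnorm H (\<sigma> n \<ominus>\<^bsub>H\<^esub> z)"
      using bound[of "\<sigma> _ \<ominus>\<^bsub>H\<^esub> z"] \<sigma>(1) z(1) by (simp add: phi_minus)
    show "(\<lambda>n. B * hnorm H (\<sigma> n \<ominus>\<^bsub>H\<^esub> z)) \<longlonglongrightarrow> 0"
      using z(2) by (rule tendsto_mult_right_zero)
  qed
  then have "(\<lambda>n. \<phi> (\<sigma> n)) \<longlonglongrightarrow> \<phi> z"
    by (simp add: LIM_zero_iff)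
  then have "(\<lambda>n. J (\<sigma> n)) \<longlonglongrightarrow> J z"
    unfolding J_def using tendsto_hnorm[OF \<sigma>(1) z] by (intro tendsto_intros)
  moreover have "(\<lambda>n. d + 1 / real (Suc n)) \<longlonglongrightarrow> d"
    using tendsto_add[OF tendsto_const[of d] LIMSEQ_inverse_real_of_nat]
    by (simp add: inverse_eq_divide)
  ultimately have "J z \<le> d"
    by (rule LIMSEQ_le) (use \<sigma>(2) less_imp_le in blast)
  then have min: "J z \<le> J x" if "x \<in> carrier H" for x
    using d_le[OF that] by linarith
  \<comment> \<open>First variation of \<open>J\<close> at the minimum \<open>z\<close> in the direction of \<open>w\<close>.\<close>
  have re: "Re (\<phi> w) = Re (hinner H w z)" if w: "w \<in> carrier H" for w
  proof -
    have "0 \<le> t\<^sup>2 * (hnorm H w)\<^sup>2 + 2 * t * (Re (hinner H z w) - Re (\<phi> w))" for t :: real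
      using min[of "z \<oplus>\<^bsub>H\<^esub> of_real t \<odot>\<^bsub>H\<^esub> w"] w z(1)
        hnorm_add_sq[of z "of_real t \<odot>\<^bsub>H\<^esub> w"]
      by (simp add: J_def add smult power_mult_distrib algebra_simps)
    then have "Re (hinner H z w) - Re (\<phi> w) = 0"
      by (intro nonneg_quadratic_imp_zero[of "(hnorm H w)\<^sup>2"]) auto
    then show ?thesis
      using hinner_commute[OF w z(1)] by simp
  qed
  \<comment> \<open>The imaginary part is the real part at \<open>\<i> w\<close>.\<close>
  have "\<phi> w = hinner H w z" if w: "w \<in> carrier H" for w
    using re[OF w] re[of "\<i> \<odot>\<^bsub>H\<^esub> w"] w z(1) by (simp add: smult complex_eq_iff)
  then show ?thesis
    using z(1) by blast
qed

lemma adjoint_exists: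
  assumes "hilbert_space H" "hilbert_space K" "blin H K f"
  shows "\<exists>g. blin K H g \<and> (\<forall>x\<in>carrier H. \<forall>y\<in>carrier K. hinner K (f x) y = hinner H x (g y))"
proof -
  interpret H: hilbert_space H by fact
  interpret K: hilbert_space K by fact
  note cl = blin_closed[OF assms(3)]
  obtain B where B: "B > 0" "\<And>x. x \<in> carrier H \<Longrightarrow> hnorm K (f x) \<le> B * hnorm H x"
    using blin_bound[OF assms] by metis
  have bound: "cmod (hinner K (f x) y) \<le> B * hnorm K y * hnorm H x"
    if "x \<in> carrier H" "y \<in> carrier K" for x y
    using K.Cauchy_Schwarz[OF cl[OF that(1)] that(2)] mult_right_mono[OF B(2)[OF that(1)], of
        "hnorm K y"]
      that by (simp add: mult_ac)
  have "\<exists>z\<in>carrier H. \<forall>x\<in>carrier H. hinner K (f x) y = hinner H x z" if "y \<in> carrier K" for y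
    by (rule H.Riesz_representation[of "\<lambda>x. hinner K (f x) y" "B * hnorm K y"])
      (use that bound cl in \<open>auto simp: blin_add_vec[OF assms(3)] blin_smult_vec[OF assms(3)]\<close>)
  then obtain g where g: "\<And>y. y \<in> carrier K \<Longrightarrow> g y \<in> carrier H"
    "\<And>x y. x \<in> carrier H \<Longrightarrow> y \<in> carrier K \<Longrightarrow> hinner K (f x) y = hinner H x (g y)"
    by metis
  have g': "hinner H (g y) x = hinner K y (f x)" if "x \<in> carrier H" "y \<in> carrier K" for x y
    using g(2)[OF that] H.hinner_commute[OF that(1) g(1)[OF that(2)]] K.hinner_commute[OF cl[OF
        that(1)] that(2)]
    by simp
  have "hnorm H (g y) \<le> B * hnorm K y" if y: "y \<in> carrier K" for y
  proof (cases "hnorm H (g y) = 0")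
    case False
    have "(hnorm H (g y))\<^sup>2 \<le> B * hnorm K y * hnorm H (g y)"
      using bound[OF g(1)[OF y] y] g(2)[OF g(1)[OF y] y] H.hinner_self[OF g(1)[OF y]]
      by (simp add: norm_power)
    then show ?thesis
      using False H.hnorm_nonneg[OF g(1)[OF y]] by (simp add: power2_eq_square)
  qed (use y B in simp)
  then have "blin K H g"
    unfolding blin_def using g(1)
    by (auto intro!: H.hinner_eqI simp: g' cl)
  then show ?thesis
    using g(2) by blast
qed

lemma adjoint_map_props:
  assumes "hilbert_space H" "hilbert_space K" "blin H K f"
  shows "adjoint_map H K f \<in> bounded_linear_maps K H"
    and "\<And>x y. x \<in> carrier H \<Longrightarrow> y \<in> carrier K \<Longrightarrow> hinner K (f x) y = hinner H x (adjoint_map H K f y)"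
proof -
  interpret H: hilbert_space H by fact
  interpret K: hilbert_space K by fact
  let ?P = "\<lambda>g. g \<in> bounded_linear_maps K H \<and>
     (\<forall>x \<in> carrier H. \<forall>y \<in> carrier K. hinner K (f x) y = hinner H x (g y))"
  obtain g where g: "blin K H g" "\<forall>x\<in>carrier H. \<forall>y\<in>carrier K. hinner K (f x) y = hinner H x (g y)"
    using adjoint_exists[OF assms] by blast
  have ex: "?P (restrict g (carrier K))"
    using g restrict_in_bounded_linear_maps[OF assms(2)] by simp
  have "h = h'" if "?P h" "?P h'" for h h'
  proof (rule extensionalityI[of _ "carrier K"])
    fix y assume y: "y \<in> carrier K"
    show "h y = h' y"
    proof (rule H.hinner_eqI)
      show hh: "h y \<in> carrier H" "h' y \<in> carrier H"
        using that y blin_closed unfolding bounded_linear_maps_iff by metis+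
      show "hinner H (h y) z = hinner H (h' y) z" if "z \<in> carrier H" for z
        using H.hinner_commute[OF that hh(1)] H.hinner_commute[OF that hh(2)]
          \<open>?P h\<close> \<open>?P h'\<close> that y by metis
    qed
  qed (use that in \<open>auto simp: bounded_linear_maps_iff\<close>)
  then have "?P (adjoint_map H K f)"
    unfolding adjoint_map_def using ex by (intro theI[of ?P]) auto
  then show "adjoint_map H K f \<in> bounded_linear_maps K H"
    and "\<And>x y. x \<in> carrier H \<Longrightarrow> y \<in> carrier K \<Longrightarrow> hinner K (f x) y = hinner H x (adjoint_map H K f y)"
    by auto
qed


section \<open>Square roots of positive operators\<close>

text \<open>
  For a positive contraction \<open>T\<close> the iteration \<open>Y\<^sub>0 = 0\<close>, \<open>Y\<^sub>n\<^sub>+\<^sub>1 =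
      (1 - T + Y\<^sub>n\<^sup>2) / 2\<close> converges in
  norm to an operator \<open>Y\<close> with \<open>(1 - Y)\<^sup>2 = T\<close>. Since \<open>\<parallel>1 - T\<parallel> \<le> 1\<close>, its increments are dominated
  by those of the scalar iteration for \<open>T = 0\<close>, which increases and is bounded by \<open>1\<close>.
\<close>

text \<open>The scalar iteration.\<close>

primrec scalar_iter :: "nat \<Rightarrow> real" where
  "scalar_iter 0 = 0"
| "scalar_iter (Suc n) = (1 + (scalar_iter n)\<^sup>2) / 2"

lemma scalar_iter_bounds: "0 \<le> scalar_iter n \<and> scalar_iter n \<le> 1"
proof (induction n)
  case (Suc n)
  then have "(scalar_iter n)\<^sup>2 \<le> 1"
    by (simp add: power_le_one)
  then show ?case
    by simp
qed simp

lemma scalar_iter_increasing: "scalar_iter n \<le> scalar_iter (Suc n)"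
proof -
  have "0 \<le> (1 - scalar_iter n)\<^sup>2"
    by simp
  then show ?thesis
    by (simp add: power2_diff)
qed

lemma Cauchy_scalar_iter: "Cauchy scalar_iter"
proof -
  have "convergent scalar_iter"
    using incseq_SucI[of scalar_iter, OF scalar_iter_increasing] scalar_iter_bounds
    by (intro Bseq_mono_convergent BseqI'[of _ 1]) (auto simp: incseq_def)
  then show ?thesis
    by (rule convergent_Cauchy)
qed

text \<open>The iterate \<open>Y\<^sub>n\<close>.\<close>

primrec sqrt_iter :: "'v hilb \<Rightarrow> ('v \<Rightarrow> 'v) \<Rightarrow> nat \<Rightarrow> 'v \<Rightarrow> 'v" where
  "sqrt_iter H T 0 x = \<zero>\<^bsub>H\<^esub>"
| "sqrt_iter H T (Suc n) x =
     (1/2) \<odot>\<^bsub>H\<^esub> ((x \<ominus>\<^bsub>H\<^esub> T x) \<oplus>\<^bsub>H\<^esub> sqrt_iter H T n (sqrt_iter H T n x))"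

text \<open>The pointwise limit \<open>Y\<close> of the iterates, an arbitrary value if there is none.\<close>

definition sqrt_iter_lim :: "'v hilb \<Rightarrow> ('v \<Rightarrow> 'v) \<Rightarrow> 'v \<Rightarrow> 'v" where
  "sqrt_iter_lim H T x =
     (SOME l. l \<in> carrier H \<and> (\<lambda>n. hnorm H (sqrt_iter H T n x \<ominus>\<^bsub>H\<^esub> l)) \<longlonglongrightarrow> 0)"

lemma (in inner_product_space) one_smult [simp]: "x \<in> carrier H \<Longrightarrow> 1 \<odot>\<^bsub>H\<^esub> x = x"
  by (intro hinner_eqI) auto

text \<open>A positive self-adjoint operator of norm at most \<open>1\<close>.\<close>

locale positive_contraction = hilbert_space H for H :: "'v hilb" +
  fixes T :: "'v \<Rightarrow> 'v"
  assumes T_blin: "blin H H T"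
    and T_selfadjoint: "x \<in> carrier H \<Longrightarrow> y \<in> carrier H \<Longrightarrow> hinner H (T x) y = hinner H x (T y)"
    and T_positive: "x \<in> carrier H \<Longrightarrow> 0 \<le> Re (hinner H (T x) x)"
    and T_le: "x \<in> carrier H \<Longrightarrow> hnorm H (T x) \<le> hnorm H x"
begin

abbreviation "Y \<equiv> sqrt_iter H T"

lemma T_closed [simp, intro]: "x \<in> carrier H \<Longrightarrow> T x \<in> carrier H"
  using T_blin blin_closed by metis

lemma Y_closed [simp, intro]: "x \<in> carrier H \<Longrightarrow> Y n x \<in> carrier H"
  by (induction n arbitrary: x) auto

text \<open>This is positivity at \<open>x - T x\<close>; it implies \<open>\<parallel>1 - T\<parallel> \<le> 1\<close>.\<close>

lemma T_norm_sq_le: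
  assumes x: "x \<in> carrier H"
  shows "(hnorm H (T x))\<^sup>2 \<le> Re (hinner H (T x) x)"
proof -
  have "0 \<le> Re (hinner H (T (x \<ominus>\<^bsub>H\<^esub> T x)) (x \<ominus>\<^bsub>H\<^esub> T x))"
    using x by (intro T_positive) auto
  also have "\<dots> = Re (hinner H (T x) x) - 2 * (hnorm H (T x))\<^sup>2 + Re (hinner H (T (T x)) (T x))"
  proof -
    have "hinner H (T (T x)) x = hinner H (T x) (T x)"
      using x by (simp add: T_selfadjoint)
    then show ?thesis
      using x blin_minus_vec[OF hilbert_space_axioms hilbert_space_axioms T_blin, of x "T x"]
      by (simp add: hnorm_sq)
  qed
  also have "Re (hinner H (T (T x)) (T x)) \<le> (hnorm H (T x))\<^sup>2"
  proof -
    have "Re (hinner H (T (T x)) (T x)) \<le> hnorm H (T (T x)) * hnorm H (T x)"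
      using x Cauchy_Schwarz[of "T (T x)" "T x"] complex_Re_le_cmod order_trans by blast
    also have "\<dots> \<le> hnorm H (T x) * hnorm H (T x)"
      using x by (intro mult_right_mono T_le) auto
    finally show ?thesis
      by (simp add: power2_eq_square)
  qed
  finally show ?thesis
    by simp
qed

lemma one_minus_T_le:
  assumes x: "x \<in> carrier H"
  shows "hnorm H (x \<ominus>\<^bsub>H\<^esub> T x) \<le> hnorm H x"
proof (rule power2_le_imp_le)
  have "Re (hinner H x (T x)) = Re (hinner H (T x) x)"
    using hinner_commute[of x "T x"] x by simp
  moreover have "0 \<le> (hnorm H (T x))\<^sup>2"
    by simp
  ultimately show "(hnorm H (x \<ominus>\<^bsub>H\<^esub> T x))\<^sup>2 \<le> (hnorm H x)\<^sup>2"
    using hnorm_minus_sq[of x "T x"] T_norm_sq_le[OF x] x by (simp, linarith)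
qed (use x in auto)

lemma Y_linear:
  assumes "x \<in> carrier H" "y \<in> carrier H"
  shows "Y n (a \<odot>\<^bsub>H\<^esub> x \<oplus>\<^bsub>H\<^esub> b \<odot>\<^bsub>H\<^esub> y) = a \<odot>\<^bsub>H\<^esub> Y n x \<oplus>\<^bsub>H\<^esub> b \<odot>\<^bsub>H\<^esub> Y n y"
  using assms
proof (induction n arbitrary: x y)
  case 0
  then show ?case
    by (intro hinner_eqI) auto
next
  case (Suc n)
  have "T (a \<odot>\<^bsub>H\<^esub> x \<oplus>\<^bsub>H\<^esub> b \<odot>\<^bsub>H\<^esub> y) = a \<odot>\<^bsub>H\<^esub> T x \<oplus>\<^bsub>H\<^esub> b \<odot>\<^bsub>H\<^esub> T y"
    using Suc.prems by (simp add: blin_add_vec[OF T_blin] blin_smult_vec[OF T_blin])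
  then show ?case
    using Suc by (intro hinner_eqI) (auto simp: field_simps)
qed

text \<open>
  Whatever intertwines \<open>T\<close> with \<open>T'\<close> intertwines their iterates. No condition on \<open>T'\<close> is needed.
\<close>

lemma Y_commute:
  assumes "hilbert_space K" "blin H K V" "\<And>x. x \<in> carrier H \<Longrightarrow> V (T x) = T' (V x)"
    and "x \<in> carrier H"
  shows "V (Y n x) = sqrt_iter K T' n (V x)"
  using assms(4)
proof (induction n arbitrary: x)
  case 0
  then show ?case
    using blin_zero_vec[OF hilbert_space_axioms assms(1,2)] by simp
next
  case (Suc n)
  then have "V (Y n (Y n x)) = sqrt_iter K T' n (sqrt_iter K T' n (V x))"
    by simp
  moreover have "V (x \<ominus>\<^bsub>H\<^esub> T x) = V x \<ominus>\<^bsub>K\<^esub> T' (V x)"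
    using Suc.prems assms(3) blin_minus_vec[OF hilbert_space_axioms assms(1,2)] by simp
  ultimately show ?case
    using Suc.prems by (simp add: blin_add_vec[OF assms(2)] blin_smult_vec[OF assms(2)])
qed

lemma Y_le: "x \<in> carrier H \<Longrightarrow> hnorm H (Y n x) \<le> scalar_iter n * hnorm H x"
proof (induction n arbitrary: x)
  case (Suc n)
  let ?s = "scalar_iter n"
  have "hnorm H (Y (Suc n) x) = hnorm H ((x \<ominus>\<^bsub>H\<^esub> T x) \<oplus>\<^bsub>H\<^esub> Y n (Y n x)) / 2"
    using Suc.prems by (simp add: norm_divide)
  also have "hnorm H ((x \<ominus>\<^bsub>H\<^esub> T x) \<oplus>\<^bsub>H\<^esub> Y n (Y n x)) \<le> hnorm H (x \<ominus>\<^bsub>H\<^esub> T x) + hnorm H (Y n (Y n x))"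
    using Suc.prems by (intro hnorm_triangle) auto
  also have "hnorm H (x \<ominus>\<^bsub>H\<^esub> T x) \<le> hnorm H x"
    by (rule one_minus_T_le) fact
  also have "hnorm H (Y n (Y n x)) \<le> ?s * hnorm H (Y n x)"
    using Suc by simp
  also have "?s * hnorm H (Y n x) \<le> ?s * (?s * hnorm H x)"
    using Suc scalar_iter_bounds by (intro mult_left_mono) auto
  finally show ?case
    by (simp add: power2_eq_square algebra_simps add_divide_distrib)
qed simp

lemma Y_blin: "blin H H (Y n)"
  unfolding blin_def
proof (intro conjI ballI allI exI)
  fix x y assume x: "x \<in> carrier H" and y: "y \<in> carrier H"
  show "Y n (x \<oplus>\<^bsub>H\<^esub> y) = Y n x \<oplus>\<^bsub>H\<^esub> Y n y"
    using Y_linear[OF x y, of n 1 1] x y by simp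
next
  fix x c assume x: "x \<in> carrier H"
  show "Y n (c \<odot>\<^bsub>H\<^esub> x) = c \<odot>\<^bsub>H\<^esub> Y n x"
  proof -
    have "c \<odot>\<^bsub>H\<^esub> v = c \<odot>\<^bsub>H\<^esub> v \<oplus>\<^bsub>H\<^esub> 0 \<odot>\<^bsub>H\<^esub> v" if "v \<in> carrier H" for v
      using that by (intro hinner_eqI) auto
    then show ?thesis
      using Y_linear[OF x x, of n c 0] x by simp
  qed
qed (auto intro: Y_le)

lemma Y_Y_commute: "x \<in> carrier H \<Longrightarrow> Y m (Y n x) = Y n (Y m x)"
proof -
  have T: "Y m (T x) = T (Y m x)" if "x \<in> carrier H" for x
    using Y_commute[where V = T and T' = T and n = m, OF hilbert_space_axioms T_blin _ that] by simp
  show "x \<in> carrier H \<Longrightarrow> Y m (Y n x) = Y n (Y m x)"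
    using Y_commute[where V = "Y m" and T' = T, OF hilbert_space_axioms Y_blin T] by simp
qed

text \<open>
  Since the iterates commute, \<open>Y\<^sub>n\<^sub>+\<^sub>2 - Y\<^sub>n\<^sub>+\<^sub>1 = (Y\<^sub>n\<^sub>+\<^sub>1 - Y\<^sub>n) (Y\<^sub>n\<^sub>+\<^sub>1 + Y\<^sub>n) / 2\<close>,
      and the same holds for
  the scalar iteration.
\<close>

lemma Y_step_le:
  "x \<in> carrier H \<Longrightarrow> hnorm H (Y (Suc n) x \<ominus>\<^bsub>H\<^esub> Y n x) \<le> (scalar_iter
      (Suc n) - scalar_iter n) * hnorm H x"
proof (induction n arbitrary: x)
  case 0
  have "Y (Suc 0) x \<ominus>\<^bsub>H\<^esub> Y 0 x = (1/2) \<odot>\<^bsub>H\<^esub> (x \<ominus>\<^bsub>H\<^esub> T x)"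
    using 0 by (intro hinner_eqI) auto
  then show ?case
    using one_minus_T_le[OF 0] 0 by (simp add: norm_divide)
next
  case (Suc n)
  let ?D = "\<lambda>v. Y (Suc n) v \<ominus>\<^bsub>H\<^esub> Y n v"
  let ?v = "Y (Suc n) x \<oplus>\<^bsub>H\<^esub> Y n x"
  let ?s = "scalar_iter n" and ?t = "scalar_iter (Suc n)"
  note x = Suc.prems
  have cl: "Y (Suc n) v \<in> carrier H" if "v \<in> carrier H" for v
    using that by (rule Y_closed)
  have eq: "Y (Suc (Suc n)) x \<ominus>\<^bsub>H\<^esub> Y (Suc n) x = (1/2) \<odot>\<^bsub>H\<^esub> ?D ?v"
  proof -
    have "?D ?v = (Y (Suc n) (Y (Suc n) x) \<oplus>\<^bsub>H\<^esub> Y (Suc n) (Y n x)) \<ominus>\<^bsub>H\<^esub>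
        (Y n (Y (Suc n) x) \<oplus>\<^bsub>H\<^esub> Y n (Y n x))"
      using x cl by (simp only: blin_add_vec[OF Y_blin] Y_closed)
    also have "\<dots> = Y (Suc n) (Y (Suc n) x) \<ominus>\<^bsub>H\<^esub> Y n (Y n x)"
      unfolding Y_Y_commute[OF x, of "Suc n" n]
      using x cl by (intro hinner_eqI) (auto simp del: sqrt_iter.simps(2))
    finally have D: "?D ?v = Y (Suc n) (Y (Suc n) x) \<ominus>\<^bsub>H\<^esub> Y n (Y n x)" .
    have "Y (Suc (Suc n)) x \<ominus>\<^bsub>H\<^esub> Y (Suc n) x =
        ((1/2) \<odot>\<^bsub>H\<^esub> ((x \<ominus>\<^bsub>H\<^esub> T x) \<oplus>\<^bsub>H\<^esub> Y (Suc n) (Y (Suc n) x))) \<ominus>\<^bsub>H\<^esub>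
        ((1/2) \<odot>\<^bsub>H\<^esub> ((x \<ominus>\<^bsub>H\<^esub> T x) \<oplus>\<^bsub>H\<^esub> Y n (Y n x)))"
      by (intro arg_cong2[of _ _ _ _ "\<lambda>v w. v \<ominus>\<^bsub>H\<^esub> w"] sqrt_iter.simps(2))
    also have "\<dots> = (1/2) \<odot>\<^bsub>H\<^esub> (Y (Suc n) (Y (Suc n) x) \<ominus>\<^bsub>H\<^esub> Y n (Y n x))"
      using x cl by (intro hinner_eqI) (auto simp del: sqrt_iter.simps(2) simp: field_simps)
    finally show ?thesis
      unfolding D .
  qed
  have "hnorm H (Y (Suc (Suc n)) x \<ominus>\<^bsub>H\<^esub> Y (Suc n) x) = hnorm H (?D ?v) / 2"
    unfolding eq using x cl by (subst hnorm_smult) (auto simp: norm_divide)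
  also have "hnorm H (?D ?v) \<le> (?t - ?s) * hnorm H ?v"
    using x cl by (intro Suc.IH) blast
  also have "\<dots> \<le> (?t - ?s) * ((?t + ?s) * hnorm H x)"
  proof (rule mult_left_mono)
    have "hnorm H ?v \<le> hnorm H (Y (Suc n) x) + hnorm H (Y n x)"
      using x cl by (intro hnorm_triangle) auto
    also have "\<dots> \<le> ?t * hnorm H x + ?s * hnorm H x"
      by (intro add_mono Y_le x)
    finally show "hnorm H ?v \<le> (?t + ?s) * hnorm H x"
      by (simp only: distrib_right)
  qed (use scalar_iter_increasing[of n] in simp)
  also have "(?t - ?s) * ((?t + ?s) * hnorm H x) / 2 = (scalar_iter (Suc (Suc n)) - ?t) * hnorm H x"
  proof -
    have "scalar_iter (Suc (Suc n)) - ?t = (1 + ?t\<^sup>2) / 2 - (1 + ?s\<^sup>2) / 2"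
      by (intro arg_cong2[of _ _ _ _ minus] scalar_iter.simps(2))
    also have "\<dots> = (?t - ?s) * (?t + ?s) / 2"
      by (simp only: power2_eq_square) (simp del: scalar_iter.simps(2) add: field_simps)
    finally show ?thesis
      by (simp only: mult.assoc times_divide_eq_left)
  qed
  finally show ?case
    by simp
qed

lemma Y_diff_le:
  assumes x: "x \<in> carrier H" and "n \<le> m"
  shows "hnorm H (Y m x \<ominus>\<^bsub>H\<^esub> Y n x) \<le> (scalar_iter m - scalar_iter n) * hnorm H x"
  using assms(2)
proof (induction m rule: dec_induct)
  case base
  then show ?case
    using x by simp
next
  case (step m)
  have "hnorm H (Y (Suc m) x \<ominus>\<^bsub>H\<^esub> Y n x) \<le>
      hnorm H (Y (Suc m) x \<ominus>\<^bsub>H\<^esub> Y m x) + hnorm H (Y m x \<ominus>\<^bsub>H\<^esub> Y n x)"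
    by (intro hnorm_triangle_minus Y_closed x)
  also have "\<dots> \<le> (scalar_iter (Suc m) - scalar_iter m) * hnorm H x +
      (scalar_iter m - scalar_iter n) * hnorm H x"
    by (intro add_mono Y_step_le x step.IH)
  finally show ?case
    by (simp only: flip: distrib_right) simp
qed

lemma Y_converges:
  assumes x: "x \<in> carrier H"
  shows "sqrt_iter_lim H T x \<in> carrier H \<and>
    (\<lambda>n. hnorm H (Y n x \<ominus>\<^bsub>H\<^esub> sqrt_iter_lim H T x)) \<longlonglongrightarrow> 0"
  unfolding sqrt_iter_lim_def
proof (rule someI_ex)
  have "\<exists>N. \<forall>m\<ge>N. \<forall>n\<ge>N. hnorm H (Y m x \<ominus>\<^bsub>H\<^esub> Y n x) < e" if e: "e > 0" for e
  proof -
    define c where "c = hnorm H x + 1"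
    have c: "c > 0" "hnorm H x \<le> c"
      using x by (auto simp: c_def intro: add_nonneg_pos)
    have le: "hnorm H (Y m x \<ominus>\<^bsub>H\<^esub> Y n x) \<le> \<bar>scalar_iter m - scalar_iter n\<bar> * hnorm H x" for m n
    proof (cases "n \<le> m")
      case True
      show ?thesis
        by (rule order_trans[OF Y_diff_le[OF x True]]) (use x in \<open>intro mult_right_mono, auto\<close>)
    next
      case False
      then have "m \<le> n"
        by simp
      show ?thesis
        unfolding hnorm_minus_commute[OF Y_closed[OF x] Y_closed[OF x], of m n]
        by (rule order_trans[OF Y_diff_le[OF x \<open>m \<le> n\<close>]]) (use x in \<open>intro mult_right_mono, auto\<close>)
    qed
    obtain N where N: "\<And>m n. m \<ge> N \<Longrightarrow> n \<ge> N \<Longrightarrow> \<bar>scalar_iter m - scalar_iter n\<bar> < e / c"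
      using Cauchy_scalar_iter c(1) e unfolding Cauchy_def dist_real_def
      by (metis divide_pos_pos)
    have "hnorm H (Y m x \<ominus>\<^bsub>H\<^esub> Y n x) < e" if "m \<ge> N" "n \<ge> N" for m n
    proof -
      have "hnorm H (Y m x \<ominus>\<^bsub>H\<^esub> Y n x) \<le> \<bar>scalar_iter m - scalar_iter n\<bar> * c"
        by (rule order_trans[OF le mult_left_mono[OF c(2)]]) simp
      also have "\<dots> < e"
        using N[OF that] c(1) by (simp add: pos_less_divide_eq)
      finally show ?thesis .
    qed
    then show ?thesis
      by blast
  qed
  then obtain l where "l \<in> carrier H" "(\<lambda>n. hnorm H (Y n x \<ominus>\<^bsub>H\<^esub> l)) \<longlonglongrightarrow> 0"
    using Cauchy_converges[of "\<lambda>n. Y n x"] x by (metis Y_closed)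
  then show "\<exists>l. l \<in> carrier H \<and> (\<lambda>n. hnorm H (Y n x \<ominus>\<^bsub>H\<^esub> l)) \<longlonglongrightarrow> 0"
    by blast
qed

abbreviation "Z \<equiv> sqrt_iter_lim H T"

lemma Z_closed [simp, intro]: "x \<in> carrier H \<Longrightarrow> Z x \<in> carrier H"
  using Y_converges by blast

lemma Y_tendsto_Z: "x \<in> carrier H \<Longrightarrow> z \<in> carrier H \<Longrightarrow> (\<lambda>n. hinner H (Y n x) z) \<longlonglongrightarrow> hinner H (Z x) z"
  using Y_converges by (intro tendsto_hinner) auto

lemma Z_blin: "blin H H Z"
  unfolding blin_def
proof (intro conjI ballI allI exI)
  fix x y assume x: "x \<in> carrier H" and y: "y \<in> carrier H"
  show "Z (x \<oplus>\<^bsub>H\<^esub> y) = Z x \<oplus>\<^bsub>H\<^esub> Z y"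
  proof (rule hinner_eqI)
    fix z assume z: "z \<in> carrier H"
    have "(\<lambda>n. hinner H (Y n (x \<oplus>\<^bsub>H\<^esub> y)) z) \<longlonglongrightarrow> hinner H (Z x \<oplus>\<^bsub>H\<^esub> Z y) z"
      using tendsto_add[OF Y_tendsto_Z[OF x z] Y_tendsto_Z[OF y z]] x y z
      by (simp add: blin_add_vec[OF Y_blin])
    then show "hinner H (Z (x \<oplus>\<^bsub>H\<^esub> y)) z = hinner H (Z x \<oplus>\<^bsub>H\<^esub> Z y) z"
      using Y_tendsto_Z[OF a_closed[OF x y] z] LIMSEQ_unique by blast
  qed (use x y in auto)
next
  fix x c assume x: "x \<in> carrier H"
  show "Z (c \<odot>\<^bsub>H\<^esub> x) = c \<odot>\<^bsub>H\<^esub> Z x"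
  proof (rule hinner_eqI)
    fix z assume z: "z \<in> carrier H"
    have "(\<lambda>n. hinner H (Y n (c \<odot>\<^bsub>H\<^esub> x)) z) \<longlonglongrightarrow> hinner H (c \<odot>\<^bsub>H\<^esub> Z x) z"
      using tendsto_mult_left[OF Y_tendsto_Z[OF x z], of c] x z
      by (simp add: blin_smult_vec[OF Y_blin])
    then show "hinner H (Z (c \<odot>\<^bsub>H\<^esub> x)) z = hinner H (c \<odot>\<^bsub>H\<^esub> Z x) z"
      using Y_tendsto_Z[OF smult_in[OF x] z] LIMSEQ_unique by blast
  qed (use x in auto)
next
  fix x assume x: "x \<in> carrier H"
  have "hnorm H (Y n x) \<le> 1 * hnorm H x" for n
    by (rule order_trans[OF Y_le[OF x]]) (use scalar_iter_bounds x in \<open>intro mult_right_mono, auto\<close>)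
  then show "hnorm H (Z x) \<le> 1 * hnorm H x"
    using x Y_converges by (intro LIMSEQ_le_const2[OF tendsto_hnorm[of "\<lambda>n. Y n x"]]) auto
qed auto

lemma Y_selfadjoint: "x \<in> carrier H \<Longrightarrow> y \<in> carrier H \<Longrightarrow> hinner H (Y n x) y = hinner H x (Y n y)"
  by (induction n arbitrary: x y) (auto simp: T_selfadjoint)

lemma Z_selfadjoint:
  assumes x: "x \<in> carrier H" and y: "y \<in> carrier H"
  shows "hinner H (Z x) y = hinner H x (Z y)"
proof -
  have "(\<lambda>n. hinner H (Y n x) y) \<longlonglongrightarrow> hinner H x (Z y)"
    using tendsto_cnj[OF Y_tendsto_Z[OF y x]] x y
    by (simp add: Y_selfadjoint flip: hinner_commute)
  then show ?thesis
    using Y_tendsto_Z[OF x y] LIMSEQ_unique by blast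
qed

text \<open>Passing to the limit in the recursion gives \<open>2 Z = 1 - T + Z\<^sup>2\<close>, that is \<open>(1 - Z)\<^sup>2 = T\<close>.\<close>

lemma Z_equation:
  assumes x: "x \<in> carrier H"
  shows "(x \<ominus>\<^bsub>H\<^esub> Z x) \<ominus>\<^bsub>H\<^esub> Z (x \<ominus>\<^bsub>H\<^esub> Z x) = T x"
proof -
  have Z: "2 * hinner H (Z x) z = hinner H x z - hinner H (T x) z + hinner H (Z (Z x)) z"
    if z: "z \<in> carrier H" for z
  proof -
    have "(\<lambda>n. hinner H (Y n x) (Y n z)) \<longlonglongrightarrow> hinner H (Z x) (Z z)"
      using x z Y_converges by (intro tendsto_hinner_both) auto
    then have "(\<lambda>n. 1/2 * (hinner H x z - hinner H (T x) z + hinner H (Y n x) (Y n z))) \<longlonglongrightarrow>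
        1/2 * (hinner H x z - hinner H (T x) z + hinner H (Z x) (Z z))"
      by (intro tendsto_intros)
    moreover have "1/2 * (hinner H x z - hinner H (T x) z + hinner H (Y n x) (Y n z)) = hinner H
        (Y (Suc n) x) z" for n
      using x z by (simp add: Y_selfadjoint)
    ultimately have "(\<lambda>n. hinner H (Y (Suc n) x) z) \<longlonglongrightarrow>
        1/2 * (hinner H x z - hinner H (T x) z + hinner H (Z x) (Z z))"
      by simp
    moreover have "(\<lambda>n. hinner H (Y (Suc n) x) z) \<longlonglongrightarrow> hinner H (Z x) z"
      using Y_tendsto_Z[OF x z] by (rule LIMSEQ_Suc)
    ultimately have "hinner H (Z x) z = 1/2 * (hinner H x z - hinner H (T x) z + hinner H (Z x)
        (Z z))"
      using LIMSEQ_unique by blast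
    then show ?thesis
      unfolding Z_selfadjoint[OF Z_closed[OF x] z] by (simp only: mult.assoc[symmetric]) simp
  qed
  have "Z (x \<ominus>\<^bsub>H\<^esub> Z x) = Z x \<ominus>\<^bsub>H\<^esub> Z (Z x)"
    using x by (intro blin_minus_vec[OF hilbert_space_axioms hilbert_space_axioms Z_blin]) auto
  then show ?thesis
    using x Z by (intro hinner_eqI) (auto simp: algebra_simps)
qed

text \<open>The limit is natural with respect to isometries that intertwine the given operators.\<close>

lemma Z_commute:
  assumes K: "positive_contraction K T'" and V: "blin H K V"
    and norm: "\<And>x. x \<in> carrier H \<Longrightarrow> hnorm K (V x) = hnorm H x"
    and TV: "\<And>x. x \<in> carrier H \<Longrightarrow> V (T x) = T' (V x)"
    and x: "x \<in> carrier H"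
  shows "V (Z x) = sqrt_iter_lim K T' (V x)"
proof -
  interpret K: positive_contraction K T' by fact
  note VK = blin_closed[OF V]
  show ?thesis
  proof (rule K.hinner_eqI)
    fix z assume z: "z \<in> carrier K"
    have "(\<lambda>n. hnorm K (V (Y n x) \<ominus>\<^bsub>K\<^esub> V (Z x))) \<longlonglongrightarrow> 0"
      using Y_converges[OF x] x norm
      by (simp flip: blin_minus_vec[OF hilbert_space_axioms K.hilbert_space_axioms V])
    then have "(\<lambda>n. hinner K (V (Y n x)) z) \<longlonglongrightarrow> hinner K (V (Z x)) z"
      using x z VK by (intro K.tendsto_hinner) auto
    moreover have "(\<lambda>n. hinner K (V (Y n x)) z) \<longlonglongrightarrow> hinner K (K.Z (V x)) z"
      using K.Y_tendsto_Z[OF VK[OF x] z] by (simp add: Y_commute[OF K.hilbert_space_axioms V TV x])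
    ultimately show "hinner K (V (Z x)) z = hinner K (K.Z (V x)) z"
      using LIMSEQ_unique by blast
  qed (use x VK in auto)
qed

end


section \<open>Unitary representations and intertwiners\<close>

lemma Hom_Hilb_iff:
  "t \<in> Hom (Hilb \<U>) H K \<longleftrightarrow> hilbert_space H \<and> carrier H \<in> \<U> \<and> hilbert_space K \<and> carrier K \<in> \<U> \<and>
     (\<exists>f. f \<in> bounded_linear_maps H K \<and> t = (H, f, K))"
  by (auto simp: Hom_def Hilb_def)

text \<open>The operator by which an arrow acts, and the component of an intertwiner at an object.\<close>

definition act :: "('o, 'm, 'v hilb, 'v hilb \<times>
    ('v \<Rightarrow> 'v) \<times> 'v hilb) star_functor \<Rightarrow> 'm \<Rightarrow> 'v \<Rightarrow> 'v" where
  "act F a = fst (snd (FArr F a))"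

definition cmp :: "'f \<times> ('o \<Rightarrow> 'h \<times> ('v \<Rightarrow> 'v) \<times> 'h) \<times> 'f \<Rightarrow> 'o \<Rightarrow> 'v \<Rightarrow> 'v" where
  "cmp f x = fst (snd (fst (snd f) x))"

text \<open>Smallness plays no role yet, so \<open>\<U>\<close> is arbitrary.\<close>

locale unitary_reps = groupoid G for G :: "('o, 'm) category" +
  fixes \<U> :: "'v set set"
begin

abbreviation "\<C> \<equiv> URep \<U> G"

text \<open>The inverse of an arrow of \<open>G\<close>, in the form in which it occurs as the involution.\<close>

abbreviation ginv :: "'m \<Rightarrow> 'm" where
  "ginv a \<equiv> THE h. is_inverse G a h"

lemma Hom_DomCod: "a \<in> Arr G \<Longrightarrow> a \<in> Hom G (Dom G a) (Cod G a)"
  by (simp add: Hom_def)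

lemma is_inverse_ginv:
  assumes a: "a \<in> Arr G"
  shows "is_inverse G a (ginv a)"
proof -
  obtain h where h: "is_inverse G a h"
    using invertible[OF a] by blast
  have "h' = h" if "is_inverse G a h'" for h'
  proof -
    have H: "h \<in> Hom G (Cod G a) (Dom G a)" "h' \<in> Hom G (Cod G a) (Dom G a)" "a \<in> Hom G (Dom G a)
        (Cod G a)"
      using h that a by (auto simp: is_inverse_def Hom_def)
    have "h' = h' \<circ>\<^bsub>G\<^esub> (a \<circ>\<^bsub>G\<^esub> h)"
      using h H by (simp add: is_inverse_def Ident_right)
    also have "\<dots> = (h' \<circ>\<^bsub>G\<^esub> a) \<circ>\<^bsub>G\<^esub> h"
      using H by (simp add: Comp_assoc)
    also have "\<dots> = h"
      using that H by (simp add: is_inverse_def Ident_left)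
    finally show ?thesis .
  qed
  with h show ?thesis
    by (rule theI)
qed

lemma ginv_Hom: "a \<in> Arr G \<Longrightarrow> ginv a \<in> Hom G (Cod G a) (Dom G a)"
  using is_inverse_ginv unfolding is_inverse_def by blast

lemma ginv_Arr [simp]: "a \<in> Arr G \<Longrightarrow> ginv a \<in> Arr G" "a \<in> Arr G \<Longrightarrow> Dom G (ginv a) = Cod G a"
  "a \<in> Arr G \<Longrightarrow> Cod G (ginv a) = Dom G a"
  using ginv_Hom by (auto simp: Hom_def)

lemma Obj_URep: "Obj \<C> = star_functors (groupoid_star_category G) (Hilb \<U>)"
  by (simp add: URep_def functor_star_category_def)

lemma rep_space:
  assumes "F \<in> Obj \<C>" "x \<in> Obj G"
  shows "hilbert_space (FObj F x)" "carrier (FObj F x) \<in> \<U>"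
  using assms by (auto simp: Obj_URep star_functors_def groupoid_star_category_def Hilb_def dest:
      PiE_mem)

lemma rep_arr:
  assumes "F \<in> Obj \<C>" "a \<in> Arr G"
  shows "FArr F a = (FObj F (Dom G a), act F a, FObj F (Cod G a))"
    and "act F a \<in> bounded_linear_maps (FObj F (Dom G a)) (FObj F (Cod G a))"
    and "blin (FObj F (Dom G a)) (FObj F (Cod G a)) (act F a)"
proof -
  have "FArr F a \<in> Hom (Hilb \<U>) (FObj F (Dom G a)) (FObj F (Cod G a))"
    using assms by (auto simp: Obj_URep star_functors_def groupoid_star_category_def)
  then show "FArr F a = (FObj F (Dom G a), act F a, FObj F (Cod G a))"
    and "act F a \<in> bounded_linear_maps (FObj F (Dom G a)) (FObj F (Cod G a))"
    by (auto simp: Hom_Hilb_iff act_def)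
  then show "blin (FObj F (Dom G a)) (FObj F (Cod G a)) (act F a)"
    by (simp add: bounded_linear_maps_iff)
qed

lemma act_closed [simp]:
  "F \<in> Obj \<C> \<Longrightarrow> a \<in> Arr G \<Longrightarrow> v \<in> carrier (FObj F (Dom G a)) \<Longrightarrow> act F a v \<in> carrier (FObj F (Cod G a))"
  by (rule blin_closed[OF rep_arr(3)])

lemma act_Ident:
  assumes "F \<in> Obj \<C>" "x \<in> Obj G" "v \<in> carrier (FObj F x)"
  shows "act F (Ident G x) v = v"
proof -
  have "FArr F (Ident G x) = Ident (Hilb \<U>) (FObj F x)"
    using assms(1,2) by (auto simp: Obj_URep star_functors_def groupoid_star_category_def)
  then show ?thesis
    using assms(3) by (simp add: act_def Hilb_def)
qed

lemma act_Comp: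
  assumes "F \<in> Obj \<C>" "a \<in> Hom G x y" "b \<in> Hom G y z" "v \<in> carrier (FObj F x)"
  shows "act F (b \<circ>\<^bsub>G\<^esub> a) v = act F b (act F a v)"
proof -
  have ab: "a \<in> Arr G" "Dom G a = x" "Cod G a = y" "b \<in> Arr G" "Dom G b = y" "Cod G b = z"
    using assms by (auto simp: Hom_def)
  have "FArr F (b \<circ>\<^bsub>G\<^esub> a) = FArr F b \<circ>\<^bsub>Hilb \<U>\<^esub> FArr F a"
    using assms(1-3) unfolding Obj_URep star_functors_def
    by (auto simp: groupoid_star_category_def Hom_def)
  then show ?thesis
    using assms(1,4) ab rep_arr(1)[of F a] rep_arr(1)[of F b]
    by (simp add: act_def[of F "b \<circ>\<^bsub>G\<^esub> a"] Hilb_def compose_def)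
qed

lemma act_ginv:
  assumes "F \<in> Obj \<C>" "a \<in> Arr G"
  shows "v \<in> carrier (FObj F (Dom G a)) \<Longrightarrow> act F (ginv a) (act F a v) = v"
    and "v \<in> carrier (FObj F (Cod G a)) \<Longrightarrow> act F a (act F (ginv a) v) = v"
proof -
  have inv: "ginv a \<circ>\<^bsub>G\<^esub> a = Ident G (Dom G a)" "a \<circ>\<^bsub>G\<^esub> ginv a = Ident G (Cod G a)"
    using is_inverse_ginv[OF assms(2)] by (auto simp: is_inverse_def)
  note act_Comp[OF assms(1) Hom_DomCod[OF assms(2)] ginv_Hom[OF assms(2)], unfolded inv]
    act_Comp[OF assms(1) ginv_Hom[OF assms(2)] Hom_DomCod[OF assms(2)], unfolded inv]
  then show "v \<in> carrier (FObj F (Dom G a)) \<Longrightarrow> act F (ginv a) (act F a v) = v"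
    and "v \<in> carrier (FObj F (Cod G a)) \<Longrightarrow> act F a (act F (ginv a) v) = v"
    using act_Ident[OF assms(1)] Dom_closed[OF assms(2)] Cod_closed[OF assms(2)] by metis+
qed

lemma act_adjoint:
  assumes F: "F \<in> Obj \<C>" and a: "a \<in> Arr G"
    and v: "v \<in> carrier (FObj F (Dom G a))" and w: "w \<in> carrier (FObj F (Cod G a))"
  shows "hinner (FObj F (Cod G a)) (act F a v) w = hinner (FObj F (Dom G a)) v (act F (ginv a) w)"
proof -
  have "FArr F (ginv a) = Star (Hilb \<U>) (FArr F a)"
    using F a by (auto simp: Obj_URep star_functors_def groupoid_star_category_def)
  then have "act F (ginv a) = adjoint_map (FObj F (Dom G a)) (FObj F (Cod G a)) (act F a)"
    using rep_arr(1)[OF F a] by (simp add: act_def[of F "ginv a"] Hilb_def)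
  then show ?thesis
    using adjoint_map_props(2)[OF rep_space(1)[OF F] rep_space(1)[OF F] rep_arr(3)[OF F a]]
      Dom_closed[OF a] Cod_closed[OF a] v w by simp
qed

lemma act_isometry:
  assumes "F \<in> Obj \<C>" "a \<in> Arr G" "v \<in> carrier (FObj F (Dom G a))" "w \<in> carrier (FObj F (Dom G a))"
  shows "hinner (FObj F (Cod G a)) (act F a v) (act F a w) = hinner (FObj F (Dom G a)) v w"
  using act_adjoint[OF assms(1-3), of "act F a w"] act_ginv(1)[OF assms(1,2,4)] assms by simp

lemma hnorm_act:
  assumes "F \<in> Obj \<C>" "a \<in> Arr G" "v \<in> carrier (FObj F (Dom G a))"
  shows "hnorm (FObj F (Cod G a)) (act F a v) = hnorm (FObj F (Dom G a)) v"
  using act_isometry[OF assms assms(3)] by (simp add: hnorm_def)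

text \<open>
  The representation with spaces \<open>H x\<close> and operators \<open>u a\<close>. If the operators are isometries that
  respect identities and composition, then \<open>u a\<close> is invertible with inverse \<open>u\<close> of the inverse of
  \<open>a\<close>, so that it is unitary and the involution is preserved.
\<close>

definition mk_rep :: "('o \<Rightarrow> 'v hilb) \<Rightarrow> ('m \<Rightarrow> 'v \<Rightarrow> 'v)
    \<Rightarrow> ('o, 'm, 'v hilb, 'v hilb \<times> ('v \<Rightarrow> 'v) \<times> 'v hilb) star_functor" where
  "mk_rep H u = \<lparr>FObj = (\<lambda>x\<in>Obj G. H x),
     FArr = (\<lambda>a\<in>Arr G. (H (Dom G a), restrict (u a) (carrier (H (Dom G a))), H (Cod G a)))\<rparr>"

lemma FObj_mk_rep [simp]: "x \<in> Obj G \<Longrightarrow> FObj (mk_rep H u) x = H x"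
  by (simp add: mk_rep_def)

lemma act_mk_rep [simp]: "a \<in> Arr G \<Longrightarrow> v \<in> carrier (H (Dom G a)) \<Longrightarrow> act (mk_rep H u) a v = u a v"
  by (simp add: mk_rep_def act_def)

lemma mk_rep_in_Obj:
  assumes H: "\<And>x. x \<in> Obj G \<Longrightarrow> hilbert_space (H x)" "\<And>x. x \<in> Obj G \<Longrightarrow> carrier (H x) \<in> \<U>"
    and u: "\<And>a. a \<in> Arr G \<Longrightarrow> blin (H (Dom G a)) (H (Cod G a)) (u a)"
    and Ident: "\<And>x v. x \<in> Obj G \<Longrightarrow> v \<in> carrier (H x) \<Longrightarrow> u (Ident G x) v = v"
    and Comp: "\<And>x y z a b v. a \<in> Hom G x y \<Longrightarrow> b \<in> Hom G y z \<Longrightarrow> v \<in> carrier (H x) \<Longrightarrow>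
      u (b \<circ>\<^bsub>G\<^esub> a) v = u b (u a v)"
    and isom: "\<And>a v w. a \<in> Arr G \<Longrightarrow> v \<in> carrier (H (Dom G a)) \<Longrightarrow> w \<in> carrier (H (Dom G a)) \<Longrightarrow>
      hinner (H (Cod G a)) (u a v) (u a w) = hinner (H (Dom G a)) v w"
  shows "mk_rep H u \<in> Obj \<C>"
proof -
  let ?F = "mk_rep H u"
  note DC = Dom_closed Cod_closed
  have arr: "FArr ?F a \<in> Hom (Hilb \<U>) (H (Dom G a)) (H (Cod G a))" if "a \<in> Arr G" for a
    using that DC H u by (simp add: Hom_Hilb_iff mk_rep_def restrict_in_bounded_linear_maps)
  have star: "FArr ?F (ginv a) = Star (Hilb \<U>) (FArr ?F a)" if a: "a \<in> Arr G" for a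
  proof -
    let ?D = "H (Dom G a)" and ?K = "H (Cod G a)"
    interpret D: hilbert_space ?D using H DC a by blast
    interpret K: hilbert_space ?K using H DC a by blast
    note ui = u[OF ginv_Arr(1)[OF a], unfolded ginv_Arr[OF a]]
    let ?r = "restrict (u a) (carrier ?D)"
    have r: "?r \<in> bounded_linear_maps ?D ?K" "blin ?D ?K ?r"
      using restrict_in_bounded_linear_maps[OF D.hilbert_space_axioms u[OF a]]
      by (auto simp: bounded_linear_maps_iff)
    note adj = adjoint_map_props[OF D.hilbert_space_axioms K.hilbert_space_axioms r(2)]
    have inv: "u a (u (ginv a) y) = y" if "y \<in> carrier ?K" for y
      using Comp[OF ginv_Hom[OF a] Hom_DomCod[OF a] that] is_inverse_ginv[OF a] Ident[of "Cod G a"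
          y] DC a that
      by (simp add: is_inverse_def)
    have "restrict (u (ginv a)) (carrier ?K) = adjoint_map ?D ?K ?r"
    proof (rule extensionalityI[of _ "carrier ?K"])
      show "adjoint_map ?D ?K ?r \<in> extensional (carrier ?K)"
        using adj(1) by (simp add: bounded_linear_maps_iff)
      fix y assume y: "y \<in> carrier ?K"
      have cl: "u (ginv a) y \<in> carrier ?D" "adjoint_map ?D ?K ?r y \<in> carrier ?D"
        using blin_closed[OF ui] adj(1) blin_closed y by (auto simp: bounded_linear_maps_iff)
      have "hinner ?D z (u (ginv a) y) = hinner ?D z (adjoint_map ?D ?K ?r y)"
          if z: "z \<in> carrier ?D" for z
        using isom[OF a z cl(1)] adj(2)[OF z y] z inv[OF y] by simp
      then have "u (ginv a) y = adjoint_map ?D ?K ?r y"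
        using cl D.hinner_commute by (intro D.hinner_eqI) metis+
      then show "restrict (u (ginv a)) (carrier ?K) y = adjoint_map ?D ?K ?r y"
        using y by simp
    qed simp
    then show ?thesis
      using a by (simp add: mk_rep_def Hilb_def)
  qed
  have ident: "FArr ?F (Ident G x) = Ident (Hilb \<U>) (H x)" if "x \<in> Obj G" for x
    using Ident_closed[OF that] Ident[OF that]
    by (auto simp: mk_rep_def Hilb_def Hom_def fun_eq_iff)
  have comp: "FArr ?F (b \<circ>\<^bsub>G\<^esub> a) = FArr ?F b \<circ>\<^bsub>Hilb \<U>\<^esub> FArr ?F a"
      if "a \<in> Hom G x y" "b \<in> Hom G y z" for a b x y z
    using Comp_closed[OF that] Comp[OF that] that blin_closed[OF u, of a]
    by (auto simp: mk_rep_def Hilb_def Hom_def fun_eq_iff compose_def)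
  have obj: "x \<in> Obj G \<Longrightarrow> H x \<in> Obj (Hilb \<U>)" for x
    using H by (simp add: Hilb_def)
  have arr': "FArr ?F a \<in> Arr (Hilb \<U>)" if "a \<in> Arr G" for a
    using arr[OF that] by (simp add: Hom_def)
  show ?thesis
    unfolding Obj_URep star_functors_def mem_Collect_eq
  proof (intro conjI ballI allI)
    show "FObj ?F \<in> Obj (groupoid_star_category G) \<rightarrow>\<^sub>E Obj (Hilb \<U>)"
      using obj by (auto simp: groupoid_star_category_def mk_rep_def)
    show "FArr ?F \<in> Arr (groupoid_star_category G) \<rightarrow>\<^sub>E Arr (Hilb \<U>)"
      using arr' by (auto simp: groupoid_star_category_def) (simp add: mk_rep_def)
  qed (use arr star ident comp DC in \<open>auto simp: groupoid_star_category_def Hom_def\<close>)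
qed

text \<open>
  A family \<open>\<tau>\<close> of bounded linear maps, one at each object, that commutes with the actions. The
  bounds may depend on the object.
\<close>

definition intertwines :: "('o, 'm, 'v hilb, 'v hilb \<times> ('v \<Rightarrow> 'v) \<times> 'v hilb) star_functor
    \<Rightarrow> ('o, 'm, 'v hilb, 'v hilb \<times> ('v \<Rightarrow> 'v) \<times> 'v hilb) star_functor \<Rightarrow> ('o \<Rightarrow> 'v \<Rightarrow> 'v) \<Rightarrow> bool" where
  "intertwines F F' \<tau> \<longleftrightarrow> (\<forall>x\<in>Obj G. blin (FObj F x) (FObj F' x) (\<tau> x)) \<and>
     (\<forall>a\<in>Arr G. \<forall>v\<in>carrier (FObj F (Dom G a)). \<tau> (Cod G a) (act F a v) = act F' a (\<tau> (Dom G a) v))"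

text \<open>The morphism with components \<open>\<tau>\<close>.\<close>

definition mk_arr where
  "mk_arr F \<tau> F' = (F, \<lambda>x\<in>Obj G. (FObj F x, restrict (\<tau> x) (carrier (FObj F x)), FObj F' x), F')"

lemma cmp_mk_arr [simp]: "x \<in> Obj G \<Longrightarrow> v \<in> carrier (FObj F x) \<Longrightarrow> cmp (mk_arr F \<tau> F') x v = \<tau> x v"
  by (simp add: cmp_def mk_arr_def)

lemma Hom_URep_iff:
  "f \<in> Hom \<C> F F' \<longleftrightarrow> F \<in> Obj \<C> \<and> F' \<in> Obj \<C> \<and>
     (\<exists>t. f = (F, t, F') \<and> t \<in> natural_transformations (groupoid_star_category G) (Hilb \<U>) F F')"
  by (auto simp: Hom_def URep_def functor_star_category_def)

lemma mk_arr_in_Hom: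
  assumes F: "F \<in> Obj \<C>" and F': "F' \<in> Obj \<C>" and \<tau>: "intertwines F F' \<tau>"
  shows "mk_arr F \<tau> F' \<in> Hom \<C> F F'"
proof -
  have 1: "blin (FObj F x) (FObj F' x) (\<tau> x)" if "x \<in> Obj G" for x
    using \<tau> that by (simp add: intertwines_def)
  have 2: "\<tau> (Cod G a) (act F a v) = act F' a (\<tau> (Dom G a) v)"
      if "a \<in> Arr G" "v \<in> carrier (FObj F (Dom G a))" for a v
    using \<tau> that by (simp add: intertwines_def)
  let ?t = "\<lambda>x. (FObj F x, restrict (\<tau> x) (carrier (FObj F x)), FObj F' x)"
  have "?t (Cod G a) \<circ>\<^bsub>Hilb \<U>\<^esub> FArr F a = FArr F' a \<circ>\<^bsub>Hilb \<U>\<^esub> ?t (Dom G a)" if "a \<in> Arr G" for a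
    using 2[OF that] rep_arr(1)[OF F that] rep_arr(1)[OF F' that] act_closed[OF F that]
    by (auto simp: Hilb_def compose_def fun_eq_iff)
  then show ?thesis
    using F F' 1 rep_space[OF F] rep_space[OF F'] Dom_closed Cod_closed
    by (auto simp: Hom_URep_iff mk_arr_def natural_transformations_def groupoid_star_category_def
        Hom_Hilb_iff restrict_in_bounded_linear_maps)
qed

text \<open>Every morphism is determined by its components.\<close>

lemma HomD:
  assumes f: "f \<in> Hom \<C> F F'"
  shows "F \<in> Obj \<C>" "F' \<in> Obj \<C>" "f = mk_arr F (cmp f) F'" "intertwines F F' (cmp f)"
    and "\<And>x. x \<in> Obj G \<Longrightarrow> cmp f x \<in> bounded_linear_maps (FObj F x) (FObj F' x)"
proof -
  obtain t where t: "f = (F, t, F')" and nat: "t \<in> natural_transformations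
      (groupoid_star_category G) (Hilb \<U>) F F'"
    and F: "F \<in> Obj \<C>" and F': "F' \<in> Obj \<C>"
    using f by (auto simp: Hom_URep_iff)
  have tx: "t x = (FObj F x, cmp f x, FObj F' x)" "cmp f x \<in> bounded_linear_maps (FObj F x)
      (FObj F' x)"
    if "x \<in> Obj G" for x
  proof -
    have "t x \<in> Hom (Hilb \<U>) (FObj F x) (FObj F' x)"
      using nat that by (auto simp: natural_transformations_def groupoid_star_category_def)
    then show "t x = (FObj F x, cmp f x, FObj F' x)" "cmp f x \<in> bounded_linear_maps (FObj F x)
        (FObj F' x)"
      by (auto simp: Hom_Hilb_iff cmp_def t)
  qed
  have ext: "t \<in> extensional (Obj G)"
    using nat by (auto simp: natural_transformations_def groupoid_star_category_def PiE_def)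
  show "F \<in> Obj \<C>" "F' \<in> Obj \<C>" by fact+
  show "cmp f x \<in> bounded_linear_maps (FObj F x) (FObj F' x)" if "x \<in> Obj G" for x
    using tx that by blast
  have "t = (\<lambda>x\<in>Obj G. (FObj F x, restrict (cmp f x) (carrier (FObj F x)), FObj F' x))"
    using ext tx by (intro extensionalityI[of _ "Obj G"])
        (auto simp: bounded_linear_maps_iff extensional_restrict)
  then show "f = mk_arr F (cmp f) F'"
    by (simp add: t mk_arr_def)
  have "cmp f (Cod G a) (act F a v) = act F' a (cmp f (Dom G a) v)"
    if a: "a \<in> Arr G" and v: "v \<in> carrier (FObj F (Dom G a))" for a v
  proof -
    have "t (Cod G a) \<circ>\<^bsub>Hilb \<U>\<^esub> FArr F a = FArr F' a \<circ>\<^bsub>Hilb \<U>\<^esub> t (Dom G a)"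
      using nat a by (auto simp: natural_transformations_def groupoid_star_category_def)
    then have "compose (carrier (FObj F (Dom G a))) (cmp f (Cod G a)) (act F a) =
        compose (carrier (FObj F (Dom G a))) (act F' a) (cmp f (Dom G a))"
      using rep_arr(1)[OF F a] rep_arr(1)[OF F' a] tx(1)[OF Dom_closed[OF a]] tx(1)[OF
          Cod_closed[OF a]]
      by (simp add: Hilb_def)
    from fun_cong[OF this, of v] show ?thesis
      using v by (simp add: compose_def)
  qed
  then show "intertwines F F' (cmp f)"
    using tx(2) by (simp add: intertwines_def bounded_linear_maps_iff)
qed

lemma cmp_blin: "f \<in> Hom \<C> F F' \<Longrightarrow> x \<in> Obj G \<Longrightarrow> blin (FObj F x) (FObj F' x) (cmp f x)"
  using HomD(4)[of f F F'] by (simp add: intertwines_def)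

lemma cmp_closed: "f \<in> Hom \<C> F F' \<Longrightarrow> x \<in> Obj G \<Longrightarrow> v \<in> carrier (FObj F x) \<Longrightarrow>
    cmp f x v \<in> carrier (FObj F' x)"
  by (rule blin_closed[OF cmp_blin])

lemma cmp_natural:
  "f \<in> Hom \<C> F F' \<Longrightarrow> a \<in> Arr G \<Longrightarrow> v \<in> carrier (FObj F (Dom G a)) \<Longrightarrow>
    cmp f (Cod G a) (act F a v) = act F' a (cmp f (Dom G a) v)"
  using HomD(4)[of f F F'] by (simp add: intertwines_def)

lemma mk_arr_eqI:
  assumes "\<And>x v. x \<in> Obj G \<Longrightarrow> v \<in> carrier (FObj F x) \<Longrightarrow> \<sigma> x v = \<tau> x v"
  shows "mk_arr F \<sigma> F' = mk_arr F \<tau> F'"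
  using assms by (auto simp: mk_arr_def fun_eq_iff restrict_def)

lemma arr_eqI:
  assumes f: "f \<in> Hom \<C> F F'" and g: "g \<in> Hom \<C> F F'"
    and eq: "\<And>x v. x \<in> Obj G \<Longrightarrow> v \<in> carrier (FObj F x) \<Longrightarrow> cmp f x v = cmp g x v"
  shows "f = g"
proof -
  have "mk_arr F (cmp f) F' = mk_arr F (cmp g) F'"
    by (rule mk_arr_eqI) (fact eq)
  then show ?thesis
    using HomD(3)[OF f] HomD(3)[OF g] by simp
qed

lemma Comp_URep: "mk_arr F' \<tau> F'' \<circ>\<^bsub>\<C>\<^esub> mk_arr F \<sigma> F' = mk_arr F (\<lambda>x v. \<tau> x (\<sigma> x v)) F''"
  if "intertwines F F' \<sigma>"
proof -
  have "blin (FObj F x) (FObj F' x) (\<sigma> x)" if "x \<in> Obj G" for x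
    using \<open>intertwines F F' \<sigma>\<close> that by (simp add: intertwines_def)
  then show ?thesis
    by (auto simp: mk_arr_def URep_def functor_star_category_def Hilb_def compose_def fun_eq_iff
        restrict_def groupoid_star_category_def dest: blin_closed)
qed

lemma intertwines_comp:
  assumes "F \<in> Obj \<C>" "F' \<in> Obj \<C>" "F'' \<in> Obj \<C>" "intertwines F F' \<sigma>" "intertwines F' F'' \<tau>"
  shows "intertwines F F'' (\<lambda>x v. \<tau> x (\<sigma> x v))"
  unfolding intertwines_def
proof (intro conjI ballI)
  show "blin (FObj F x) (FObj F'' x) (\<lambda>v. \<tau> x (\<sigma> x v))" if x: "x \<in> Obj G" for x
    using assms(4,5) x
      blin_comp[OF rep_space(1)[OF assms(1) x] rep_space(1)[OF assms(2) x] rep_space(1)[OF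
          assms(3) x],
        of "\<sigma> x" "\<tau> x"]
    by (simp add: intertwines_def)
  fix a v assume a: "a \<in> Arr G" and v: "v \<in> carrier (FObj F (Dom G a))"
  have "\<sigma> (Dom G a) v \<in> carrier (FObj F' (Dom G a))"
    using assms(4) Dom_closed[OF a] v by (auto simp: intertwines_def intro: blin_closed)
  then show "\<tau> (Cod G a) (\<sigma> (Cod G a) (act F a v)) = act F'' a (\<tau> (Dom G a) (\<sigma> (Dom G a) v))"
    using assms(4,5) a v by (simp add: intertwines_def)
qed

lemma Comp_Hom:
  assumes f: "f \<in> Hom \<C> F F'" and g: "g \<in> Hom \<C> F' F''"
  shows "g \<circ>\<^bsub>\<C>\<^esub> f \<in> Hom \<C> F F''"
    and "\<And>x v. x \<in> Obj G \<Longrightarrow> v \<in> carrier (FObj F x) \<Longrightarrow> cmp (g \<circ>\<^bsub>\<C>\<^esub> f) x v = cmp g x (cmp f x v)"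
proof -
  have eq: "g \<circ>\<^bsub>\<C>\<^esub> f = mk_arr F (\<lambda>x v. cmp g x (cmp f x v)) F''"
    using Comp_URep[OF HomD(4)[OF f], where \<tau> = "cmp g" and F'' = F'']
    by (simp only: HomD(3)[OF f, symmetric] HomD(3)[OF g, symmetric])
  show "g \<circ>\<^bsub>\<C>\<^esub> f \<in> Hom \<C> F F''"
  proof -
    have "intertwines F F'' (\<lambda>x v. cmp g x (cmp f x v))"
      using HomD(1,2)[OF f] HomD(2)[OF g] HomD(4)[OF f] HomD(4)[OF g] by (rule intertwines_comp)
    then show ?thesis
      unfolding eq by (rule mk_arr_in_Hom[OF HomD(1)[OF f] HomD(2)[OF g]])
  qed
  show "cmp (g \<circ>\<^bsub>\<C>\<^esub> f) x v = cmp g x (cmp f x v)" if "x \<in> Obj G" "v \<in> carrier (FObj F x)" for x v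
    using that by (simp add: eq)
qed

lemma Ident_Hom:
  assumes F: "F \<in> Obj \<C>"
  shows "Ident \<C> F \<in> Hom \<C> F F"
    and "\<And>x v. x \<in> Obj G \<Longrightarrow> v \<in> carrier (FObj F x) \<Longrightarrow> cmp (Ident \<C> F) x v = v"
proof -
  have eq: "Ident \<C> F = mk_arr F (\<lambda>x v. v) F"
    by (auto simp: mk_arr_def URep_def functor_star_category_def Hilb_def
        groupoid_star_category_def fun_eq_iff)
  show "Ident \<C> F \<in> Hom \<C> F F"
    unfolding eq by (intro mk_arr_in_Hom F) (simp add: intertwines_def blin_id)
  show "cmp (Ident \<C> F) x v = v" if "x \<in> Obj G" "v \<in> carrier (FObj F x)" for x v
    using that by (simp add: eq)
qed

text \<open>
  The pointwise adjoint of an intertwiner \<open>f\<close> is an intertwiner: since the actions are unitary,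
  naturality of \<open>f\<close> at the inverse of \<open>a\<close> is transposed to naturality of the adjoint at \<open>a\<close>.
\<close>

lemma Star_Hom:
  assumes f: "f \<in> Hom \<C> F F'"
  shows "Star \<C> f \<in> Hom \<C> F' F"
    and "\<And>x v w. x \<in> Obj G \<Longrightarrow> v \<in> carrier (FObj F x) \<Longrightarrow> w \<in> carrier (FObj F' x) \<Longrightarrow>
      hinner (FObj F' x) (cmp f x v) w = hinner (FObj F x) v (cmp (Star \<C> f) x w)"
proof -
  note F = HomD(1)[OF f] and F' = HomD(2)[OF f]
  let ?adj = "\<lambda>x. adjoint_map (FObj F x) (FObj F' x) (cmp f x)"
  have adj: "?adj x \<in> bounded_linear_maps (FObj F' x) (FObj F x)"
    "\<And>v w. v \<in> carrier (FObj F x) \<Longrightarrow> w \<in> carrier (FObj F' x) \<Longrightarrow>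
      hinner (FObj F' x) (cmp f x v) w = hinner (FObj F x) v (?adj x w)" if x: "x \<in> Obj G" for x
    using adjoint_map_props[OF rep_space(1)[OF F x] rep_space(1)[OF F' x] cmp_blin[OF f x]] by auto
  have blin: "blin (FObj F' x) (FObj F x) (?adj x)" if "x \<in> Obj G" for x
    using adj(1)[OF that] by (simp add: bounded_linear_maps_iff)
  have restr: "adjoint_map (FObj F x) (FObj F' x) (restrict (cmp f x) (carrier (FObj F x)))
      = ?adj x"
    if "x \<in> Obj G" for x
    using HomD(5)[OF f that] by (simp add: bounded_linear_maps_iff extensional_restrict)
  have eq: "Star \<C> f = mk_arr F' ?adj F"
  proof -
    have "Star \<C> (mk_arr F (cmp f) F') = mk_arr F' ?adj F"
      using adj(1) by (auto simp: mk_arr_def URep_def functor_star_category_def Hilb_def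
          groupoid_star_category_def fun_eq_iff restr bounded_linear_maps_iff extensional_restrict)
    then show ?thesis
      by (simp only: HomD(3)[OF f, symmetric])
  qed
  have "?adj (Cod G a) (act F' a v) = act F a (?adj (Dom G a) v)"
    if a: "a \<in> Arr G" and v: "v \<in> carrier (FObj F' (Dom G a))" for a v
  proof -
    let ?x = "Dom G a" and ?y = "Cod G a"
    note xy = Dom_closed[OF a] Cod_closed[OF a]
    interpret D: hilbert_space "FObj F ?y" by (rule rep_space(1)[OF F xy(2)])
    have cl: "?adj ?y (act F' a v) \<in> carrier (FObj F ?y)" "?adj ?x v \<in> carrier (FObj F ?x)"
      using blin_closed[OF blin] xy v a F' by auto
    have "hinner (FObj F ?y) z (?adj ?y (act F' a v)) = hinner (FObj F ?y) z (act F a (?adj ?x v))"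
      if z: "z \<in> carrier (FObj F ?y)" for z
    proof -
      let ?z = "act F (ginv a) z"
      have z': "?z \<in> carrier (FObj F ?x)"
        using act_closed[OF F ginv_Arr(1)[OF a]] z a by simp
      have zz: "act F a ?z = z"
        using act_ginv(2)[OF F a z] .
      have "hinner (FObj F ?y) z (?adj ?y (act F' a v)) = hinner (FObj F' ?y) (cmp f ?y
          (act F a ?z)) (act F' a v)"
        using adj(2)[OF xy(2) z, of "act F' a v"] a v F' zz by simp
      also have "\<dots> = hinner (FObj F' ?y) (act F' a (cmp f ?x ?z)) (act F' a v)"
        using cmp_natural[OF f a z'] by simp
      also have "\<dots> = hinner (FObj F' ?x) (cmp f ?x ?z) v"
        using cmp_closed[OF f xy(1) z'] act_isometry[OF F' a _ v] by simp
      also have "\<dots> = hinner (FObj F ?x) ?z (?adj ?x v)"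
        using adj(2)[OF xy(1) z' v] .
      also have "\<dots> = hinner (FObj F ?y) (act F a ?z) (act F a (?adj ?x v))"
        using act_isometry[OF F a z' cl(2)] by simp
      finally show ?thesis
        using zz by simp
    qed
    then show ?thesis
      using cl a F D.hinner_commute by (intro D.hinner_eqI) (metis act_closed)+
  qed
  then have int: "intertwines F' F ?adj"
    using blin by (simp add: intertwines_def)
  show "Star \<C> f \<in> Hom \<C> F' F"
    unfolding eq by (rule mk_arr_in_Hom[OF F' F int])
  show "hinner (FObj F' x) (cmp f x v) w = hinner (FObj F x) v (cmp (Star \<C> f) x w)"
    if "x \<in> Obj G" "v \<in> carrier (FObj F x)" "w \<in> carrier (FObj F' x)" for x v w
    using that adj(2) by (simp add: eq)
qed

end


section \<open>Hilbert spaces of families of vectors\<close>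

lemma (in inner_product_space) add_in: "x \<in> carrier H \<Longrightarrow> y \<in> carrier H \<Longrightarrow> x \<oplus>\<^bsub>H\<^esub> y \<in> carrier H"
  by simp

lemma (in inner_product_space) zero_in: "\<zero>\<^bsub>H\<^esub> \<in> carrier H"
  by simp

text \<open>Pointwise operations on families indexed by \<open>J\<close>, extensional outside of \<open>J\<close>.\<close>

definition fam_add :: "'i set \<Rightarrow> ('i \<Rightarrow> 'v hilb) \<Rightarrow> ('i \<Rightarrow> 'v) \<Rightarrow> ('i \<Rightarrow> 'v) \<Rightarrow> ('i \<Rightarrow> 'v)" where
  "fam_add J X v w = (\<lambda>j\<in>J. v j \<oplus>\<^bsub>X j\<^esub> w j)"

definition fam_smult :: "'i set \<Rightarrow> ('i \<Rightarrow> 'v hilb) \<Rightarrow> complex \<Rightarrow> ('i \<Rightarrow> 'v) \<Rightarrow> ('i \<Rightarrow> 'v)" where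
  "fam_smult J X c v = (\<lambda>j\<in>J. c \<odot>\<^bsub>X j\<^esub> v j)"

definition fam_zero :: "'i set \<Rightarrow> ('i \<Rightarrow> 'v hilb) \<Rightarrow> ('i \<Rightarrow> 'v)" where
  "fam_zero J X = (\<lambda>j\<in>J. \<zero>\<^bsub>X j\<^esub>)"

text \<open>
  A space \<open>S\<close> of families with pointwise operations and an inner product whose norm dominates
  the norms of all components. Such an inner product is definite, and a Cauchy sequence has a
  componentwise limit; the last assumption says that it converges to this limit. Kernels,
  products and limits of diagrams of Hilbert spaces are all of this form.
\<close>

locale hilbert_family =
  fixes J :: "'i set" and X :: "'i \<Rightarrow> 'v hilb" and S :: "('i \<Rightarrow> 'v) set"
    and ip :: "('i \<Rightarrow> 'v) \<Rightarrow> ('i \<Rightarrow> 'v) \<Rightarrow> complex"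
  assumes X_hilbert: "j \<in> J \<Longrightarrow> hilbert_space (X j)"
    and S_subset: "S \<subseteq> (\<Pi>\<^sub>E j\<in>J. carrier (X j))"
    and S_zero: "fam_zero J X \<in> S"
    and S_add: "v \<in> S \<Longrightarrow> w \<in> S \<Longrightarrow> fam_add J X v w \<in> S"
    and S_smult: "v \<in> S \<Longrightarrow> fam_smult J X c v \<in> S"
    and ip_add: "v \<in> S \<Longrightarrow> w \<in> S \<Longrightarrow> z \<in> S \<Longrightarrow> ip (fam_add J X v w) z = ip v z + ip w z"
    and ip_smult: "v \<in> S \<Longrightarrow> w \<in> S \<Longrightarrow> ip (fam_smult J X c v) w = c * ip v w"
    and ip_commute: "v \<in> S \<Longrightarrow> w \<in> S \<Longrightarrow> ip w v = cnj (ip v w)"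
    and ip_nonneg: "v \<in> S \<Longrightarrow> 0 \<le> Re (ip v v)"
    and ip_dominates: "v \<in> S \<Longrightarrow> j \<in> J \<Longrightarrow> (hnorm (X j) (v j))\<^sup>2 \<le> Re (ip v v)"
    and ip_complete: "(\<And>n. \<sigma> n \<in> S) \<Longrightarrow> l \<in> (\<Pi>\<^sub>E j\<in>J. carrier (X j)) \<Longrightarrow>
      (\<And>j. j \<in> J \<Longrightarrow> (\<lambda>n. hnorm (X j) (\<sigma> n j \<ominus>\<^bsub>X j\<^esub> l j)) \<longlonglongrightarrow> 0) \<Longrightarrow>
      (\<And>e. e > 0 \<Longrightarrow> \<exists>N. \<forall>m\<ge>N. \<forall>n\<ge>N.
        sqrt (Re (ip (fam_add J X (\<sigma> m) (fam_smult J X (-1) (\<sigma> n)))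
          (fam_add J X (\<sigma> m) (fam_smult J X (-1) (\<sigma> n))))) < e) \<Longrightarrow>
      l \<in> S \<and> (\<lambda>n. sqrt (Re (ip (fam_add J X (\<sigma> n) (fam_smult J X (-1) l))
          (fam_add J X (\<sigma> n) (fam_smult J X (-1) l))))) \<longlonglongrightarrow> 0"
begin

text \<open>
  All Hilbert spaces have vectors of type \<open>'v\<close>, so the families in \<open>S\<close> are encoded by an injection
  \<open>\<phi>\<close> on \<open>S\<close>.
\<close>

definition fam_space :: "(('i \<Rightarrow> 'v) \<Rightarrow> 'v) \<Rightarrow> 'v hilb" where
  "fam_space \<phi> = \<lparr>carrier = \<phi> ` S, monoid.mult = undefined, one = undefined, zero = \<phi>
      (fam_zero J X),
     add = (\<lambda>x y. \<phi> (fam_add J X (inv_into S \<phi> x) (inv_into S \<phi> y))),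
     smult = (\<lambda>c x. \<phi> (fam_smult J X c (inv_into S \<phi> x))),
     hinner = (\<lambda>x y. ip (inv_into S \<phi> x) (inv_into S \<phi> y))\<rparr>"

lemma S_component: "v \<in> S \<Longrightarrow> j \<in> J \<Longrightarrow> v j \<in> carrier (X j)"
  using S_subset by (auto dest!: subsetD PiE_mem)

lemma S_eqI:
  assumes "v \<in> S" "w \<in> S" "\<And>j. j \<in> J \<Longrightarrow> v j = w j"
  shows "v = w"
  using assms S_subset by (intro PiE_ext[of v J "\<lambda>j. carrier (X j)" w]) auto

lemma hilbert_space_fam_space:
  assumes \<phi>: "inj_on \<phi> S"
  shows "hilbert_space (fam_space \<phi>)"
proof -
  let ?H = "fam_space \<phi>" and ?d = "\<lambda>v w. fam_add J X v (fam_smult J X (-1) w)"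
  have carr: "carrier ?H = \<phi> ` S"
    by (simp add: fam_space_def)
  have ops [simp]: "\<zero>\<^bsub>?H\<^esub> = \<phi> (fam_zero J X)"
    "v \<in> S \<Longrightarrow> w \<in> S \<Longrightarrow> \<phi> v \<oplus>\<^bsub>?H\<^esub> \<phi> w = \<phi> (fam_add J X v w)"
    "v \<in> S \<Longrightarrow> c \<odot>\<^bsub>?H\<^esub> \<phi> v = \<phi> (fam_smult J X c v)"
    "v \<in> S \<Longrightarrow> w \<in> S \<Longrightarrow> hinner ?H (\<phi> v) (\<phi> w) = ip v w" for v w c
    using \<phi> by (auto simp: fam_space_def)
  have comp [simp]: "fam_zero J X j = \<zero>\<^bsub>X j\<^esub>" "fam_add J X v w j = v j \<oplus>\<^bsub>X j\<^esub> w j"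
    "fam_smult J X c v j = c \<odot>\<^bsub>X j\<^esub> v j" if "j \<in> J" for j c v w
    using that by (simp_all add: fam_zero_def fam_add_def fam_smult_def)
  note [simp] = S_zero S_add S_smult S_component
  have eq: "\<phi> v = \<phi> w" if "v \<in> S" "w \<in> S"
    and "\<And>j z. j \<in> J \<Longrightarrow> inner_product_space (X j) \<Longrightarrow> z \<in> carrier (X j) \<Longrightarrow>
        hinner (X j) (v j) z = hinner (X j) (w j) z" for v w
  proof (intro arg_cong[of _ _ \<phi>] S_eqI that(1,2))
    fix j assume j: "j \<in> J"
    interpret hilbert_space "X j" by (rule X_hilbert[OF j])
    show "v j = w j"
      using S_component[OF that(1) j] S_component[OF that(2) j]
      by (rule hinner_eqI) (rule that(3)[OF j inner_product_space_axioms])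
  qed
  note simps = inner_product_space.hinner_left inner_product_space.hinner_zero_left
    inner_product_space.smult_in inner_product_space.add_in inner_product_space.zero_in
  have norm_d: "hnorm ?H (\<phi> v \<oplus>\<^bsub>?H\<^esub> (-1) \<odot>\<^bsub>?H\<^esub> \<phi> w) = sqrt (Re (ip (?d v w) (?d v w)))"
      if "v \<in> S" "w \<in> S" for v w
    using that by (simp add: hnorm_def)
  show ?thesis
  proof (rule hilbert_spaceI, unfold carr)
    show "\<zero>\<^bsub>?H\<^esub> \<in> \<phi> ` S"
      by simp
  next
    fix x assume "x \<in> \<phi> ` S" "hinner ?H x x = 0"
    then obtain v where v: "v \<in> S" "x = \<phi> v" "ip v v = 0"
      by auto
    have "v = fam_zero J X"
    proof (rule S_eqI)
      fix j assume j: "j \<in> J"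
      interpret hilbert_space "X j" by (rule X_hilbert[OF j])
      have "(hnorm (X j) (v j))\<^sup>2 \<le> 0"
        using ip_dominates[OF v(1) j] v(3) by simp
      then show "v j = fam_zero J X j"
        using v(1) j hnorm_eq_0 by simp
    qed (use v in auto)
    then show "x = \<zero>\<^bsub>?H\<^esub>"
      by (simp add: v(2))
  next
    fix \<sigma> :: "nat \<Rightarrow> 'v"
    assume \<sigma>: "\<And>n. \<sigma> n \<in> \<phi> ` S"
      and cau: "\<And>e. e > 0 \<Longrightarrow> \<exists>N. \<forall>m\<ge>N. \<forall>n\<ge>N. hnorm ?H (\<sigma> m \<oplus>\<^bsub>?H\<^esub> (-1) \<odot>\<^bsub>?H\<^esub> \<sigma> n) < e"
    define \<tau> where "\<tau> n = inv_into S \<phi> (\<sigma> n)" for n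
    have \<tau>: "\<tau> n \<in> S" "\<sigma> n = \<phi> (\<tau> n)" for n
      using \<sigma>[of n] unfolding \<tau>_def by (auto simp: inv_into_into f_inv_into_f)
    have cau': "\<exists>N. \<forall>m\<ge>N. \<forall>n\<ge>N. sqrt (Re (ip (?d (\<tau> m) (\<tau> n)) (?d (\<tau> m) (\<tau> n)))) < e" if "e > 0"
        for e
      using cau[OF that] by (simp only: \<tau>(2) norm_d[OF \<tau>(1) \<tau>(1)])
    have "\<exists>l. l \<in> carrier (X j) \<and> (\<lambda>n. hnorm (X j) (\<tau> n j \<ominus>\<^bsub>X j\<^esub> l)) \<longlonglongrightarrow> 0" if j: "j \<in> J" for j
    proof -
      interpret hilbert_space "X j" by (rule X_hilbert[OF j])
      have le: "hnorm (X j) (\<tau> m j \<ominus>\<^bsub>X j\<^esub> \<tau> n j) \<le> sqrt (Re (ip (?d (\<tau> m) (\<tau> n)) (?d (\<tau> m)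
          (\<tau> n))))" for m n
        using ip_dominates[of "?d (\<tau> m) (\<tau> n)" j] \<tau>(1) j
        by (simp add: real_le_rsqrt minus_conv_smult)
      have "\<exists>N. \<forall>m\<ge>N. \<forall>n\<ge>N. hnorm (X j) (\<tau> m j \<ominus>\<^bsub>X j\<^esub> \<tau> n j) < e" if "e > 0" for e
        using cau'[OF that] le by (meson le_less_trans)
      then show ?thesis
        using Cauchy_converges[of "\<lambda>n. \<tau> n j"] \<tau>(1) j S_component by metis
    qed
    then obtain l0 where l0: "\<And>j. j \<in> J \<Longrightarrow>
        l0 j \<in> carrier (X j) \<and> (\<lambda>n. hnorm (X j) (\<tau> n j \<ominus>\<^bsub>X j\<^esub> l0 j)) \<longlonglongrightarrow> 0"
      by metis
    let ?l = "restrict l0 J"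
    have l: "?l \<in> S \<and> (\<lambda>n. sqrt (Re (ip (?d (\<tau> n) ?l) (?d (\<tau> n) ?l)))) \<longlonglongrightarrow> 0"
      by (rule ip_complete) (use l0 \<tau>(1) cau' in auto)
    have "hnorm ?H (\<sigma> n \<oplus>\<^bsub>?H\<^esub> (-1) \<odot>\<^bsub>?H\<^esub> \<phi> ?l) = sqrt (Re (ip (?d (\<tau> n) ?l) (?d (\<tau> n) ?l)))" for n
      using norm_d[OF \<tau>(1)[of n], of ?l] l by (simp only: \<tau>(2))
    then show "\<exists>l\<in>\<phi> ` S. (\<lambda>n. hnorm ?H (\<sigma> n \<oplus>\<^bsub>?H\<^esub> (-1) \<odot>\<^bsub>?H\<^esub> l)) \<longlonglongrightarrow> 0"
      using l by (intro bexI[of _ "\<phi> ?l"]) simp_all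
  qed (auto simp: ip_add ip_smult ip_nonneg algebra_simps intro!: eq simp: simps intro: ip_commute)
qed

end

text \<open>
  \<open>represents_family J X S ip L p\<close> says that the vectors of the representation \<open>L\<close> are, via the
  projections \<open>p\<close>, the families in \<open>S\<close>, with inner product \<open>ip\<close>.
\<close>

definition (in unitary_reps) represents_family where
  "represents_family J X S ip L p \<longleftrightarrow> L \<in> Obj \<C> \<and> (\<forall>j\<in>J. p j \<in> Hom \<C> L (X j)) \<and>
     (\<forall>x\<in>Obj G. bij_betw (\<lambda>v. \<lambda>j\<in>J. cmp (p j) x v) (carrier (FObj L x)) (S x) \<and>
       (\<forall>v\<in>carrier (FObj L x). \<forall>w\<in>carrier (FObj L x).
          hinner (FObj L x) v w = ip x (\<lambda>j\<in>J. cmp (p j) x v) (\<lambda>j\<in>J. cmp (p j) x w)))"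

context unitary_reps
begin

text \<open>
  Pointwise Hilbert spaces of families that are invariant under the componentwise action of \<open>G\<close>
  assemble to a representation. Smallness provides the encoding of families as vectors.
\<close>

lemma ex_represents_family:
  assumes X: "\<And>j. j \<in> J \<Longrightarrow> X j \<in> Obj \<C>"
    and fam: "\<And>x. x \<in> Obj G \<Longrightarrow> hilbert_family J (\<lambda>j. FObj (X j) x) (S x) (ip x)"
    and small: "\<And>x. x \<in> Obj G \<Longrightarrow> \<exists>D\<in>\<U>. S x \<lesssim> D"
    and small_closed: "\<And>A B. A \<in> \<U> \<Longrightarrow> B \<lesssim> A \<Longrightarrow> B \<in> \<U>"
    and S_act: "\<And>a v. a \<in> Arr G \<Longrightarrow> v \<in> S (Dom G a) \<Longrightarrow> (\<lambda>j\<in>J. act (X j) a (v j)) \<in> S (Cod G a)"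
    and ip_act: "\<And>a v w. a \<in> Arr G \<Longrightarrow> v \<in> S (Dom G a) \<Longrightarrow> w \<in> S (Dom G a) \<Longrightarrow>
      ip (Cod G a) (\<lambda>j\<in>J. act (X j) a (v j)) (\<lambda>j\<in>J. act (X j) a (w j)) = ip (Dom G a) v w"
  shows "\<exists>L p. represents_family J X S ip L p"
proof -
  have "\<exists>\<phi>. inj_on \<phi> (S x) \<and> \<phi> ` S x \<in> \<U>" if x: "x \<in> Obj G" for x
  proof -
    obtain D \<phi> where "D \<in> \<U>" "inj_on \<phi> (S x)" "\<phi> ` S x \<subseteq> D"
      using small[OF x] unfolding lepoll_def by blast
    then show ?thesis
      using small_closed[OF \<open>D \<in> \<U>\<close> subset_imp_lepoll] by blast
  qed
  then obtain \<phi> where \<phi>: "\<And>x. x \<in> Obj G \<Longrightarrow> inj_on (\<phi> x) (S x)" "\<And>x. x \<in> Obj G \<Longrightarrow> \<phi> x ` S x \<in> \<U>"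
    by metis
  define H where "H x = hilbert_family.fam_space J (\<lambda>j. FObj (X j) x) (S x) (ip x) (\<phi> x)" for x
  define \<psi> where "\<psi> x = inv_into (S x) (\<phi> x)" for x
  define u where "u a v = \<phi> (Cod G a) (\<lambda>j\<in>J. act (X j) a (\<psi> (Dom G a) v j))" for a v
  have carr: "carrier (H x) = \<phi> x ` S x" if x: "x \<in> Obj G" for x
    using hilbert_family.fam_space_def[OF fam[OF x]] by (simp add: H_def)
  have \<psi>\<phi> [simp]: "\<psi> x (\<phi> x v) = v" if "x \<in> Obj G" "v \<in> S x" for x v
    using that \<phi>(1) by (simp add: \<psi>_def)
  have smult: "c \<odot>\<^bsub>H x\<^esub> \<phi> x v = \<phi> x (fam_smult J (\<lambda>j. FObj (X j) x) c v)"
    if "x \<in> Obj G" "v \<in> S x" for x v c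
    using that \<phi>(1) hilbert_family.fam_space_def[OF fam[OF that(1)]] by (simp add: H_def)
  have ops: "\<phi> x v \<oplus>\<^bsub>H x\<^esub> \<phi> x w = \<phi> x (fam_add J (\<lambda>j. FObj (X j) x) v w)"
    "hinner (H x) (\<phi> x v) (\<phi> x w) = ip x v w" if "x \<in> Obj G" "v \<in> S x" "w \<in> S x" for x v w
    using that \<phi>(1) hilbert_family.fam_space_def[OF fam[OF that(1)]] by (simp_all add: H_def)
  have hilb: "hilbert_space (H x)" if x: "x \<in> Obj G" for x
    unfolding H_def by (rule hilbert_family.hilbert_space_fam_space[OF fam[OF x] \<phi>(1)[OF x]])
  have Sc: "v j \<in> carrier (FObj (X j) x)" if "x \<in> Obj G" "v \<in> S x" "j \<in> J" for x v j
    by (rule hilbert_family.S_component[OF fam[OF that(1)] that(2,3)])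
  note S_add = hilbert_family.S_add[OF fam] and S_smult = hilbert_family.S_smult[OF fam]
  note DC = Dom_closed Cod_closed
  have u\<phi>: "u a (\<phi> (Dom G a) v) = \<phi> (Cod G a) (\<lambda>j\<in>J. act (X j) a (v j))"
      if "a \<in> Arr G" "v \<in> S (Dom G a)" for a v
    using that DC by (simp add: u_def)
  have u_isom: "hinner (H (Cod G a)) (u a v) (u a w) = hinner (H (Dom G a)) v w"
    if "a \<in> Arr G" "v \<in> carrier (H (Dom G a))" "w \<in> carrier (H (Dom G a))" for a v w
    using that DC carr ops(2) S_act ip_act by (auto simp: u\<phi>)
  have u_blin: "blin (H (Dom G a)) (H (Cod G a)) (u a)" if a: "a \<in> Arr G" for a
    unfolding blin_def
  proof (intro conjI ballI allI exI)
    fix x assume x: "x \<in> carrier (H (Dom G a))"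
    then obtain v where v: "v \<in> S (Dom G a)" "x = \<phi> (Dom G a) v"
      using carr DC a by auto
    show "u a x \<in> carrier (H (Cod G a))"
      using v a DC S_act by (auto simp: u\<phi> carr)
    show "hnorm (H (Cod G a)) (u a x) \<le> 1 * hnorm (H (Dom G a)) x"
      using u_isom[OF a x x] by (simp add: hnorm_def)
    show "u a (c \<odot>\<^bsub>H (Dom G a)\<^esub> x) = c \<odot>\<^bsub>H (Cod G a)\<^esub> u a x" for c
    proof -
      have "(\<lambda>j\<in>J. act (X j) a (fam_smult J (\<lambda>j. FObj (X j) (Dom G a)) c v j)) =
          fam_smult J (\<lambda>j. FObj (X j) (Cod G a)) c (\<lambda>j\<in>J. act (X j) a (v j))"
        using v a DC Sc blin_smult_vec[OF rep_arr(3)[OF X a]]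
        by (auto simp: fam_smult_def fun_eq_iff)
      then show ?thesis
        using v a DC S_act S_smult by (simp add: ops smult u\<phi>)
    qed
    fix y assume y: "y \<in> carrier (H (Dom G a))"
    then obtain w where w: "w \<in> S (Dom G a)" "y = \<phi> (Dom G a) w"
      using carr DC a by auto
    show "u a (x \<oplus>\<^bsub>H (Dom G a)\<^esub> y) = u a x \<oplus>\<^bsub>H (Cod G a)\<^esub> u a y"
    proof -
      have "(\<lambda>j\<in>J. act (X j) a (fam_add J (\<lambda>j. FObj (X j) (Dom G a)) v w j)) =
          fam_add J (\<lambda>j. FObj (X j) (Cod G a)) (\<lambda>j\<in>J. act (X j) a (v j)) (\<lambda>j\<in>J. act (X j) a (w j))"
        using v w a DC Sc blin_add_vec[OF rep_arr(3)[OF X a]] by (auto simp: fam_add_def fun_eq_iff)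
      then show ?thesis
        using v w a DC S_act S_add by (simp add: ops smult u\<phi>)
    qed
  qed
  define L where "L = mk_rep H u"
  have S_ext: "(\<lambda>j\<in>J. v j) = v" if "x \<in> Obj G" "v \<in> S x" for x v
    using hilbert_family.S_subset[OF fam[OF that(1)]] that(2)
    by (auto simp: PiE_def extensional_restrict)
  have L: "L \<in> Obj \<C>"
    unfolding L_def
  proof (rule mk_rep_in_Obj)
    show "u (Ident G x) v = v" if x: "x \<in> Obj G" and v: "v \<in> carrier (H x)" for x v
    proof -
      obtain w where w: "w \<in> S x" "v = \<phi> x w"
        using v carr x by auto
      have I: "Ident G x \<in> Arr G" "Dom G (Ident G x) = x" "Cod G (Ident G x) = x"
        using Ident_closed[OF x] by (auto simp: Hom_def)
      have "(\<lambda>j\<in>J. act (X j) (Ident G x) (w j)) = (\<lambda>j\<in>J. w j)"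
        using X x Sc[OF x w(1)] by (auto simp: fun_eq_iff act_Ident)
      then show ?thesis
        using u\<phi>[OF I(1), of w] w I S_ext[OF x w(1)] by simp
    qed
    show "u (b \<circ>\<^bsub>G\<^esub> a) v = u b (u a v)"
        if a: "a \<in> Hom G x y" and b: "b \<in> Hom G y z" and v: "v \<in> carrier (H x)" for a b x y z v
    proof -
      have ab: "a \<in> Arr G" "Dom G a = x" "Cod G a = y" "b \<in> Arr G" "Dom G b = y" "Cod G b = z"
        "b \<circ>\<^bsub>G\<^esub> a \<in> Arr G" "Dom G (b \<circ>\<^bsub>G\<^esub> a) = x" "Cod G (b \<circ>\<^bsub>G\<^esub> a) = z"
        using a b Comp_closed[OF a b] by (auto simp: Hom_def)
      have x: "x \<in> Obj G"
        using ab DC by blast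
      obtain w where w: "w \<in> S x" "v = \<phi> x w"
        using v carr x by auto
      have "(\<lambda>j\<in>J. act (X j) (b \<circ>\<^bsub>G\<^esub> a) (w j)) = (\<lambda>j\<in>J. act (X j) b ((\<lambda>j\<in>J. act (X j) a (w j)) j))"
        using X Sc[OF x w(1)] act_Comp[OF X a b] by (auto simp: fun_eq_iff)
      then show ?thesis
        using u\<phi>[OF ab(7), of w] u\<phi>[OF ab(1), of w] u\<phi>[OF ab(4), of "\<lambda>j\<in>J. act (X j) a
            (w j)"] w ab S_act[OF ab(1), of w]
        by simp
    qed
  qed (use hilb carr \<phi>(2) u_blin u_isom in auto)
  have FL [simp]: "FObj L x = H x" if "x \<in> Obj G" for x
    using that by (simp add: L_def)
  define p where "p j = mk_arr L (\<lambda>x v. \<psi> x v j) (X j)" for j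
  have p: "p j \<in> Hom \<C> L (X j)" if j: "j \<in> J" for j
    unfolding p_def
  proof (rule mk_arr_in_Hom[OF L X[OF j]], unfold intertwines_def, intro conjI ballI)
    fix x assume x: "x \<in> Obj G"
    interpret Xj: hilbert_space "FObj (X j) x" by (rule rep_space(1)[OF X[OF j] x])
    interpret H: hilbert_space "H x" by (rule hilb[OF x])
    have bound: "hnorm (FObj (X j) x) (v j) \<le> hnorm (H x) (\<phi> x v)" if v: "v \<in> S x" for v
      using hilbert_family.ip_dominates[OF fam[OF x] v j] ops(2)[OF x v v]
      by (simp add: hnorm_def[of "H x"] real_le_rsqrt)
    show "blin (FObj L x) (FObj (X j) x) (\<lambda>v. \<psi> x v j)"
      unfolding blin_def FL[OF x] carr[OF x]
    proof (intro conjI allI)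
      show "\<exists>B. \<forall>v\<in>\<phi> x ` S x. hnorm (FObj (X j) x) (\<psi> x v j) \<le> B * hnorm (H x) v"
        using bound x by (intro exI[of _ 1]) auto
    qed (use x j Sc S_add S_smult
        in \<open>auto simp: ops smult fam_add_def[of J _ _ _ , THEN fun_cong] fam_smult_def[of J _ _ _,
            THEN fun_cong]\<close>)
  next
    fix a v assume a: "a \<in> Arr G" and v: "v \<in> carrier (FObj L (Dom G a))"
    then have v': "v \<in> carrier (H (Dom G a))"
      using DC by simp
    then obtain w where w: "w \<in> S (Dom G a)" "v = \<phi> (Dom G a) w"
      using carr DC a by auto
    have "act L a v = u a v"
      using a v' by (simp add: L_def)
    then show "\<psi> (Cod G a) (act L a v) j = act (X j) a (\<psi> (Dom G a) v j)"
      using w u\<phi>[OF a w(1)] a DC S_act j by simp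
  qed
  have tup: "(\<lambda>j\<in>J. cmp (p j) x (\<phi> x v)) = v" if x: "x \<in> Obj G" and v: "v \<in> S x" for x v
    using S_ext[OF x v] x v carr by (auto simp: p_def fun_eq_iff restrict_def)
  have "bij_betw (\<lambda>v. \<lambda>j\<in>J. cmp (p j) x v) (carrier (FObj L x)) (S x)" if x: "x \<in> Obj G" for x
  proof (rule bij_betw_byWitness[where f' = "\<phi> x"])
    show "\<forall>v\<in>carrier (FObj L x). \<phi> x (\<lambda>j\<in>J. cmp (p j) x v) = v"
      using x tup[OF x] by (auto simp: carr)
  qed (use x tup[OF x] in \<open>auto simp: carr\<close>)
  then have "represents_family J X S ip L p"
    unfolding represents_family_def using L p tup ops(2) by (auto simp: carr)
  then show ?thesis
    by blast
qed

lemma represents_familyD: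
  assumes "represents_family J X S ip L p"
  shows "L \<in> Obj \<C>" and "\<And>j. j \<in> J \<Longrightarrow> p j \<in> Hom \<C> L (X j)"
    and "\<And>x v. x \<in> Obj G \<Longrightarrow> v \<in> carrier (FObj L x) \<Longrightarrow> (\<lambda>j\<in>J. cmp (p j) x v) \<in> S x"
    and "\<And>x v w. x \<in> Obj G \<Longrightarrow> v \<in> carrier (FObj L x) \<Longrightarrow> w \<in> carrier (FObj L x) \<Longrightarrow>
      hinner (FObj L x) v w = ip x (\<lambda>j\<in>J. cmp (p j) x v) (\<lambda>j\<in>J. cmp (p j) x w)"
    and "\<And>x v w. x \<in> Obj G \<Longrightarrow> v \<in> carrier (FObj L x) \<Longrightarrow> w \<in> carrier (FObj L x) \<Longrightarrow>
      (\<And>j. j \<in> J \<Longrightarrow> cmp (p j) x v = cmp (p j) x w) \<Longrightarrow> v = w"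
    and "\<And>x s. x \<in> Obj G \<Longrightarrow> s \<in> S x \<Longrightarrow> \<exists>v\<in>carrier (FObj L x). \<forall>j\<in>J. cmp (p j) x v = s j"
proof -
  have bij: "bij_betw (\<lambda>v. \<lambda>j\<in>J. cmp (p j) x v) (carrier (FObj L x)) (S x)" if "x \<in> Obj G" for x
    using assms that by (simp add: represents_family_def)
  show "L \<in> Obj \<C>" and "\<And>j. j \<in> J \<Longrightarrow> p j \<in> Hom \<C> L (X j)"
    and "\<And>x v w. x \<in> Obj G \<Longrightarrow> v \<in> carrier (FObj L x) \<Longrightarrow> w \<in> carrier (FObj L x) \<Longrightarrow>
      hinner (FObj L x) v w = ip x (\<lambda>j\<in>J. cmp (p j) x v) (\<lambda>j\<in>J. cmp (p j) x w)"
    using assms by (auto simp: represents_family_def)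
  show "\<And>x v. x \<in> Obj G \<Longrightarrow> v \<in> carrier (FObj L x) \<Longrightarrow> (\<lambda>j\<in>J. cmp (p j) x v) \<in> S x"
    by (rule bij_betw_apply[OF bij])
  show "v = w" if "x \<in> Obj G" "v \<in> carrier (FObj L x)" "w \<in> carrier (FObj L x)"
    "\<And>j. j \<in> J \<Longrightarrow> cmp (p j) x v = cmp (p j) x w" for x v w
  proof (rule inj_onD[OF bij_betw_imp_inj_on[OF bij[OF that(1)]] _ that(2,3)])
    show "(\<lambda>j\<in>J. cmp (p j) x v) = (\<lambda>j\<in>J. cmp (p j) x w)"
      using that(4) by (rule restrict_ext)
  qed
  show "\<exists>v\<in>carrier (FObj L x). \<forall>j\<in>J. cmp (p j) x v = s j" if x: "x \<in> Obj G" and s: "s \<in> S x" for x s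
  proof -
    obtain v where "v \<in> carrier (FObj L x)" "s = (\<lambda>j\<in>J. cmp (p j) x v)"
      using bij_betw_imp_surj_on[OF bij[OF x]] s by blast
    then show ?thesis
      by auto
  qed
qed

text \<open>
  The universal property: intertwiners \<open>g j\<close> whose values form families in \<open>S\<close> factor uniquely
  through the projections, provided that the resulting map is bounded.
\<close>

lemma ex1_mediating:
  assumes rep: "represents_family J X S ip L p" and Y: "Y \<in> Obj \<C>"
    and g: "\<And>j. j \<in> J \<Longrightarrow> g j \<in> Hom \<C> Y (X j)"
    and gS: "\<And>x y. x \<in> Obj G \<Longrightarrow> y \<in> carrier (FObj Y x) \<Longrightarrow> (\<lambda>j\<in>J. cmp (g j) x y) \<in> S x"
    and bound: "\<And>x. x \<in> Obj G \<Longrightarrow> \<exists>B. \<forall>y\<in>carrier (FObj Y x).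
      Re (ip x (\<lambda>j\<in>J. cmp (g j) x y) (\<lambda>j\<in>J. cmp (g j) x y)) \<le> B * (hnorm (FObj Y x) y)\<^sup>2"
  shows "\<exists>!u. u \<in> Hom \<C> Y L \<and> (\<forall>j\<in>J. p j \<circ>\<^bsub>\<C>\<^esub> u = g j)"
proof -
  note D = represents_familyD[OF rep]
  have "\<exists>v\<in>carrier (FObj L x). \<forall>j\<in>J. cmp (p j) x v = cmp (g j) x y"
      if "x \<in> Obj G" "y \<in> carrier (FObj Y x)" for x y
    using D(6)[OF that(1) gS[OF that]] by simp
  then obtain \<tau> where \<tau>: "\<And>x y. x \<in> Obj G \<Longrightarrow> y \<in> carrier (FObj Y x) \<Longrightarrow> \<tau> x y \<in> carrier (FObj L x)"
    "\<And>x y j. x \<in> Obj G \<Longrightarrow> y \<in> carrier (FObj Y x) \<Longrightarrow> j \<in> J \<Longrightarrow> cmp (p j) x (\<tau> x y) = cmp (g j) x y"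
    by metis
  have int: "intertwines Y L \<tau>"
    unfolding intertwines_def
  proof (intro conjI ballI)
    fix x assume x: "x \<in> Obj G"
    interpret Y: hilbert_space "FObj Y x" by (rule rep_space(1)[OF Y x])
    interpret L: hilbert_space "FObj L x" by (rule rep_space(1)[OF D(1) x])
    note lin = blin_add_vec[OF cmp_blin[OF D(2) x]] blin_smult_vec[OF cmp_blin[OF D(2) x]]
      blin_add_vec[OF cmp_blin[OF g x]] blin_smult_vec[OF cmp_blin[OF g x]]
    obtain B where B: "\<And>y. y \<in> carrier (FObj Y x) \<Longrightarrow>
        Re (ip x (\<lambda>j\<in>J. cmp (g j) x y) (\<lambda>j\<in>J. cmp (g j) x y)) \<le> B * (hnorm (FObj Y x) y)\<^sup>2"
      using bound[OF x] by metis
    show "blin (FObj Y x) (FObj L x) (\<tau> x)"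
      unfolding blin_def
    proof (intro conjI ballI allI exI)
      fix y assume y: "y \<in> carrier (FObj Y x)"
      show "\<tau> x y \<in> carrier (FObj L x)"
        by (rule \<tau>(1)[OF x y])
      show "\<tau> x (c \<odot>\<^bsub>FObj Y x\<^esub> y) = c \<odot>\<^bsub>FObj L x\<^esub> \<tau> x y" for c
        by (rule D(5)[OF x]) (use x y \<tau> in \<open>auto simp: lin\<close>)
      have tup: "(\<lambda>j\<in>J. cmp (p j) x (\<tau> x y)) = (\<lambda>j\<in>J. cmp (g j) x y)"
        by (rule restrict_ext) (rule \<tau>(2)[OF x y])
      have "(hnorm (FObj L x) (\<tau> x y))\<^sup>2 \<le> B * (hnorm (FObj Y x) y)\<^sup>2"
        using B[OF y] D(4)[OF x \<tau>(1)[OF x y] \<tau>(1)[OF x y]] \<tau>(1)[OF x y]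
        by (simp add: L.hnorm_sq tup)
      also have "\<dots> \<le> (sqrt \<bar>B\<bar> * hnorm (FObj Y x) y)\<^sup>2"
        by (simp add: power_mult_distrib mult_right_mono)
      finally show "hnorm (FObj L x) (\<tau> x y) \<le> sqrt \<bar>B\<bar> * hnorm (FObj Y x) y"
        by (rule power2_le_imp_le) (use y in simp)
      fix z assume z: "z \<in> carrier (FObj Y x)"
      show "\<tau> x (y \<oplus>\<^bsub>FObj Y x\<^esub> z) = \<tau> x y \<oplus>\<^bsub>FObj L x\<^esub> \<tau> x z"
        by (rule D(5)[OF x]) (use x y z \<tau> in \<open>auto simp: lin\<close>)
    qed
  next
    fix a y assume a: "a \<in> Arr G" and y: "y \<in> carrier (FObj Y (Dom G a))"
    note xy = Dom_closed[OF a] Cod_closed[OF a]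
    have ay: "act Y a y \<in> carrier (FObj Y (Cod G a))"
      using Y a y by simp
    show "\<tau> (Cod G a) (act Y a y) = act L a (\<tau> (Dom G a) y)"
    proof (rule D(5)[OF xy(2)])
      fix j assume j: "j \<in> J"
      have "cmp (p j) (Cod G a) (\<tau> (Cod G a) (act Y a y)) = cmp (g j) (Cod G a) (act Y a y)"
        by (rule \<tau>(2)[OF xy(2) ay j])
      also have "\<dots> = act (X j) a (cmp (p j) (Dom G a) (\<tau> (Dom G a) y))"
        using cmp_natural[OF g[OF j] a y] \<tau>(2)[OF xy(1) y j] by simp
      also have "\<dots> = cmp (p j) (Cod G a) (act L a (\<tau> (Dom G a) y))"
        using cmp_natural[OF D(2)[OF j] a \<tau>(1)[OF xy(1) y]] by simp
      finally show "cmp (p j) (Cod G a) (\<tau> (Cod G a) (act Y a y)) = cmp (p j) (Cod G a) (act L a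
          (\<tau> (Dom G a) y))" .
    qed (use \<tau>(1) xy y ay a D(1) in auto)
  qed
  let ?u = "mk_arr Y \<tau> L"
  have u: "?u \<in> Hom \<C> Y L"
    by (rule mk_arr_in_Hom[OF Y D(1) int])
  show ?thesis
  proof (rule ex1I[of _ ?u], intro conjI ballI u)
    fix j assume j: "j \<in> J"
    show "p j \<circ>\<^bsub>\<C>\<^esub> ?u = g j"
      by (rule arr_eqI[OF Comp_Hom(1)[OF u D(2)[OF j]] g[OF j]])
        (simp add: Comp_Hom(2)[OF u D(2)[OF j]] \<tau>(2) j)
  next
    fix u' assume u': "u' \<in> Hom \<C> Y L \<and> (\<forall>j\<in>J. p j \<circ>\<^bsub>\<C>\<^esub> u' = g j)"
    then have u'H: "u' \<in> Hom \<C> Y L"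
      by blast
    show "u' = ?u"
    proof (rule arr_eqI[OF u'H u])
      fix x y assume x: "x \<in> Obj G" and y: "y \<in> carrier (FObj Y x)"
      show "cmp u' x y = cmp ?u x y"
      proof (rule D(5)[OF x cmp_closed[OF u'H x y] cmp_closed[OF u x y]])
        fix j assume j: "j \<in> J"
        have "cmp (p j) x (cmp u' x y) = cmp (g j) x y"
          using Comp_Hom(2)[OF u'H D(2)[OF j] x y] u' j by simp
        then show "cmp (p j) x (cmp u' x y) = cmp (p j) x (cmp ?u x y)"
          using x y j by (simp add: \<tau>(2))
      qed
    qed
  qed
qed

end


section \<open>Families with finitely many components\<close>

text \<open>
  For finite \<open>J\<close> a componentwise closed space of families is complete for the sum of the inner
  products. The cases of zero, one and two components give zero objects, kernels and products.
\<close>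

lemma hilbert_family_finite:
  assumes fin: "finite J" and X: "\<And>j. j \<in> J \<Longrightarrow> hilbert_space (X j)"
    and sub: "S \<subseteq> (\<Pi>\<^sub>E j\<in>J. carrier (X j))"
    and zero: "fam_zero J X \<in> S"
    and add: "\<And>v w. v \<in> S \<Longrightarrow> w \<in> S \<Longrightarrow> fam_add J X v w \<in> S"
    and smult: "\<And>c v. v \<in> S \<Longrightarrow> fam_smult J X c v \<in> S"
    and closed: "\<And>\<sigma> l. (\<And>n. \<sigma> n \<in> S) \<Longrightarrow> l \<in> (\<Pi>\<^sub>E j\<in>J. carrier (X j)) \<Longrightarrow>
      (\<And>j. j \<in> J \<Longrightarrow> (\<lambda>n. hnorm (X j) (\<sigma> n j \<ominus>\<^bsub>X j\<^esub> l j)) \<longlonglongrightarrow> 0) \<Longrightarrow> l \<in> S"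
  shows "hilbert_family J X S (\<lambda>v w. \<Sum>j\<in>J. hinner (X j) (v j) (w j))"
proof -
  have ips: "inner_product_space (X j)" if "j \<in> J" for j
  proof -
    interpret hilbert_space "X j" by (rule X[OF that])
    show ?thesis by (rule inner_product_space_axioms)
  qed
  have comp: "v j \<in> carrier (X j)" if "v \<in> S" "j \<in> J" for v j
    using sub that by (auto dest!: subsetD PiE_mem)
  have norm: "Re (\<Sum>j\<in>J. hinner (X j) (v j) (v j)) = (\<Sum>j\<in>J. (hnorm (X j) (v j))\<^sup>2)"
    if "\<And>j. j \<in> J \<Longrightarrow> v j \<in> carrier (X j)" for v
    using that by (simp add: inner_product_space.hnorm_sq[OF ips])
  show ?thesis
  proof (rule hilbert_family.intro)
    fix v w z assume "v \<in> S" "w \<in> S" "z \<in> S"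
    then show "(\<Sum>j\<in>J. hinner (X j) (fam_add J X v w j) (z j)) =
        (\<Sum>j\<in>J. hinner (X j) (v j) (z j)) + (\<Sum>j\<in>J. hinner (X j) (w j) (z j))"
      using comp by (simp add: fam_add_def inner_product_space.hinner_add_left[OF ips] sum.distrib)
  next
    fix v w c assume "v \<in> S" "w \<in> S"
    then show "(\<Sum>j\<in>J. hinner (X j) (fam_smult J X c v j) (w j)) = c * (\<Sum>j\<in>J. hinner (X j) (v j)
        (w j))"
      using comp by (simp add: fam_smult_def inner_product_space.hinner_smult_left[OF ips]
          sum_distrib_left)
  next
    fix v w assume "v \<in> S" "w \<in> S"
    then show "(\<Sum>j\<in>J. hinner (X j) (w j) (v j)) = cnj (\<Sum>j\<in>J. hinner (X j) (v j) (w j))"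
      unfolding cnj_sum by (intro sum.cong refl inner_product_space.hinner_commute[OF ips] comp)
  next
    fix v assume v: "v \<in> S"
    show "0 \<le> Re (\<Sum>j\<in>J. hinner (X j) (v j) (v j))"
      using comp[OF v] by (simp add: norm sum_nonneg del: Re_sum)
    show "(hnorm (X j) (v j))\<^sup>2 \<le> Re (\<Sum>j\<in>J. hinner (X j) (v j) (v j))" if "j \<in> J" for j
    proof -
      have "(hnorm (X j) (v j))\<^sup>2 \<le> (\<Sum>j\<in>J. (hnorm (X j) (v j))\<^sup>2)"
        using that fin by (intro member_le_sum) auto
      then show ?thesis
        using norm[of v] comp[OF v] by simp
    qed
  next
    fix \<sigma> :: "nat \<Rightarrow> 'a \<Rightarrow> 'b" and l
    assume \<sigma>: "\<And>n. \<sigma> n \<in> S" and l: "l \<in> (\<Pi>\<^sub>E j\<in>J. carrier (X j))"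
      and lim: "\<And>j. j \<in> J \<Longrightarrow> (\<lambda>n. hnorm (X j) (\<sigma> n j \<ominus>\<^bsub>X j\<^esub> l j)) \<longlonglongrightarrow> 0"
    let ?d = "\<lambda>n. fam_add J X (\<sigma> n) (fam_smult J X (-1) l)"
    have lc: "l j \<in> carrier (X j)" if "j \<in> J" for j
      using l that by auto
    have d: "?d n j = \<sigma> n j \<ominus>\<^bsub>X j\<^esub> l j" "?d n j \<in> carrier (X j)" if j: "j \<in> J" for n j
    proof -
      interpret inner_product_space "X j" by (rule ips[OF j])
      show "?d n j = \<sigma> n j \<ominus>\<^bsub>X j\<^esub> l j"
        using j comp[OF \<sigma> j] lc[OF j] by (simp add: fam_add_def fam_smult_def minus_conv_smult)
      then show "?d n j \<in> carrier (X j)"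
        using comp[OF \<sigma> j] lc[OF j] by simp
    qed
    have "(\<lambda>n. sqrt (\<Sum>j\<in>J. (hnorm (X j) (\<sigma> n j \<ominus>\<^bsub>X j\<^esub> l j))\<^sup>2)) \<longlonglongrightarrow> sqrt (\<Sum>j\<in>J. 0\<^sup>2)"
      by (intro tendsto_intros lim)
    moreover have "Re (\<Sum>j\<in>J. hinner (X j) (?d n j) (?d n j)) = (\<Sum>j\<in>J. (hnorm (X j) (\<sigma> n j
        \<ominus>\<^bsub>X j\<^esub> l j))\<^sup>2)" for n
    proof -
      have "Re (\<Sum>j\<in>J. hinner (X j) (?d n j) (?d n j)) = (\<Sum>j\<in>J. (hnorm (X j) (?d n j))\<^sup>2)"
        by (rule norm) (rule d(2))
      also have "\<dots> = (\<Sum>j\<in>J. (hnorm (X j) (\<sigma> n j \<ominus>\<^bsub>X j\<^esub> l j))\<^sup>2)"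
        by (rule sum.cong) (simp_all only: d(1))
      finally show ?thesis .
    qed
    ultimately show "l \<in> S \<and> (\<lambda>n. sqrt (Re (\<Sum>j\<in>J. hinner (X j) (?d n j) (?d n j)))) \<longlonglongrightarrow> 0"
      using closed[OF \<sigma> l lim] by simp
  qed (fact X sub zero add smult)+
qed

section \<open>The star-category of unitary representations\<close>

locale small_unitary_reps = unitary_reps G \<U>
  for G :: "('o, 'm) category" and \<U> :: "'v set set" +
  fixes \<I> :: "'j set set"
  assumes small: "small_sets \<I> \<U>"
begin

lemma small_lepoll: "A \<in> \<U> \<Longrightarrow> B \<lesssim> A \<Longrightarrow> B \<in> \<U>"
  using small unfolding small_sets_def by blast

lemma small_Times: "A \<in> \<U> \<Longrightarrow> B \<in> \<U> \<Longrightarrow> \<exists>D\<in>\<U>. A \<times> B \<lesssim> D"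
  using small unfolding small_sets_def by blast

lemma small_PiE: "J \<in> \<I> \<Longrightarrow> (\<And>j. j \<in> J \<Longrightarrow> A j \<in> \<U>) \<Longrightarrow> \<exists>D\<in>\<U>. (\<Pi>\<^sub>E j\<in>J. A j) \<lesssim> D"
  using small unfolding small_sets_def by blast

lemma ex_small_nonempty: "\<exists>A\<in>\<U>. A \<noteq> {}"
proof -
  obtain A where "A \<in> \<U>" "(UNIV :: complex set) \<lesssim> A"
    using small unfolding small_sets_def by blast
  then show ?thesis
    by (auto simp: lepoll_def)
qed

lemma Arr_Hom: "f \<in> Arr \<C> \<Longrightarrow> f \<in> Hom \<C> (Dom \<C> f) (Cod \<C> f)"
  by (simp add: Hom_def)

lemma Hom_Arr: "f \<in> Hom \<C> F F' \<Longrightarrow> f \<in> Arr \<C> \<and> Dom \<C> f = F \<and> Cod \<C> f = F'"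
  by (simp add: Hom_def)

lemma cmp_zero: "f \<in> Hom \<C> F F' \<Longrightarrow> x \<in> Obj G \<Longrightarrow> cmp f x \<zero>\<^bsub>FObj F x\<^esub> = \<zero>\<^bsub>FObj F' x\<^esub>"
  by (rule blin_zero_vec[OF rep_space(1)[OF HomD(1)] rep_space(1)[OF HomD(2)] cmp_blin])

lemma Star_Hom':
  assumes f: "f \<in> Hom \<C> F F'" and x: "x \<in> Obj G" and v: "v \<in> carrier (FObj F x)"
      and w: "w \<in> carrier (FObj F' x)"
  shows "hinner (FObj F x) (cmp (Star \<C> f) x w) v = hinner (FObj F' x) w (cmp f x v)"
proof -
  interpret F: hilbert_space "FObj F x" by (rule rep_space(1)[OF HomD(1)[OF f] x])
  interpret F': hilbert_space "FObj F' x" by (rule rep_space(1)[OF HomD(2)[OF f] x])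
  show ?thesis
    using Star_Hom(2)[OF f x v w] F.hinner_commute[OF v cmp_closed[OF Star_Hom(1)[OF f] x w]]
      F'.hinner_commute[OF cmp_closed[OF f x v] w] by simp
qed

lemma Star_eqI:
  assumes f: "f \<in> Hom \<C> F F'" and g: "g \<in> Hom \<C> F' F"
    and adj: "\<And>x v w. x \<in> Obj G \<Longrightarrow> v \<in> carrier (FObj F x) \<Longrightarrow> w \<in> carrier (FObj F' x) \<Longrightarrow>
      hinner (FObj F x) (cmp g x w) v = hinner (FObj F' x) w (cmp f x v)"
  shows "Star \<C> f = g"
proof (rule arr_eqI[OF Star_Hom(1)[OF f] g])
  fix x w assume x: "x \<in> Obj G" and w: "w \<in> carrier (FObj F' x)"
  interpret F: hilbert_space "FObj F x" by (rule rep_space(1)[OF HomD(1)[OF f] x])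
  show "cmp (Star \<C> f) x w = cmp g x w"
    by (rule F.hinner_eqI[OF cmp_closed[OF Star_Hom(1)[OF f] x w] cmp_closed[OF g x w]])
      (simp add: adj x w Star_Hom'[OF f])
qed

lemma star_category_URep: "star_category \<C>"
proof
  show "Dom \<C> f \<in> Obj \<C>" "Cod \<C> f \<in> Obj \<C>" if "f \<in> Arr \<C>" for f
    using HomD(1,2)[OF Arr_Hom[OF that]] by auto
  show "Ident \<C> X \<in> Hom \<C> X X" if "X \<in> Obj \<C>" for X
    by (rule Ident_Hom(1)[OF that])
  show "g \<circ>\<^bsub>\<C>\<^esub> f \<in> Hom \<C> X Z" if "f \<in> Hom \<C> X Y" "g \<in> Hom \<C> Y Z" for f g X Y Z
    by (rule Comp_Hom(1)[OF that])
  show "Ident \<C> Y \<circ>\<^bsub>\<C>\<^esub> f = f" if f: "f \<in> Hom \<C> X Y" for f X Y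
    by (rule arr_eqI[OF Comp_Hom(1)[OF f Ident_Hom(1)[OF HomD(2)[OF f]]] f])
      (simp add: Comp_Hom(2)[OF f Ident_Hom(1)[OF HomD(2)[OF f]]] Ident_Hom(2)[OF HomD(2)[OF f]]
          cmp_closed[OF f])
  show "f \<circ>\<^bsub>\<C>\<^esub> Ident \<C> X = f" if f: "f \<in> Hom \<C> X Y" for f X Y
    by (rule arr_eqI[OF Comp_Hom(1)[OF Ident_Hom(1)[OF HomD(1)[OF f]] f] f])
      (simp add: Comp_Hom(2)[OF Ident_Hom(1)[OF HomD(1)[OF f]] f] Ident_Hom(2)[OF HomD(1)[OF f]])
  show "(h \<circ>\<^bsub>\<C>\<^esub> g) \<circ>\<^bsub>\<C>\<^esub> f = h \<circ>\<^bsub>\<C>\<^esub> (g \<circ>\<^bsub>\<C>\<^esub> f)"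
    if f: "f \<in> Hom \<C> W X" and g: "g \<in> Hom \<C> X Y" and h: "h \<in> Hom \<C> Y Z" for f g h W X Y Z
    by (rule arr_eqI[OF Comp_Hom(1)[OF f Comp_Hom(1)[OF g h]] Comp_Hom(1)[OF Comp_Hom(1)[OF f g]
        h]])
      (simp add: Comp_Hom(2)[OF f Comp_Hom(1)[OF g h]] Comp_Hom(2)[OF Comp_Hom(1)[OF f g] h]
        Comp_Hom(2)[OF f g] Comp_Hom(2)[OF g h] cmp_closed[OF f])
  show "Star \<C> f \<in> Hom \<C> Y X" if "f \<in> Hom \<C> X Y" for f X Y
    by (rule Star_Hom(1)[OF that])
  show "Star \<C> (Ident \<C> X) = Ident \<C> X" if X: "X \<in> Obj \<C>" for X
    by (rule Star_eqI[OF Ident_Hom(1)[OF X] Ident_Hom(1)[OF X]]) (simp add: Ident_Hom(2)[OF X])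
  show "Star \<C> (g \<circ>\<^bsub>\<C>\<^esub> f) = Star \<C> f \<circ>\<^bsub>\<C>\<^esub> Star \<C> g" if f: "f \<in> Hom \<C> X Y" and g: "g \<in> Hom \<C> Y Z"
      for f g X Y Z
    by (rule Star_eqI[OF Comp_Hom(1)[OF f g] Comp_Hom(1)[OF Star_Hom(1)[OF g] Star_Hom(1)[OF f]]])
      (simp add: Comp_Hom(2)[OF f g] Comp_Hom(2)[OF Star_Hom(1)[OF g] Star_Hom(1)[OF f]]
        Star_Hom'[OF f] Star_Hom'[OF g] cmp_closed[OF f] cmp_closed[OF Star_Hom(1)[OF g]])
  show "Star \<C> (Star \<C> f) = f" if f: "f \<in> Hom \<C> X Y" for f X Y
    by (rule Star_eqI[OF Star_Hom(1)[OF f] f]) (rule Star_Hom(2)[OF f])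
qed

sublocale URep: star_category \<C>
  by (rule star_category_URep)

section \<open>Sums and differences of intertwiners\<close>

text \<open>The intertwiner \<open>f + a g\<close>, written \<open>1 f + a g\<close> to be an instance of \<open>blin_combination\<close>.\<close>

definition comb_arr where
  "comb_arr f a g = mk_arr (Dom \<C> f) (\<lambda>x v. 1 \<odot>\<^bsub>FObj (Cod \<C> f) x\<^esub> cmp f x v \<oplus>\<^bsub>FObj (Cod \<C> f) x\<^esub>
     a \<odot>\<^bsub>FObj (Cod \<C> f) x\<^esub> cmp g x v) (Cod \<C> f)"

lemma comb_arr_Hom:
  assumes f: "f \<in> Hom \<C> F F'" and g: "g \<in> Hom \<C> F F'"
  shows "comb_arr f a g \<in> Hom \<C> F F'"
    and "\<And>x v. x \<in> Obj G \<Longrightarrow> v \<in> carrier (FObj F x) \<Longrightarrow>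
      cmp (comb_arr f a g) x v = cmp f x v \<oplus>\<^bsub>FObj F' x\<^esub> a \<odot>\<^bsub>FObj F' x\<^esub> cmp g x v"
proof -
  note F = HomD(1)[OF f] and F' = HomD(2)[OF f]
  have DC: "Dom \<C> f = F" "Cod \<C> f = F'"
    using Hom_Arr[OF f] by auto
  have one: "1 \<odot>\<^bsub>FObj F' x\<^esub> cmp f x v = cmp f x v" if "x \<in> Obj G" "v \<in> carrier (FObj F x)" for x v
  proof -
    interpret F': hilbert_space "FObj F' x" by (rule rep_space(1)[OF F' that(1)])
    show ?thesis
      using cmp_closed[OF f that] by simp
  qed
  show "comb_arr f a g \<in> Hom \<C> F F'"
    unfolding comb_arr_def DC
  proof (rule mk_arr_in_Hom[OF F F'], unfold intertwines_def, intro conjI ballI)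
    fix x assume x: "x \<in> Obj G"
    show "blin (FObj F x) (FObj F' x) (\<lambda>v. 1 \<odot>\<^bsub>FObj F' x\<^esub> cmp f x v
        \<oplus>\<^bsub>FObj F' x\<^esub> a \<odot>\<^bsub>FObj F' x\<^esub> cmp g x v)"
      by (rule blin_combination[OF rep_space(1)[OF F x] rep_space(1)[OF F' x] cmp_blin[OF f x]
          cmp_blin[OF g x]])
  next
    fix b v assume b: "b \<in> Arr G" and v: "v \<in> carrier (FObj F (Dom G b))"
    note xy = Dom_closed[OF b] Cod_closed[OF b]
    interpret D: hilbert_space "FObj F' (Dom G b)" by (rule rep_space(1)[OF F' xy(1)])
    show "1 \<odot>\<^bsub>FObj F' (Cod G b)\<^esub> cmp f (Cod G b) (act F b v) \<oplus>\<^bsub>FObj F' (Cod G b)\<^esub>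
        a \<odot>\<^bsub>FObj F' (Cod G b)\<^esub> cmp g (Cod G b) (act F b v) =
      act F' b (1 \<odot>\<^bsub>FObj F' (Dom G b)\<^esub> cmp f (Dom G b) v \<oplus>\<^bsub>FObj F' (Dom G b)\<^esub>
        a \<odot>\<^bsub>FObj F' (Dom G b)\<^esub> cmp g (Dom G b) v)"
      using cmp_closed[OF f xy(1) v] cmp_closed[OF g xy(1) v]
      by (simp only: blin_add_vec[OF rep_arr(3)[OF F' b]] blin_smult_vec[OF rep_arr(3)[OF F' b]]
          D.smult_in cmp_natural[OF f b v] cmp_natural[OF g b v])
  qed
  show "cmp (comb_arr f a g) x v = cmp f x v \<oplus>\<^bsub>FObj F' x\<^esub> a \<odot>\<^bsub>FObj F' x\<^esub> cmp g x v"
    if "x \<in> Obj G" "v \<in> carrier (FObj F x)" for x v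
    using that by (simp add: comb_arr_def DC one)
qed

section \<open>Zero objects and zero intertwiners\<close>

lemma PiE_bool_lepoll:
  "(\<Pi>\<^sub>E b\<in>(UNIV :: bool set). A b) \<lesssim> A True \<times> A False"
  unfolding lepoll_def
proof (intro exI conjI)
  show "inj_on (\<lambda>v. (v True, v False)) (\<Pi>\<^sub>E b\<in>(UNIV :: bool set). A b)"
    by (auto simp: inj_on_def fun_eq_iff) (metis (full_types))+
qed auto

text \<open>There is just one family with no components.\<close>

lemma ex_zero_rep: "\<exists>Z\<in>Obj \<C>. \<forall>x\<in>Obj G. carrier (FObj Z x) = {\<zero>\<^bsub>FObj Z x\<^esub>}"
proof -
  obtain A and a :: 'v where A: "A \<in> \<U>" "a \<in> A"
    using ex_small_nonempty by blast
  let ?X = "\<lambda>_ :: unit. undefined :: ('o, 'm, 'v hilb, 'v hilb \<times> ('v \<Rightarrow> 'v) \<times> 'v hilb) star_functor"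
  let ?S = "\<lambda>x. \<Pi>\<^sub>E j\<in>({} :: unit set). carrier (FObj (?X j) x)"
  have "\<exists>L p. represents_family {} ?X ?S (\<lambda>x v w. \<Sum>j\<in>{}. hinner (FObj (?X j) x) (v j) (w j)) L p"
  proof (rule ex_represents_family)
    show "hilbert_family {} (\<lambda>j. FObj (?X j) x) (?S x) (\<lambda>v w. \<Sum>j\<in>{}. hinner (FObj (?X j) x) (v j)
        (w j))" for x
      by (rule hilbert_family_finite) (auto simp: fam_zero_def fam_add_def fam_smult_def)
    show "\<exists>D\<in>\<U>. ?S x \<lesssim> D" for x
      using A by (intro bexI[of _ A]) (auto simp: lepoll_def intro!: exI[of _ "\<lambda>_. a"])
  qed (auto intro: small_lepoll)
  then obtain L p where L: "represents_family {} ?X ?S (\<lambda>x v w. \<Sum>j\<in>{}. hinner (FObj (?X j) x)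
      (v j) (w j)) L p"
    by blast
  have "carrier (FObj L x) = {\<zero>\<^bsub>FObj L x\<^esub>}" if x: "x \<in> Obj G" for x
  proof -
    interpret hilbert_space "FObj L x" by (rule rep_space(1)[OF represents_familyD(1)[OF L] x])
    show ?thesis
      using represents_familyD(5)[OF L x] zero_in by blast
  qed
  then show ?thesis
    using represents_familyD(1)[OF L] by blast
qed

lemma zero_map_Hom:
  assumes F: "F \<in> Obj \<C>" and F': "F' \<in> Obj \<C>"
  shows "mk_arr F (\<lambda>x v. \<zero>\<^bsub>FObj F' x\<^esub>) F' \<in> Hom \<C> F F'"
proof (rule mk_arr_in_Hom[OF F F'], unfold intertwines_def, intro conjI ballI)
  show "blin (FObj F x) (FObj F' x) (\<lambda>v. \<zero>\<^bsub>FObj F' x\<^esub>)" if "x \<in> Obj G" for x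
    by (rule blin_zero[OF rep_space(1)[OF F that] rep_space(1)[OF F' that]])
  show "\<zero>\<^bsub>FObj F' (Cod G a)\<^esub> = act F' a \<zero>\<^bsub>FObj F' (Dom G a)\<^esub>" if "a \<in> Arr G" for a
    using blin_zero_vec[OF rep_space(1)[OF F' Dom_closed[OF that]] rep_space(1)[OF F'
        Cod_closed[OF that]]
        rep_arr(3)[OF F' that]] by simp
qed

lemma zero_objectI:
  assumes Z: "Z \<in> Obj \<C>" and carr: "\<And>x. x \<in> Obj G \<Longrightarrow> carrier (FObj Z x) = {\<zero>\<^bsub>FObj Z x\<^esub>}"
  shows "zero_object \<C> Z"
  unfolding zero_object_def
proof (intro conjI ballI Z)
  fix F assume F: "F \<in> Obj \<C>"
  show "\<exists>!f. f \<in> Hom \<C> F Z"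
  proof (rule ex1I, rule zero_map_Hom[OF F Z])
    fix f assume f: "f \<in> Hom \<C> F Z"
    show "f = mk_arr F (\<lambda>x v. \<zero>\<^bsub>FObj Z x\<^esub>) Z"
      by (rule arr_eqI[OF f zero_map_Hom[OF F Z]]) (use cmp_closed[OF f] carr in simp)
  qed
  show "\<exists>!f. f \<in> Hom \<C> Z F"
  proof (rule ex1I, rule zero_map_Hom[OF Z F])
    fix f assume f: "f \<in> Hom \<C> Z F"
    show "f = mk_arr Z (\<lambda>x v. \<zero>\<^bsub>FObj F x\<^esub>) F"
      by (rule arr_eqI[OF f zero_map_Hom[OF Z F]]) (use cmp_zero[OF f] carr in simp)
  qed
qed

lemma ex_zero_object_URep: "\<exists>Z. zero_object \<C> Z"
proof -
  obtain Z where "Z \<in> Obj \<C>" "\<forall>x\<in>Obj G. carrier (FObj Z x) = {\<zero>\<^bsub>FObj Z x\<^esub>}"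
    using ex_zero_rep by blast
  then show ?thesis
    using zero_objectI[of Z] by auto
qed

lemma zero_arr_iff:
  assumes f: "f \<in> Hom \<C> F F'"
  shows "zero_arr \<C> f \<longleftrightarrow> (\<forall>x\<in>Obj G. \<forall>v\<in>carrier (FObj F x). cmp f x v = \<zero>\<^bsub>FObj F' x\<^esub>)"
proof
  note F = HomD(1)[OF f] and F' = HomD(2)[OF f]
  have DC: "f \<in> Arr \<C>" "Dom \<C> f = F" "Cod \<C> f = F'"
    using Hom_Arr[OF f] by auto
  {
    assume "zero_arr \<C> f"
    then obtain Z a b where Z: "zero_object \<C> Z" and a: "a \<in> Hom \<C> F Z" and b: "b \<in> Hom \<C> Z F'"
      and fba: "f = b \<circ>\<^bsub>\<C>\<^esub> a"
      unfolding zero_arr_def DC by blast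
    have "a = mk_arr F (\<lambda>x v. \<zero>\<^bsub>FObj Z x\<^esub>) Z"
      using Z F a zero_map_Hom[OF F HomD(2)[OF a]] unfolding zero_object_def by blast
    then have "cmp a x v = \<zero>\<^bsub>FObj Z x\<^esub>" if "x \<in> Obj G" "v \<in> carrier (FObj F x)" for x v
      using that by simp
    then show "\<forall>x\<in>Obj G. \<forall>v\<in>carrier (FObj F x). cmp f x v = \<zero>\<^bsub>FObj F' x\<^esub>"
      unfolding fba by (simp add: Comp_Hom(2)[OF a b] cmp_zero[OF b])
  }
  assume zero: "\<forall>x\<in>Obj G. \<forall>v\<in>carrier (FObj F x). cmp f x v = \<zero>\<^bsub>FObj F' x\<^esub>"
  obtain Z where Z: "zero_object \<C> Z" and ZO: "Z \<in> Obj \<C>"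
    using ex_zero_object_URep unfolding zero_object_def by blast
  let ?a = "mk_arr F (\<lambda>x v. \<zero>\<^bsub>FObj Z x\<^esub>) Z" and ?b = "mk_arr Z (\<lambda>x v. \<zero>\<^bsub>FObj F' x\<^esub>) F'"
  note a = zero_map_Hom[OF F ZO] and b = zero_map_Hom[OF ZO F']
  have "f = ?b \<circ>\<^bsub>\<C>\<^esub> ?a"
  proof (rule arr_eqI[OF f Comp_Hom(1)[OF a b]])
    fix x v assume x: "x \<in> Obj G" and v: "v \<in> carrier (FObj F x)"
    show "cmp f x v = cmp (?b \<circ>\<^bsub>\<C>\<^esub> ?a) x v"
      unfolding Comp_Hom(2)[OF a b x v] using zero x cmp_closed[OF a x v] v by simp
  qed
  then show "zero_arr \<C> f"
    unfolding zero_arr_def DC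
    by (intro conjI exI[of _ Z] exI[of _ ?a] exI[of _ ?b] DC(1) Z a b)
qed

section \<open>Orthonormal products\<close>

lemma blin_sq_bound:
  assumes "hilbert_space H" "hilbert_space K" "blin H K f"
  shows "\<exists>B\<ge>0. \<forall>x\<in>carrier H. (hnorm K (f x))\<^sup>2 \<le> B * (hnorm H x)\<^sup>2"
proof -
  interpret K: hilbert_space K by fact
  obtain B where B: "B > 0" "\<And>x. x \<in> carrier H \<Longrightarrow> hnorm K (f x) \<le> B * hnorm H x"
    using blin_bound[OF assms] by metis
  have "(hnorm K (f x))\<^sup>2 \<le> B\<^sup>2 * (hnorm H x)\<^sup>2" if "x \<in> carrier H" for x
    using power_mono[OF B(2)[OF that], of 2] K.hnorm_nonneg[OF blin_closed[OF assms(3) that]]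
    by (simp add: power_mult_distrib)
  then show ?thesis
    by (intro exI[of _ "B\<^sup>2"]) auto
qed

text \<open>The direct sum, as the space of all families indexed by \<open>bool\<close>.\<close>

lemma ex_orthonormal_product_URep:
  assumes F1: "F1 \<in> Obj \<C>" and F2: "F2 \<in> Obj \<C>"
  shows "\<exists>P r1 r2. orthonormal_product \<C> F1 F2 P r1 r2"
proof -
  let ?J = "UNIV :: bool set"
  define X where "X b = (if b then F1 else F2)" for b
  have X: "X b \<in> Obj \<C>" for b
    using F1 F2 by (simp add: X_def)
  let ?S = "\<lambda>x. \<Pi>\<^sub>E b\<in>?J. carrier (FObj (X b) x)"
  let ?ip = "\<lambda>x v w. \<Sum>b\<in>?J. hinner (FObj (X b) x) (v b) (w b)"
  have "\<exists>L p. represents_family ?J X ?S ?ip L p"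
  proof (rule ex_represents_family)
    fix x assume x: "x \<in> Obj G"
    have ips: "inner_product_space (FObj (X b) x)" for b
    proof -
      interpret hilbert_space "FObj (X b) x" by (rule rep_space(1)[OF X x])
      show ?thesis by (rule inner_product_space_axioms)
    qed
    show "hilbert_family ?J (\<lambda>j. FObj (X j) x) (?S x) (?ip x)"
      by (rule hilbert_family_finite[OF finite])
        (auto simp: fam_zero_def fam_add_def fam_smult_def rep_space(1)[OF X x]
          inner_product_space.zero_in[OF ips]
          intro!: inner_product_space.add_in[OF ips] inner_product_space.smult_in[OF ips])
    obtain D where "D \<in> \<U>" "carrier (FObj (X True) x) \<times> carrier (FObj (X False) x) \<lesssim> D"
      using small_Times[OF rep_space(2)[OF X x] rep_space(2)[OF X x]] by blast
    then show "\<exists>D\<in>\<U>. ?S x \<lesssim> D"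
      by (intro bexI[of _ D] lepoll_trans[OF PiE_bool_lepoll])
  next
    fix a v w assume a: "a \<in> Arr G" and v: "v \<in> ?S (Dom G a)" and w: "w \<in> ?S (Dom G a)"
    show "(\<Sum>b\<in>?J. hinner (FObj (X b) (Cod G a)) ((\<lambda>j\<in>?J. act (X j) a (v j)) b) ((\<lambda>j\<in>?J. act
        (X j) a (w j)) b)) =
        ?ip (Dom G a) v w"
      using v w by (intro sum.cong) (auto intro!: act_isometry[OF X a])
    show "(\<lambda>j\<in>?J. act (X j) a (v j)) \<in> ?S (Cod G a)"
      unfolding restrict_PiE_iff by (intro ballI act_closed X a PiE_mem[OF v])
  qed (use X in \<open>auto intro: small_lepoll\<close>)
  then obtain P p where P: "represents_family ?J X ?S ?ip P p"
    by blast
  note D = represents_familyD[OF P]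
  have p: "p b \<in> Hom \<C> P (X b)" for b
    by (rule D(2)) simp
  have ip: "hinner (FObj P x) v w =
      hinner (FObj F1 x) (cmp (p True) x v) (cmp (p True) x w) +
      hinner (FObj F2 x) (cmp (p False) x v) (cmp (p False) x w)"
    if "x \<in> Obj G" "v \<in> carrier (FObj P x)" "w \<in> carrier (FObj P x)" for x v w
    using D(4)[OF that] by (simp add: UNIV_bool X_def)
  \<comment> \<open>The adjoint of a projection is the inclusion of the corresponding summand.\<close>
  have star: "cmp (p c) x (cmp (Star \<C> (p b)) x v) = (if c = b then v else \<zero>\<^bsub>FObj (X c) x\<^esub>)"
    if x: "x \<in> Obj G" and v: "v \<in> carrier (FObj (X b) x)" for x b c v
  proof -
    interpret P: hilbert_space "FObj P x" by (rule rep_space(1)[OF D(1) x])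
    have h: "hilbert_space (FObj (X c) x)" for c
      by (rule rep_space(1)[OF X x])
    have ips: "inner_product_space (FObj (X c) x)" for c
    proof -
      interpret hilbert_space "FObj (X c) x" by (rule h)
      show ?thesis by (rule inner_product_space_axioms)
    qed
    have "(\<lambda>c. if c = b then v else \<zero>\<^bsub>FObj (X c) x\<^esub>) \<in> ?S x"
      using v by (auto simp: inner_product_space.zero_in[OF ips])
    from D(6)[OF x this] obtain e where e: "e \<in> carrier (FObj P x)"
      "\<And>c. cmp (p c) x e = (if c = b then v else \<zero>\<^bsub>FObj (X c) x\<^esub>)"
      by auto
    have "cmp (Star \<C> (p b)) x v = e"
    proof (rule P.hinner_eqI[OF cmp_closed[OF Star_Hom(1)[OF p] x v] e(1)])
      fix z assume z: "z \<in> carrier (FObj P x)"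
      have pz: "cmp (p c) x z \<in> carrier (FObj (X c) x)" for c
        by (rule cmp_closed[OF p x z])
      have "hinner (FObj P x) e z = hinner (FObj (X b) x) v (cmp (p b) x z)"
        using ip[OF x e(1) z] pz[of True] pz[of False]
          inner_product_space.hinner_zero_left[OF ips[of True]]
              inner_product_space.hinner_zero_left[OF ips[of False]]
        by (cases b) (simp_all add: e(2) X_def)
      then show "hinner (FObj P x) (cmp (Star \<C> (p b)) x v) z = hinner (FObj P x) e z"
        using Star_Hom'[OF p x z v] by simp
    qed
    then show ?thesis
      by (simp add: e(2))
  qed
  have XTF: "X True = F1" "X False = F2"
    by (simp_all add: X_def)
  have "binary_product \<C> F1 F2 P (p True) (p False)"
    unfolding binary_product_def
  proof (intro conjI allI impI)
    show "p True \<in> Hom \<C> P F1" "p False \<in> Hom \<C> P F2"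
      using p[of True] p[of False] by (simp_all add: X_def)
    fix Y f1 f2 assume f1: "f1 \<in> Hom \<C> Y F1" and f2: "f2 \<in> Hom \<C> Y F2"
    let ?g = "\<lambda>b. if b then f1 else f2"
    have g: "?g b \<in> Hom \<C> Y (X b)" for b
      using f1 f2 by (simp add: X_def)
    have "\<exists>!u. u \<in> Hom \<C> Y P \<and> (\<forall>j\<in>?J. p j \<circ>\<^bsub>\<C>\<^esub> u = ?g j)"
    proof (rule ex1_mediating[OF P HomD(1)[OF f1] g])
      show "(\<lambda>j\<in>?J. cmp (?g j) x y) \<in> ?S x" if "x \<in> Obj G" "y \<in> carrier (FObj Y x)" for x y
        using cmp_closed[OF g that] by simp
      show "\<exists>B. \<forall>y\<in>carrier (FObj Y x). Re (?ip x (\<lambda>j\<in>?J. cmp (?g j) x y) (\<lambda>j\<in>?J. cmp (?g j) x y))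
          \<le> B * (hnorm (FObj Y x) y)\<^sup>2" if x: "x \<in> Obj G" for x
      proof -
        interpret F1: hilbert_space "FObj F1 x" by (rule rep_space(1)[OF F1 x])
        interpret F2: hilbert_space "FObj F2 x" by (rule rep_space(1)[OF F2 x])
        note Yx = rep_space(1)[OF HomD(1)[OF f1] x]
        obtain B1 where B1: "\<And>y. y \<in> carrier (FObj Y x) \<Longrightarrow>
            (hnorm (FObj F1 x) (cmp f1 x y))\<^sup>2 \<le> B1 * (hnorm (FObj Y x) y)\<^sup>2"
          using blin_sq_bound[OF Yx F1.hilbert_space_axioms cmp_blin[OF f1 x]] by metis
        obtain B2 where B2: "\<And>y. y \<in> carrier (FObj Y x) \<Longrightarrow>
            (hnorm (FObj F2 x) (cmp f2 x y))\<^sup>2 \<le> B2 * (hnorm (FObj Y x) y)\<^sup>2"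
          using blin_sq_bound[OF Yx F2.hilbert_space_axioms cmp_blin[OF f2 x]] by metis
        have "Re (?ip x (\<lambda>j\<in>?J. cmp (?g j) x y) (\<lambda>j\<in>?J. cmp (?g j) x y)) \<le> (B1 + B2) * (hnorm
            (FObj Y x) y)\<^sup>2"
          if y: "y \<in> carrier (FObj Y x)" for y
          using B1[OF y] B2[OF y] F1.hnorm_sq[OF cmp_closed[OF f1 x y]] F2.hnorm_sq[OF
              cmp_closed[OF f2 x y]]
          by (simp add: UNIV_bool X_def distrib_right)
        then show ?thesis
          by blast
      qed
    qed
    then show "\<exists>!h. h \<in> Hom \<C> Y P \<and> p True \<circ>\<^bsub>\<C>\<^esub> h = f1 \<and> p False \<circ>\<^bsub>\<C>\<^esub> h = f2"
      by (simp add: UNIV_bool conj_commute)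
  qed
  moreover have "coisometry_arr \<C> (p b)" for b
  proof -
    note c = Comp_Hom[OF Star_Hom(1)[OF p[of b]] p[of b]]
    have "p b \<circ>\<^bsub>\<C>\<^esub> Star \<C> (p b) = Ident \<C> (X b)"
      by (rule arr_eqI[OF c(1) Ident_Hom(1)[OF X]]) (simp add: c(2) Ident_Hom(2)[OF X] star)
    then show ?thesis
      using Hom_Arr[OF p[of b]] by (simp add: coisometry_arr_def)
  qed
  moreover have "zero_arr \<C> (p True \<circ>\<^bsub>\<C>\<^esub> Star \<C> (p False))"
    unfolding zero_arr_iff[OF Comp_Hom(1)[OF Star_Hom(1)[OF p] p]]
    by (simp add: Comp_Hom(2)[OF Star_Hom(1)[OF p] p] star)
  ultimately show ?thesis
    unfolding orthonormal_product_def by blast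
qed

end


context small_unitary_reps
begin

section \<open>Isometric kernels\<close>

lemma PiE_unit_lepoll: "(\<Pi>\<^sub>E j\<in>(UNIV :: unit set). A j) \<lesssim> A ()"
  unfolding lepoll_def
  by (rule exI[of _ "\<lambda>v. v ()"]) (auto simp: inj_on_def fun_eq_iff)

text \<open>The pointwise kernel is a closed invariant subspace; its vectors are treated as families
    with one component.\<close>

lemma ex_isometric_kernel_URep:
  assumes fA: "f \<in> Arr \<C>"
  shows "\<exists>k. is_kernel \<C> f k \<and> isometry_arr \<C> k"
proof -
  define F F' where "F = Dom \<C> f" and "F' = Cod \<C> f"
  have f: "f \<in> Hom \<C> F F'"
    using Arr_Hom[OF fA] by (simp add: F_def F'_def)
  note F = HomD(1)[OF f] and F' = HomD(2)[OF f]
  let ?J = "UNIV :: unit set"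
  let ?PiE = "\<lambda>x. \<Pi>\<^sub>E j\<in>?J. carrier (FObj F x)"
  let ?S = "\<lambda>x. {v \<in> ?PiE x. cmp f x (v ()) = \<zero>\<^bsub>FObj F' x\<^esub>}"
  let ?ip = "\<lambda>x v w. \<Sum>j\<in>?J. hinner (FObj F x) (v j) (w j)"
  have "\<exists>L p. represents_family ?J (\<lambda>_. F) ?S ?ip L p"
  proof (rule ex_represents_family)
    fix x assume x: "x \<in> Obj G"
    interpret F: hilbert_space "FObj F x" by (rule rep_space(1)[OF F x])
    interpret F': hilbert_space "FObj F' x" by (rule rep_space(1)[OF F' x])
    note fx = cmp_blin[OF f x]
    have smult0: "c \<odot>\<^bsub>FObj F' x\<^esub> \<zero>\<^bsub>FObj F' x\<^esub> = \<zero>\<^bsub>FObj F' x\<^esub>" for c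
      by (intro F'.hinner_eqI) auto
    show "hilbert_family ?J (\<lambda>_. FObj F x) (?S x) (?ip x)"
    proof (rule hilbert_family_finite)
      fix \<sigma> :: "nat \<Rightarrow> unit \<Rightarrow> 'v" and l
      assume \<sigma>: "\<And>n. \<sigma> n \<in> ?S x" and l: "l \<in> ?PiE x"
        and lim: "\<And>j. j \<in> ?J \<Longrightarrow> (\<lambda>n. hnorm (FObj F x) (\<sigma> n j \<ominus>\<^bsub>FObj F x\<^esub> l j)) \<longlonglongrightarrow> 0"
      have \<sigma>c: "\<sigma> n () \<in> carrier (FObj F x)" "cmp f x (\<sigma> n ()) = \<zero>\<^bsub>FObj F' x\<^esub>" for n
        using \<sigma>[of n] by auto
      have lc: "l () \<in> carrier (FObj F x)"
        using l by auto
      have flc: "cmp f x (l ()) \<in> carrier (FObj F' x)"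
        by (rule cmp_closed[OF f x lc])
      obtain B where B: "B > 0" "\<And>v. v \<in> carrier (FObj F x) \<Longrightarrow>
          hnorm (FObj F' x) (cmp f x v) \<le> B * hnorm (FObj F x) v"
        using blin_bound[OF F.hilbert_space_axioms F'.hilbert_space_axioms fx] by metis
      have "hnorm (FObj F' x) (cmp f x (l ())) \<le> B * hnorm (FObj F x) (\<sigma> n () \<ominus>\<^bsub>FObj F x\<^esub> l ())"
          for n
      proof -
        have "cmp f x (\<sigma> n () \<ominus>\<^bsub>FObj F x\<^esub> l ()) = \<zero>\<^bsub>FObj F' x\<^esub> \<ominus>\<^bsub>FObj F' x\<^esub> cmp f x (l ())"
          using blin_minus_vec[OF F.hilbert_space_axioms F'.hilbert_space_axioms fx \<sigma>c(1) lc]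
              \<sigma>c(2) by simp
        moreover have "hnorm (FObj F' x) (\<zero>\<^bsub>FObj F' x\<^esub> \<ominus>\<^bsub>FObj F' x\<^esub> cmp f x (l ())) = hnorm
            (FObj F' x) (cmp f x (l ()))"
          using flc by (simp add: hnorm_def)
        ultimately show ?thesis
          using B(2)[OF F.minus_closed[OF \<sigma>c(1) lc], of n] by simp
      qed
      moreover have "(\<lambda>n. B * hnorm (FObj F x) (\<sigma> n () \<ominus>\<^bsub>FObj F x\<^esub> l ())) \<longlonglongrightarrow> 0"
        by (intro tendsto_mult_right_zero lim) simp
      ultimately have "hnorm (FObj F' x) (cmp f x (l ())) \<le> 0"
        by (intro LIMSEQ_le_const[of "\<lambda>n. B * hnorm (FObj F x) (\<sigma> n () \<ominus>\<^bsub>FObj F x\<^esub> l ())"]) auto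
      then have "cmp f x (l ()) = \<zero>\<^bsub>FObj F' x\<^esub>"
        using F'.hnorm_eq_0[OF flc] F'.hnorm_nonneg[OF flc] by simp
      then show "l \<in> ?S x"
        using l by simp
    qed (auto simp: fam_zero_def fam_add_def fam_smult_def F.hilbert_space_axioms cmp_zero[OF f x]
        blin_add_vec[OF fx] blin_smult_vec[OF fx] smult0 PiE_iff)
    have "?S x \<lesssim> carrier (FObj F x)"
      by (rule lepoll_trans[OF subset_imp_lepoll PiE_unit_lepoll]) auto
    then show "\<exists>D\<in>\<U>. ?S x \<lesssim> D"
      using rep_space(2)[OF F x] by blast
  next
    fix a v assume a: "a \<in> Arr G" and v: "v \<in> ?S (Dom G a)"
    note xy = Dom_closed[OF a] Cod_closed[OF a]
    have vc: "v () \<in> carrier (FObj F (Dom G a))" and v0: "cmp f (Dom G a) (v ()) = \<zero>\<^bsub>FObj F'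
        (Dom G a)\<^esub>"
      using v by auto
    have "cmp f (Cod G a) (act F a (v ())) = \<zero>\<^bsub>FObj F' (Cod G a)\<^esub>"
      unfolding cmp_natural[OF f a vc] v0
      by (rule blin_zero_vec[OF rep_space(1)[OF F' xy(1)] rep_space(1)[OF F' xy(2)] rep_arr(3)[OF
          F' a]])
    then show "(\<lambda>j\<in>?J. act F a (v j)) \<in> ?S (Cod G a)"
      using act_closed[OF F a vc] by auto
    fix w assume w: "w \<in> ?S (Dom G a)"
    then have wc: "w () \<in> carrier (FObj F (Dom G a))"
      by auto
    show "?ip (Cod G a) (\<lambda>j\<in>?J. act F a (v j)) (\<lambda>j\<in>?J. act F a (w j)) = ?ip (Dom G a) v w"
      using act_isometry[OF F a vc wc] by (simp add: UNIV_unit)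
  qed (use F in \<open>auto intro: small_lepoll\<close>)
  then obtain K p where K: "represents_family ?J (\<lambda>_. F) ?S ?ip K p"
    by blast
  note D = represents_familyD[OF K]
  define k where "k = p ()"
  have k: "k \<in> Hom \<C> K F"
    unfolding k_def by (rule D(2)) simp
  have fk: "f \<circ>\<^bsub>\<C>\<^esub> k \<in> Hom \<C> K F'"
    by (rule Comp_Hom(1)[OF k f])
  have "cmp (f \<circ>\<^bsub>\<C>\<^esub> k) x v = \<zero>\<^bsub>FObj F' x\<^esub>" if "x \<in> Obj G" "v \<in> carrier (FObj K x)" for x v
    unfolding Comp_Hom(2)[OF k f that] using D(3)[OF that] by (simp add: k_def)
  then have zero: "zero_arr \<C> (f \<circ>\<^bsub>\<C>\<^esub> k)"
    by (simp add: zero_arr_iff[OF fk])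
  have "isometry_arr \<C> k"
  proof -
    note c = Comp_Hom[OF k Star_Hom(1)[OF k]]
    have "Star \<C> k \<circ>\<^bsub>\<C>\<^esub> k = Ident \<C> K"
    proof (rule arr_eqI[OF c(1) Ident_Hom(1)[OF D(1)]])
      fix x v assume x: "x \<in> Obj G" and v: "v \<in> carrier (FObj K x)"
      interpret K: hilbert_space "FObj K x" by (rule rep_space(1)[OF D(1) x])
      show "cmp (Star \<C> k \<circ>\<^bsub>\<C>\<^esub> k) x v = cmp (Ident \<C> K) x v"
        unfolding c(2)[OF x v] Ident_Hom(2)[OF D(1) x v]
      proof (rule K.hinner_eqI[OF cmp_closed[OF Star_Hom(1)[OF k] x cmp_closed[OF k x v]] v])
        fix z assume z: "z \<in> carrier (FObj K x)"
        show "hinner (FObj K x) (cmp (Star \<C> k) x (cmp k x v)) z = hinner (FObj K x) v z"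
          using Star_Hom'[OF k x z cmp_closed[OF k x v]] D(4)[OF x v z]
          by (simp add: k_def UNIV_unit)
      qed
    qed
    then show ?thesis
      using Hom_Arr[OF k] by (simp add: isometry_arr_def)
  qed
  moreover have "is_kernel \<C> f k"
    unfolding is_kernel_def
  proof (intro conjI allI impI fA zero)
    show "k \<in> Arr \<C>" "Cod \<C> k = Dom \<C> f"
      using Hom_Arr[OF k] by (auto simp: F_def)
    fix Y g assume "g \<in> Hom \<C> Y (Dom \<C> f)" and gz: "zero_arr \<C> (f \<circ>\<^bsub>\<C>\<^esub> g)"
    then have g: "g \<in> Hom \<C> Y F"
      by (simp add: F_def)
    have g0: "cmp f x (cmp g x y) = \<zero>\<^bsub>FObj F' x\<^esub>" if "x \<in> Obj G" "y \<in> carrier (FObj Y x)" for x y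
      using gz that unfolding zero_arr_iff[OF Comp_Hom(1)[OF g f]]
      by (simp add: Comp_Hom(2)[OF g f])
    have "\<exists>!u. u \<in> Hom \<C> Y K \<and> (\<forall>j\<in>?J. p j \<circ>\<^bsub>\<C>\<^esub> u = g)"
    proof (rule ex1_mediating[OF K HomD(1)[OF g] g])
      show "(\<lambda>j\<in>?J. cmp g x y) \<in> ?S x" if "x \<in> Obj G" "y \<in> carrier (FObj Y x)" for x y
        using cmp_closed[OF g that] g0[OF that] by simp
      show "\<exists>B. \<forall>y\<in>carrier (FObj Y x). Re (?ip x (\<lambda>j\<in>?J. cmp g x y) (\<lambda>j\<in>?J. cmp g x y))
          \<le> B * (hnorm (FObj Y x) y)\<^sup>2" if x: "x \<in> Obj G" for x
      proof -
        interpret F: hilbert_space "FObj F x" by (rule rep_space(1)[OF F x])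
        obtain B where "\<And>y. y \<in> carrier (FObj Y x) \<Longrightarrow>
            (hnorm (FObj F x) (cmp g x y))\<^sup>2 \<le> B * (hnorm (FObj Y x) y)\<^sup>2"
          using blin_sq_bound[OF rep_space(1)[OF HomD(1)[OF g] x] F.hilbert_space_axioms
              cmp_blin[OF g x]] by metis
        then show ?thesis
          using F.hnorm_sq[OF cmp_closed[OF g x]] by (intro exI[of _ B]) (simp add: UNIV_unit)
      qed
    qed
    then show "\<exists>!h. h \<in> Hom \<C> Y (Dom \<C> k) \<and> k \<circ>\<^bsub>\<C>\<^esub> h = g"
      using Hom_Arr[OF k] by (simp add: UNIV_unit k_def)
  qed
  ultimately show ?thesis
    by blast
qed

section \<open>Diagonals as kernels\<close>

lemma binary_product_eqI:
  assumes P: "binary_product \<C> F1 F2 P r1 r2" and g: "g \<in> Hom \<C> Y P" and h: "h \<in> Hom \<C> Y P"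
    and "r1 \<circ>\<^bsub>\<C>\<^esub> g = r1 \<circ>\<^bsub>\<C>\<^esub> h" "r2 \<circ>\<^bsub>\<C>\<^esub> g = r2 \<circ>\<^bsub>\<C>\<^esub> h"
  shows "g = h"
proof -
  have r: "r1 \<in> Hom \<C> P F1" "r2 \<in> Hom \<C> P F2"
    using P by (auto simp: binary_product_def)
  have "\<exists>!u. u \<in> Hom \<C> Y P \<and> r1 \<circ>\<^bsub>\<C>\<^esub> u = r1 \<circ>\<^bsub>\<C>\<^esub> h \<and> r2 \<circ>\<^bsub>\<C>\<^esub> u = r2 \<circ>\<^bsub>\<C>\<^esub> h"
    by (rule P[unfolded binary_product_def, THEN conjunct2, THEN conjunct2, rule_format,
          OF Comp_Hom(1)[OF h r(1)] Comp_Hom(1)[OF h r(2)]])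
  then show ?thesis
    using assms by blast
qed

text \<open>The diagonal is a kernel of \<open>r1 - r2\<close>.\<close>

lemma diagonal_kernel_URep:
  assumes P: "binary_product \<C> F F P r1 r2" and d: "d \<in> Hom \<C> F P"
    and r1d: "r1 \<circ>\<^bsub>\<C>\<^esub> d = Ident \<C> F" and r2d: "r2 \<circ>\<^bsub>\<C>\<^esub> d = Ident \<C> F"
  shows "\<exists>f. is_kernel \<C> f d"
proof -
  have r: "r1 \<in> Hom \<C> P F" "r2 \<in> Hom \<C> P F"
    using P by (auto simp: binary_product_def)
  note F = HomD(1)[OF d]
  let ?f = "comb_arr r1 (-1) r2"
  note f = comb_arr_Hom[OF r, where a = "-1"]
  have zero_iff: "zero_arr \<C> (?f \<circ>\<^bsub>\<C>\<^esub> g) \<longleftrightarrow> r1 \<circ>\<^bsub>\<C>\<^esub> g = r2 \<circ>\<^bsub>\<C>\<^esub> g" if g: "g \<in> Hom \<C> Y P" for g Y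
  proof -
    have iff: "cmp (?f \<circ>\<^bsub>\<C>\<^esub> g) x y = \<zero>\<^bsub>FObj F x\<^esub> \<longleftrightarrow> cmp (r1 \<circ>\<^bsub>\<C>\<^esub> g) x y = cmp (r2 \<circ>\<^bsub>\<C>\<^esub> g) x y"
      if x: "x \<in> Obj G" and y: "y \<in> carrier (FObj Y x)" for x y
    proof -
      interpret F: hilbert_space "FObj F x" by (rule rep_space(1)[OF F x])
      note gy = cmp_closed[OF g x y]
      show ?thesis
        unfolding Comp_Hom(2)[OF g f(1) x y] f(2)[OF x gy] Comp_Hom(2)[OF g r(1) x y]
            Comp_Hom(2)[OF g r(2) x y]
        using F.hminus_eq_zero_iff F.minus_conv_smult cmp_closed[OF r(1) x gy] cmp_closed[OF r(2)
            x gy] by simp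
    qed
    show ?thesis
      unfolding zero_arr_iff[OF Comp_Hom(1)[OF g f(1)]]
    proof
      assume "r1 \<circ>\<^bsub>\<C>\<^esub> g = r2 \<circ>\<^bsub>\<C>\<^esub> g"
      then show "\<forall>x\<in>Obj G. \<forall>v\<in>carrier (FObj Y x). cmp (?f \<circ>\<^bsub>\<C>\<^esub> g) x v = \<zero>\<^bsub>FObj F x\<^esub>"
        by (simp add: iff)
    next
      assume "\<forall>x\<in>Obj G. \<forall>v\<in>carrier (FObj Y x). cmp (?f \<circ>\<^bsub>\<C>\<^esub> g) x v = \<zero>\<^bsub>FObj F x\<^esub>"
      then show "r1 \<circ>\<^bsub>\<C>\<^esub> g = r2 \<circ>\<^bsub>\<C>\<^esub> g"
        by (intro arr_eqI[OF Comp_Hom(1)[OF g r(1)] Comp_Hom(1)[OF g r(2)]]) (simp add: iff)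
    qed
  qed
  have "is_kernel \<C> ?f d"
    unfolding is_kernel_def
  proof (intro conjI allI impI)
    show "?f \<in> Arr \<C>" "d \<in> Arr \<C>" "Cod \<C> d = Dom \<C> ?f"
      using Hom_Arr[OF f(1)] Hom_Arr[OF d] by auto
    show "zero_arr \<C> (?f \<circ>\<^bsub>\<C>\<^esub> d)"
      using zero_iff[OF d] r1d r2d by simp
    fix Y g assume "g \<in> Hom \<C> Y (Dom \<C> ?f)" and z: "zero_arr \<C> (?f \<circ>\<^bsub>\<C>\<^esub> g)"
    then have g: "g \<in> Hom \<C> Y P"
      using Hom_Arr[OF f(1)] by simp
    have eq: "r1 \<circ>\<^bsub>\<C>\<^esub> g = r2 \<circ>\<^bsub>\<C>\<^esub> g"
      using z zero_iff[OF g] by simp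
    have dc: "Dom \<C> d = F"
      using Hom_Arr[OF d] by simp
    have rd: "ri \<circ>\<^bsub>\<C>\<^esub> (d \<circ>\<^bsub>\<C>\<^esub> h) = h" if "ri \<in> Hom \<C> P F" "ri \<circ>\<^bsub>\<C>\<^esub> d = Ident \<C> F" "h \<in> Hom \<C> Y F"
        for ri h
      using URep.Comp_assoc[OF that(3) d that(1)] that URep.Ident_left[OF that(3)] by simp
    show "\<exists>!h. h \<in> Hom \<C> Y (Dom \<C> d) \<and> d \<circ>\<^bsub>\<C>\<^esub> h = g"
      unfolding dc
    proof (intro ex1I conjI)
      show h: "r1 \<circ>\<^bsub>\<C>\<^esub> g \<in> Hom \<C> Y F"
        by (rule Comp_Hom(1)[OF g r(1)])
      show "d \<circ>\<^bsub>\<C>\<^esub> (r1 \<circ>\<^bsub>\<C>\<^esub> g) = g"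
        by (rule binary_product_eqI[OF P Comp_Hom(1)[OF h d] g rd[OF r(1) r1d h]
              trans[OF rd[OF r(2) r2d h] eq]])
      fix h assume h: "h \<in> Hom \<C> Y F \<and> d \<circ>\<^bsub>\<C>\<^esub> h = g"
      then show "h = r1 \<circ>\<^bsub>\<C>\<^esub> g"
        using rd[OF r(1) r1d, of h] by auto
    qed
  qed
  then show ?thesis
    by blast
qed

lemma pre_hilbert_URep: "pre_hilbert_star_category \<C>"
proof
  show "\<exists>Z. zero_object \<C> Z"
    by (rule ex_zero_object_URep)
  show "\<exists>P r1 r2. orthonormal_product \<C> X1 X2 P r1 r2" if "X1 \<in> Obj \<C>" "X2 \<in> Obj \<C>" for X1 X2
    by (rule ex_orthonormal_product_URep[OF that])
  show "\<exists>k. is_kernel \<C> f k \<and> isometry_arr \<C> k" if "f \<in> Arr \<C>" for f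
    by (rule ex_isometric_kernel_URep[OF that])
  show "\<exists>f. is_kernel \<C> f d" if "orthonormal_product \<C> X X P r1 r2" "d \<in> Hom \<C> X P"
    "r1 \<circ>\<^bsub>\<C>\<^esub> d = Ident \<C> X" "r2 \<circ>\<^bsub>\<C>\<^esub> d = Ident \<C> X" for X P r1 r2 d
    using that by (intro diagonal_kernel_URep[of X P r1 r2 d])
        (simp_all add: orthonormal_product_def)
qed

section \<open>The canonical addition\<close>

text \<open>
  The canonical addition is pointwise: for any orthonormal product \<open>P\<close> the identity of \<open>P\<close> is
  \<open>r1\<^sup>* r1 + r2\<^sup>* r2\<close>, and inserting this into \<open>n h\<close> gives \<open>f + g\<close> whatever the choices were.
\<close>

lemma arr_add_eq:
  assumes f: "f \<in> Hom \<C> A B" and g: "g \<in> Hom \<C> A B"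
  shows "arr_add \<C> f g = comb_arr f 1 g"
  unfolding arr_add_def
proof (rule the_equality)
  note B = HomD(2)[OF f]
  note s = comb_arr_Hom[OF f g, where a = 1]
  have DC: "Dom \<C> f = A" "Cod \<C> f = B"
    using Hom_Arr[OF f] by auto
  have bin: "binary_product \<C> B B P r1 r2" and r: "r1 \<in> Hom \<C> P B" "r2 \<in> Hom \<C> P B"
    and r11: "\<And>x v. x \<in> Obj G \<Longrightarrow> v \<in> carrier (FObj B x) \<Longrightarrow> cmp r1 x (cmp (Star \<C> r1) x v) = v"
    and r22: "\<And>x v. x \<in> Obj G \<Longrightarrow> v \<in> carrier (FObj B x) \<Longrightarrow> cmp r2 x (cmp (Star \<C> r2) x v) = v"
    and r12: "\<And>x v. x \<in> Obj G \<Longrightarrow> v \<in> carrier (FObj B x) \<Longrightarrow>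
        cmp r1 x (cmp (Star \<C> r2) x v) = \<zero>\<^bsub>FObj B x\<^esub>"
    and r21: "\<And>x v. x \<in> Obj G \<Longrightarrow> v \<in> carrier (FObj B x) \<Longrightarrow>
        cmp r2 x (cmp (Star \<C> r1) x v) = \<zero>\<^bsub>FObj B x\<^esub>"
    if P: "orthonormal_product \<C> B B P r1 r2" for P r1 r2
  proof -
    show bin: "binary_product \<C> B B P r1 r2"
      using P by (simp add: orthonormal_product_def)
    then show r1: "r1 \<in> Hom \<C> P B" and r2: "r2 \<in> Hom \<C> P B"
      by (auto simp: binary_product_def)
    have 1: "r1 \<circ>\<^bsub>\<C>\<^esub> Star \<C> r1 = Ident \<C> B" and 2: "r2 \<circ>\<^bsub>\<C>\<^esub> Star \<C> r2 = Ident \<C> B"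
      and 3: "zero_arr \<C> (r1 \<circ>\<^bsub>\<C>\<^esub> Star \<C> r2)"
      using P Hom_Arr[OF r1] Hom_Arr[OF r2]
      by (auto simp: orthonormal_product_def coisometry_arr_def)
    note S1 = Star_Hom(1)[OF r1] and S2 = Star_Hom(1)[OF r2]
    fix x v assume x: "x \<in> Obj G" and v: "v \<in> carrier (FObj B x)"
    interpret B: hilbert_space "FObj B x" by (rule rep_space(1)[OF B x])
    show "cmp r1 x (cmp (Star \<C> r1) x v) = v"
      using Comp_Hom(2)[OF S1 r1 x v] Ident_Hom(2)[OF B x v] 1 by simp
    show "cmp r2 x (cmp (Star \<C> r2) x v) = v"
      using Comp_Hom(2)[OF S2 r2 x v] Ident_Hom(2)[OF B x v] 2 by simp
    have r12: "cmp r1 x (cmp (Star \<C> r2) x v) = \<zero>\<^bsub>FObj B x\<^esub>" if v: "v \<in> carrier (FObj B x)" for v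
      using 3 x v unfolding zero_arr_iff[OF Comp_Hom(1)[OF S2 r1]]
      by (simp add: Comp_Hom(2)[OF S2 r1])
    show "cmp r1 x (cmp (Star \<C> r2) x v) = \<zero>\<^bsub>FObj B x\<^esub>"
      by (rule r12[OF v])
    show "cmp r2 x (cmp (Star \<C> r1) x v) = \<zero>\<^bsub>FObj B x\<^esub>"
    proof (rule B.hinner_eqI[OF cmp_closed[OF r2 x cmp_closed[OF S1 x v]] B.zero_in])
      fix z assume z: "z \<in> carrier (FObj B x)"
      show "hinner (FObj B x) (cmp r2 x (cmp (Star \<C> r1) x v)) z = hinner (FObj B x) \<zero>\<^bsub>FObj B x\<^esub> z"
        using Star_Hom(2)[OF r2 x cmp_closed[OF S1 x v] z] Star_Hom'[OF r1 x cmp_closed[OF S2 x z]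
            v]
          r12[OF z] v z by simp
    qed
  qed
  {
    obtain P r1 r2 where P: "orthonormal_product \<C> B B P r1 r2"
      using ex_orthonormal_product_URep[OF B B] by blast
    note R = bin[OF P] r[OF P] r11[OF P] r22[OF P] r12[OF P] r21[OF P]
    note S = Star_Hom(1)[OF R(2)] Star_Hom(1)[OF R(3)]
    obtain h where h: "h \<in> Hom \<C> A P" "r1 \<circ>\<^bsub>\<C>\<^esub> h = f" "r2 \<circ>\<^bsub>\<C>\<^esub> h = g"
      using R(1) f g unfolding binary_product_def by blast
    let ?n = "comb_arr r1 1 r2"
    note n = comb_arr_Hom[OF R(2,3), where a = 1]
    have n1: "?n \<circ>\<^bsub>\<C>\<^esub> Star \<C> r1 = Ident \<C> B"
    proof (rule arr_eqI[OF Comp_Hom(1)[OF S(1) n(1)] Ident_Hom(1)[OF B]])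
      fix x v assume x: "x \<in> Obj G" and v: "v \<in> carrier (FObj B x)"
      interpret B: hilbert_space "FObj B x" by (rule rep_space(1)[OF B x])
      show "cmp (?n \<circ>\<^bsub>\<C>\<^esub> Star \<C> r1) x v = cmp (Ident \<C> B) x v"
        unfolding Comp_Hom(2)[OF S(1) n(1) x v] n(2)[OF x cmp_closed[OF S(1) x v]] R(4)[OF x v]
            R(7)[OF x v]
          Ident_Hom(2)[OF B x v]
        using v by simp
    qed
    have n2: "?n \<circ>\<^bsub>\<C>\<^esub> Star \<C> r2 = Ident \<C> B"
    proof (rule arr_eqI[OF Comp_Hom(1)[OF S(2) n(1)] Ident_Hom(1)[OF B]])
      fix x v assume x: "x \<in> Obj G" and v: "v \<in> carrier (FObj B x)"
      interpret B: hilbert_space "FObj B x" by (rule rep_space(1)[OF B x])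
      show "cmp (?n \<circ>\<^bsub>\<C>\<^esub> Star \<C> r2) x v = cmp (Ident \<C> B) x v"
        unfolding Comp_Hom(2)[OF S(2) n(1) x v] n(2)[OF x cmp_closed[OF S(2) x v]] R(5)[OF x v]
            R(6)[OF x v]
          Ident_Hom(2)[OF B x v]
        using v by simp
    qed
    have "comb_arr f 1 g = ?n \<circ>\<^bsub>\<C>\<^esub> h"
    proof (rule arr_eqI[OF s(1) Comp_Hom(1)[OF h(1) n(1)]])
      fix x v assume x: "x \<in> Obj G" and v: "v \<in> carrier (FObj A x)"
      have "cmp f x v = cmp r1 x (cmp h x v)" "cmp g x v = cmp r2 x (cmp h x v)"
        using Comp_Hom(2)[OF h(1) R(2) x v] Comp_Hom(2)[OF h(1) R(3) x v] h(2,3) by auto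
      then show "cmp (comb_arr f 1 g) x v = cmp (?n \<circ>\<^bsub>\<C>\<^esub> h) x v"
        unfolding Comp_Hom(2)[OF h(1) n(1) x v] n(2)[OF x cmp_closed[OF h(1) x v]] s(2)[OF x v]
        by simp
    qed
    then show "\<exists>P r1 r2 h n. orthonormal_product \<C> (Cod \<C> f) (Cod \<C> f) P r1 r2 \<and>
       h \<in> Hom \<C> (Dom \<C> f) P \<and> r1 \<circ>\<^bsub>\<C>\<^esub> h = f \<and> r2 \<circ>\<^bsub>\<C>\<^esub> h = g \<and>
       n \<in> Hom \<C> P (Cod \<C> f) \<and> n \<circ>\<^bsub>\<C>\<^esub> Star \<C> r1 = Ident \<C> (Cod \<C> f) \<and>
       n \<circ>\<^bsub>\<C>\<^esub> Star \<C> r2 = Ident \<C> (Cod \<C> f) \<and> comb_arr f 1 g = n \<circ>\<^bsub>\<C>\<^esub> h"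
      unfolding DC
      by (intro exI[of _ P] exI[of _ r1] exI[of _ r2] exI[of _ h] exI[of _ ?n] conjI P h n(1) n1 n2)
  }
  fix t assume "\<exists>P r1 r2 h n. orthonormal_product \<C> (Cod \<C> f) (Cod \<C> f) P r1 r2 \<and>
       h \<in> Hom \<C> (Dom \<C> f) P \<and> r1 \<circ>\<^bsub>\<C>\<^esub> h = f \<and> r2 \<circ>\<^bsub>\<C>\<^esub> h = g \<and>
       n \<in> Hom \<C> P (Cod \<C> f) \<and> n \<circ>\<^bsub>\<C>\<^esub> Star \<C> r1 = Ident \<C> (Cod \<C> f) \<and>
       n \<circ>\<^bsub>\<C>\<^esub> Star \<C> r2 = Ident \<C> (Cod \<C> f) \<and> t = n \<circ>\<^bsub>\<C>\<^esub> h"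
  then obtain P r1 r2 h n where P: "orthonormal_product \<C> B B P r1 r2"
    and h: "h \<in> Hom \<C> A P" "r1 \<circ>\<^bsub>\<C>\<^esub> h = f" "r2 \<circ>\<^bsub>\<C>\<^esub> h = g"
    and n: "n \<in> Hom \<C> P B" and n1: "n \<circ>\<^bsub>\<C>\<^esub> Star \<C> r1 = Ident \<C> B" and n2: "n \<circ>\<^bsub>\<C>\<^esub> Star \<C> r2
        = Ident \<C> B"
    and t: "t = n \<circ>\<^bsub>\<C>\<^esub> h"
    unfolding DC by blast
  note R = bin[OF P] r[OF P] r11[OF P] r22[OF P] r12[OF P] r21[OF P]
  note S = Star_Hom(1)[OF R(2)] Star_Hom(1)[OF R(3)]
  note PO = HomD(1)[OF R(2)]
  note q1 = Comp_Hom[OF R(2) S(1)] and q2 = Comp_Hom[OF R(3) S(2)]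
  let ?e = "comb_arr (Star \<C> r1 \<circ>\<^bsub>\<C>\<^esub> r1) 1 (Star \<C> r2 \<circ>\<^bsub>\<C>\<^esub> r2)"
  note e = comb_arr_Hom[OF q1(1) q2(1), where a = 1]
  have ev: "cmp ?e x v = cmp (Star \<C> r1) x (cmp r1 x v) \<oplus>\<^bsub>FObj P x\<^esub> cmp (Star \<C> r2) x (cmp r2 x v)"
    if x: "x \<in> Obj G" and v: "v \<in> carrier (FObj P x)" for x v
  proof -
    interpret P: hilbert_space "FObj P x" by (rule rep_space(1)[OF PO x])
    show ?thesis
      using cmp_closed[OF S(2) x cmp_closed[OF R(3) x v]]
      by (simp add: e(2)[OF x v] q1(2)[OF x v] q2(2)[OF x v])
  qed
  have rie: "ri \<circ>\<^bsub>\<C>\<^esub> ?e = ri \<circ>\<^bsub>\<C>\<^esub> Ident \<C> P" if ri: "ri \<in> {r1, r2}" for ri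
  proof -
    have riH: "ri \<in> Hom \<C> P B"
      using ri R(2,3) by auto
    show ?thesis
    proof (rule arr_eqI[OF Comp_Hom(1)[OF e(1) riH] Comp_Hom(1)[OF Ident_Hom(1)[OF PO] riH]])
      fix x v assume x: "x \<in> Obj G" and v: "v \<in> carrier (FObj P x)"
      interpret B: hilbert_space "FObj B x" by (rule rep_space(1)[OF B x])
      note c = cmp_closed[OF R(2) x v] cmp_closed[OF R(3) x v]
      show "cmp (ri \<circ>\<^bsub>\<C>\<^esub> ?e) x v = cmp (ri \<circ>\<^bsub>\<C>\<^esub> Ident \<C> P) x v"
        unfolding Comp_Hom(2)[OF e(1) riH x v] Comp_Hom(2)[OF Ident_Hom(1)[OF PO] riH x v]
            Ident_Hom(2)[OF PO x v]
          ev[OF x v] blin_add_vec[OF cmp_blin[OF riH x] cmp_closed[OF S(1) x c(1)] cmp_closed[OF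
              S(2) x c(2)]]
        using ri c R(4)[OF x c(1)] R(5)[OF x c(2)] R(6)[OF x c(2)] R(7)[OF x c(1)] by auto
    qed
  qed
  have e1: "?e = Ident \<C> P"
    by (rule binary_product_eqI[OF R(1) e(1) Ident_Hom(1)[OF PO]]) (simp_all add: rie)
  show "t = comb_arr f 1 g"
    unfolding t
  proof (rule arr_eqI[OF Comp_Hom(1)[OF h(1) n] s(1)])
    fix x v assume x: "x \<in> Obj G" and v: "v \<in> carrier (FObj A x)"
    interpret B: hilbert_space "FObj B x" by (rule rep_space(1)[OF B x])
    note hv = cmp_closed[OF h(1) x v]
    have fg: "cmp r1 x (cmp h x v) = cmp f x v" "cmp r2 x (cmp h x v) = cmp g x v"
      using Comp_Hom(2)[OF h(1) R(2) x v] Comp_Hom(2)[OF h(1) R(3) x v] h(2,3) by auto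
    note fgc = cmp_closed[OF f x v] cmp_closed[OF g x v]
    have "cmp h x v = cmp (Star \<C> r1) x (cmp f x v) \<oplus>\<^bsub>FObj P x\<^esub> cmp (Star \<C> r2) x (cmp g x v)"
      using ev[OF x hv] unfolding e1 Ident_Hom(2)[OF PO x hv] fg .
    then have "cmp n x (cmp h x v) = cmp n x (cmp (Star \<C> r1) x (cmp f x v)) \<oplus>\<^bsub>FObj B x\<^esub> cmp n x
        (cmp (Star \<C> r2) x (cmp g x v))"
      using blin_add_vec[OF cmp_blin[OF n x] cmp_closed[OF S(1) x fgc(1)] cmp_closed[OF S(2) x
          fgc(2)]] by simp
    also have "cmp n x (cmp (Star \<C> r1) x (cmp f x v)) = cmp f x v"
      using Comp_Hom(2)[OF S(1) n x fgc(1)] n1 Ident_Hom(2)[OF B x fgc(1)] by simp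
    also have "cmp n x (cmp (Star \<C> r2) x (cmp g x v)) = cmp g x v"
      using Comp_Hom(2)[OF S(2) n x fgc(2)] n2 Ident_Hom(2)[OF B x fgc(2)] by simp
    finally show "cmp (n \<circ>\<^bsub>\<C>\<^esub> h) x v = cmp (comb_arr f 1 g) x v"
      unfolding Comp_Hom(2)[OF h(1) n x v] s(2)[OF x v] using fgc by simp
  qed
qed

lemma arr_diff_eq:
  assumes f: "f \<in> Hom \<C> A B" and g: "g \<in> Hom \<C> A B"
  shows "arr_diff \<C> g f = comb_arr g (-1) f"
  unfolding arr_diff_def
proof (rule the_equality)
  have DC: "Dom \<C> f = A" "Cod \<C> f = B"
    using Hom_Arr[OF f] by auto
  note d = comb_arr_Hom[OF g f, where a = "-1"]
  note B = HomD(2)[OF f]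
  have "comb_arr f 1 (comb_arr g (-1) f) = g"
  proof (rule arr_eqI[OF comb_arr_Hom(1)[OF f d(1)] g])
    fix x v assume x: "x \<in> Obj G" and v: "v \<in> carrier (FObj A x)"
    interpret B: hilbert_space "FObj B x" by (rule rep_space(1)[OF B x])
    show "cmp (comb_arr f 1 (comb_arr g (-1) f)) x v = cmp g x v"
      unfolding comb_arr_Hom(2)[OF f d(1) x v] d(2)[OF x v]
      using cmp_closed[OF f x v] cmp_closed[OF g x v] by (intro B.hinner_eqI) auto
  qed
  then show "comb_arr g (-1) f \<in> Hom \<C> (Dom \<C> f) (Cod \<C> f) \<and> arr_add \<C> f (comb_arr g (-1) f) = g"
    unfolding DC using d(1) arr_add_eq[OF f d(1)] by simp
  fix e assume "e \<in> Hom \<C> (Dom \<C> f) (Cod \<C> f) \<and> arr_add \<C> f e = g"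
  then have e: "e \<in> Hom \<C> A B" and ge: "g = comb_arr f 1 e"
    using arr_add_eq[OF f, of e] by (auto simp: DC)
  show "e = comb_arr g (-1) f"
  proof (rule arr_eqI[OF e d(1)])
    fix x v assume x: "x \<in> Obj G" and v: "v \<in> carrier (FObj A x)"
    interpret B: hilbert_space "FObj B x" by (rule rep_space(1)[OF B x])
    have "cmp g x v = cmp f x v \<oplus>\<^bsub>FObj B x\<^esub> 1 \<odot>\<^bsub>FObj B x\<^esub> cmp e x v"
      unfolding ge by (rule comb_arr_Hom(2)[OF f e x v])
    then show "cmp e x v = cmp (comb_arr g (-1) f) x v"
      unfolding d(2)[OF x v]
      using cmp_closed[OF f x v] cmp_closed[OF e x v] by (intro B.hinner_eqI) auto
  qed
qed

end


section \<open>Bounded threads of a system of contractions\<close>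

context directed_set
begin

text \<open>The filter of tails of the directed set.\<close>

definition tails :: "'j filter" where
  "tails = (INF j\<in>J. principal {k \<in> J. leq j k})"

lemma eventually_tails: "eventually P tails \<longleftrightarrow> (\<exists>j\<in>J. \<forall>k\<in>J. leq j k \<longrightarrow> P k)"
  unfolding tails_def
proof (subst eventually_INF_base)
  show "\<exists>l\<in>J. principal {m \<in> J. leq l m} \<le> inf (principal {m \<in> J. leq j m})
      (principal {m \<in> J. leq k m})"
    if jk: "j \<in> J" "k \<in> J" for j k
  proof -
    obtain l where l: "l \<in> J" "leq j l" "leq k l"
      using directed_upper_bound[OF jk] by blast
    then show ?thesis
      using directed_trans[OF jk(1) l(1)] directed_trans[OF jk(2) l(1)] by (intro bexI[of _ l]) auto
  qed
qed (use directed_nonempty in \<open>auto simp: eventually_principal\<close>)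

lemma tails_nontrivial [simp]: "tails \<noteq> bot"
  unfolding trivial_limit_def eventually_tails using directed_refl by blast

lemma eventually_tails_in: "eventually (\<lambda>k. k \<in> J) tails"
  unfolding eventually_tails using directed_nonempty by blast

lemma eventually_tails_ge: "j \<in> J \<Longrightarrow> eventually (\<lambda>k. k \<in> J \<and> leq j k) tails"
  unfolding eventually_tails by blast

lemma tendsto_tails_mono:
  fixes h :: "'j \<Rightarrow> real"
  assumes mono: "\<And>j k. j \<in> J \<Longrightarrow> k \<in> J \<Longrightarrow> leq j k \<Longrightarrow> h j \<le> h k"
    and bound: "\<And>j. j \<in> J \<Longrightarrow> h j \<le> B"
  shows "(h \<longlongrightarrow> (SUP j\<in>J. h j)) tails"
proof (rule order_tendstoI)
  have bdd: "bdd_above (h ` J)"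
    using bound by (intro bdd_aboveI2)
  show "\<forall>\<^sub>F k in tails. a < h k" if a: "a < (SUP j\<in>J. h j)" for a
  proof -
    obtain j where j: "j \<in> J" "a < h j"
      using a less_cSUP_iff[OF directed_nonempty bdd] by blast
    show ?thesis
      using eventually_tails_ge[OF j(1)] by eventually_elim (use j mono
          in \<open>auto intro: less_le_trans\<close>)
  qed
  show "\<forall>\<^sub>F k in tails. h k < a" if a: "(SUP j\<in>J. h j) < a" for a
    using eventually_tails_in by eventually_elim (use a bdd
        in \<open>auto intro: le_less_trans[OF cSUP_upper]\<close>)
qed

end

lemma (in inner_product_space) polarization:
  assumes "x \<in> carrier H" "y \<in> carrier H"
  shows "hinner H x y = (of_real ((hnorm H (x \<oplus>\<^bsub>H\<^esub> 1 \<odot>\<^bsub>H\<^esub> y))\<^sup>2) - of_real ((hnorm H (x \<oplus>\<^bsub>H\<^esub>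
      (-1) \<odot>\<^bsub>H\<^esub> y))\<^sup>2) +
    \<i> * of_real ((hnorm H (x \<oplus>\<^bsub>H\<^esub> \<i> \<odot>\<^bsub>H\<^esub> y))\<^sup>2) - \<i> * of_real ((hnorm H (x \<oplus>\<^bsub>H\<^esub>
        (-\<i>) \<odot>\<^bsub>H\<^esub> y))\<^sup>2)) / 4"
proof -
  have n: "of_real ((hnorm H (x \<oplus>\<^bsub>H\<^esub> c \<odot>\<^bsub>H\<^esub> y))\<^sup>2) =
      hinner H x x + cnj c * hinner H x y + c * hinner H y x + c * cnj c * hinner H y y" for c
    using assms by (subst hinner_self[symmetric]) (auto simp: algebra_simps)
  show ?thesis
    unfolding n by (simp add: algebra_simps)
qed

text \<open>
  A system of contractions between Hilbert spaces indexed by a directed set. Bounded threads form a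
  Hilbert space even if the contractions are not functorial, so this is not required.
\<close>

locale contraction_system = directed_set J leq
  for J :: "'j set" and leq :: "'j \<Rightarrow> 'j \<Rightarrow> bool" +
  fixes H :: "'j \<Rightarrow> 'v hilb" and \<phi> :: "'j \<Rightarrow> 'j \<Rightarrow> 'v \<Rightarrow> 'v"
  assumes H_hilbert: "j \<in> J \<Longrightarrow> hilbert_space (H j)"
    and \<phi>_blin: "j \<in> J \<Longrightarrow> k \<in> J \<Longrightarrow> leq j k \<Longrightarrow> blin (H k) (H j) (\<phi> j k)"
    and \<phi>_le: "j \<in> J \<Longrightarrow> k \<in> J \<Longrightarrow> leq j k \<Longrightarrow> v \<in> carrier (H k) \<Longrightarrow> hnorm (H j) (\<phi> j k v) \<le> hnorm (H k) v"
begin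

text \<open>Families that are compatible with the transition maps and have bounded norms.\<close>

definition threads :: "('j \<Rightarrow> 'v) set" where
  "threads = {v \<in> (\<Pi>\<^sub>E j\<in>J. carrier (H j)).
     (\<forall>j\<in>J. \<forall>k\<in>J. leq j k \<longrightarrow> \<phi> j k (v k) = v j) \<and> (\<exists>B. \<forall>j\<in>J. hnorm (H j) (v j) \<le> B)}"

text \<open>
  The norms of the components of a thread increase, so by polarization the inner products of the
  components of two threads converge.
\<close>

definition thread_ip :: "('j \<Rightarrow> 'v) \<Rightarrow> ('j \<Rightarrow> 'v) \<Rightarrow> complex" where
  "thread_ip v w = Lim tails (\<lambda>j. hinner (H j) (v j) (w j))"

lemma H_ips: "j \<in> J \<Longrightarrow> inner_product_space (H j)"
proof -
  assume "j \<in> J"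
  then interpret hilbert_space "H j" by (rule H_hilbert)
  show ?thesis by (rule inner_product_space_axioms)
qed

lemma threadsD:
  assumes "v \<in> threads"
  shows "\<And>j. j \<in> J \<Longrightarrow> v j \<in> carrier (H j)"
    and "\<And>j k. j \<in> J \<Longrightarrow> k \<in> J \<Longrightarrow> leq j k \<Longrightarrow> \<phi> j k (v k) = v j"
    and "\<exists>B. \<forall>j\<in>J. hnorm (H j) (v j) \<le> B"
  using assms by (auto simp: threads_def)

lemma threads_combination:
  assumes v: "v \<in> threads" and w: "w \<in> threads"
  shows "fam_add J H v (fam_smult J H c w) \<in> threads"
proof -
  obtain B where B: "\<And>j. j \<in> J \<Longrightarrow> hnorm (H j) (v j) \<le> B"
    using threadsD(3)[OF v] by blast
  obtain C where C: "\<And>j. j \<in> J \<Longrightarrow> hnorm (H j) (w j) \<le> C"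
    using threadsD(3)[OF w] by blast
  have cl: "v j \<in> carrier (H j)" "c \<odot>\<^bsub>H j\<^esub> w j \<in> carrier (H j)" "w j \<in> carrier (H j)"
      if j: "j \<in> J" for j
    using threadsD(1)[OF v j] threadsD(1)[OF w j] inner_product_space.smult_in[OF H_ips[OF j]]
    by auto
  have "hnorm (H j) (v j \<oplus>\<^bsub>H j\<^esub> c \<odot>\<^bsub>H j\<^esub> w j) \<le> B + cmod c * C" if j: "j \<in> J" for j
  proof -
    interpret inner_product_space "H j" by (rule H_ips[OF j])
    have "hnorm (H j) (v j \<oplus>\<^bsub>H j\<^esub> c \<odot>\<^bsub>H j\<^esub> w j) \<le> hnorm (H j) (v j) + cmod c * hnorm (H j) (w j)"
      using hnorm_triangle[OF cl(1,2)[OF j]] cl(3)[OF j] by simp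
    also have "\<dots> \<le> B + cmod c * C"
      using B[OF j] C[OF j] by (intro add_mono mult_left_mono) auto
    finally show ?thesis .
  qed
  moreover have "\<phi> j k (v k \<oplus>\<^bsub>H k\<^esub> c \<odot>\<^bsub>H k\<^esub> w k) = v j \<oplus>\<^bsub>H j\<^esub> c \<odot>\<^bsub>H j\<^esub> w j"
    if jk: "j \<in> J" "k \<in> J" "leq j k" for j k
    using threadsD(2)[OF v jk] threadsD(2)[OF w jk] cl[OF jk(2)]
    by (simp add: blin_add_vec[OF \<phi>_blin[OF jk]] blin_smult_vec[OF \<phi>_blin[OF jk]])
  moreover have "v j \<oplus>\<^bsub>H j\<^esub> c \<odot>\<^bsub>H j\<^esub> w j \<in> carrier (H j)" if "j \<in> J" for j
    using inner_product_space.add_in[OF H_ips] cl that by blast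
  ultimately show ?thesis
    unfolding threads_def fam_add_def fam_smult_def by auto
qed

lemma zero_thread: "fam_zero J H \<in> threads"
proof -
  have "\<phi> j k \<zero>\<^bsub>H k\<^esub> = \<zero>\<^bsub>H j\<^esub>" if "j \<in> J" "k \<in> J" "leq j k" for j k
    by (rule blin_zero_vec[OF H_hilbert[OF that(2)] H_hilbert[OF that(1)] \<phi>_blin[OF that]])
  moreover have "hnorm (H j) \<zero>\<^bsub>H j\<^esub> \<le> 0" if "j \<in> J" for j
    using inner_product_space.hnorm_zero[OF H_ips[OF that]] by simp
  ultimately show ?thesis
    unfolding threads_def fam_zero_def
    using inner_product_space.zero_in[OF H_ips] by auto
qed

lemma smult_thread:
  assumes v: "v \<in> threads"
  shows "fam_smult J H c v \<in> threads"
proof -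
  have eq: "fam_smult J H c v = fam_add J H (fam_zero J H) (fam_smult J H c v)"
    unfolding fam_add_def fam_zero_def fam_smult_def
  proof (rule restrict_ext)
    fix j assume j: "j \<in> J"
    interpret inner_product_space "H j" by (rule H_ips[OF j])
    show "c \<odot>\<^bsub>H j\<^esub> v j = (\<lambda>j\<in>J. \<zero>\<^bsub>H j\<^esub>) j \<oplus>\<^bsub>H j\<^esub> (\<lambda>j\<in>J. c \<odot>\<^bsub>H j\<^esub> v j) j"
      using j threadsD(1)[OF v j] by simp
  qed
  show ?thesis
    using threads_combination[OF zero_thread v, of c] unfolding eq[symmetric] .
qed

lemma add_thread:
  assumes v: "v \<in> threads" and w: "w \<in> threads"
  shows "fam_add J H v w \<in> threads"
proof -
  have eq: "fam_add J H v w = fam_add J H v (fam_smult J H 1 w)"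
    unfolding fam_add_def fam_smult_def
  proof (rule restrict_ext)
    fix j assume j: "j \<in> J"
    interpret inner_product_space "H j" by (rule H_ips[OF j])
    show "v j \<oplus>\<^bsub>H j\<^esub> w j = v j \<oplus>\<^bsub>H j\<^esub> (\<lambda>j\<in>J. 1 \<odot>\<^bsub>H j\<^esub> w j) j"
      using j threadsD(1)[OF w j] by simp
  qed
  show ?thesis
    unfolding eq by (rule threads_combination[OF v w])
qed

lemma thread_norms_converge:
  assumes v: "v \<in> threads"
  shows "\<exists>l. ((\<lambda>j. (hnorm (H j) (v j))\<^sup>2) \<longlongrightarrow> l) tails"
proof -
  obtain B where B: "\<And>j. j \<in> J \<Longrightarrow> hnorm (H j) (v j) \<le> B"
    using threadsD(3)[OF v] by blast
  have nonneg: "0 \<le> hnorm (H j) (v j)" if "j \<in> J" for j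
    by (rule inner_product_space.hnorm_nonneg[OF H_ips[OF that] threadsD(1)[OF v that]])
  show ?thesis
  proof (rule exI, rule tendsto_tails_mono)
    show "(hnorm (H j) (v j))\<^sup>2 \<le> B\<^sup>2" if "j \<in> J" for j
      by (rule power_mono[OF B[OF that] nonneg[OF that]])
    show "(hnorm (H j) (v j))\<^sup>2 \<le> (hnorm (H k) (v k))\<^sup>2" if jk: "j \<in> J" "k \<in> J" "leq j k" for j k
      using \<phi>_le[OF jk threadsD(1)[OF v jk(2)]] threadsD(2)[OF v jk] nonneg[OF jk(1)]
      by (intro power_mono) auto
  qed
qed

lemma tendsto_thread_ip:
  assumes v: "v \<in> threads" and w: "w \<in> threads"
  shows "((\<lambda>j. hinner (H j) (v j) (w j)) \<longlongrightarrow> thread_ip v w) tails"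
proof -
  let ?n = "\<lambda>c j. (hnorm (H j) (v j \<oplus>\<^bsub>H j\<^esub> c \<odot>\<^bsub>H j\<^esub> w j))\<^sup>2"
  have "\<exists>l. (?n c \<longlongrightarrow> l) tails" for c
  proof -
    obtain l where l: "((\<lambda>j. (hnorm (H j) (fam_add J H v (fam_smult J H c w) j))\<^sup>2) \<longlongrightarrow> l) tails"
      using thread_norms_converge[OF threads_combination[OF v w]] by blast
    have "\<forall>\<^sub>F j in tails. (hnorm (H j) (fam_add J H v (fam_smult J H c w) j))\<^sup>2 = ?n c j"
      using eventually_tails_in by eventually_elim (simp add: fam_add_def fam_smult_def)
    then show ?thesis
      using l tendsto_cong by fast
  qed
  then have "\<exists>l. \<forall>c. (?n c \<longlongrightarrow> l c) tails"
    by (intro choice allI)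
  then obtain l where l: "\<And>c. (?n c \<longlongrightarrow> l c) tails"
    by blast
  let ?L = "(of_real (l 1) - of_real (l (-1)) + \<i> * of_real (l \<i>) - \<i> * of_real (l (-\<i>))) / 4"
  have "((\<lambda>j. (of_real (?n 1 j) - of_real (?n (-1) j) + \<i> * of_real (?n \<i> j) - \<i> * of_real (?n
      (-\<i>) j)) / 4) \<longlongrightarrow> ?L) tails"
    by (intro tendsto_intros l) simp
  moreover have "\<forall>\<^sub>F j in tails. (of_real (?n 1 j) - of_real (?n (-1) j) + \<i> * of_real
      (?n \<i> j) - \<i> * of_real (?n (-\<i>) j)) / 4 =
      hinner (H j) (v j) (w j)"
    using eventually_tails_in
    by eventually_elim (rule inner_product_space.polarization[symmetric], auto intro: H_ips
        threadsD(1)[OF v] threadsD(1)[OF w])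
  ultimately have lim: "((\<lambda>j. hinner (H j) (v j) (w j)) \<longlongrightarrow> ?L) tails"
    using tendsto_cong by fast
  then have "thread_ip v w = ?L"
    unfolding thread_ip_def by (intro tendsto_Lim) simp_all
  with lim show ?thesis
    by (simp only:)
qed

lemma thread_ip_eqI:
  assumes v: "v \<in> threads" and w: "w \<in> threads" and l: "(g \<longlongrightarrow> l) tails"
    and eq: "\<And>j. j \<in> J \<Longrightarrow> g j = hinner (H j) (v j) (w j)"
  shows "thread_ip v w = l"
proof -
  have "\<forall>\<^sub>F j in tails. g j = hinner (H j) (v j) (w j)"
    using eventually_tails_in by eventually_elim (rule eq)
  then have "((\<lambda>j. hinner (H j) (v j) (w j)) \<longlongrightarrow> l) tails"
    using l tendsto_cong by fast
  then show ?thesis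
    using tendsto_thread_ip[OF v w] tendsto_unique[OF tails_nontrivial] by blast
qed

lemma tendsto_thread_norm:
  assumes v: "v \<in> threads"
  shows "((\<lambda>j. (hnorm (H j) (v j))\<^sup>2) \<longlongrightarrow> Re (thread_ip v v)) tails"
proof -
  have "\<forall>\<^sub>F j in tails. Re (hinner (H j) (v j) (v j)) = (hnorm (H j) (v j))\<^sup>2"
    using eventually_tails_in
    by eventually_elim (simp add: inner_product_space.hnorm_sq[OF H_ips] threadsD(1)[OF v])
  then show ?thesis
    using tendsto_Re[OF tendsto_thread_ip[OF v v]] tendsto_cong by fast
qed

lemma thread_norm_ge:
  assumes v: "v \<in> threads" and j: "j \<in> J"
  shows "(hnorm (H j) (v j))\<^sup>2 \<le> Re (thread_ip v v)"
proof (rule tendsto_lowerbound[OF tendsto_thread_norm[OF v]])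
  show "\<forall>\<^sub>F k in tails. (hnorm (H j) (v j))\<^sup>2 \<le> (hnorm (H k) (v k))\<^sup>2"
    using eventually_tails_ge[OF j]
  proof eventually_elim
    case (elim k)
    then show ?case
      using \<phi>_le[OF j _ _ threadsD(1)[OF v, of k]] threadsD(2)[OF v j, of k]
        inner_product_space.hnorm_nonneg[OF H_ips[OF j] threadsD(1)[OF v j]]
      by (intro power_mono) auto
  qed
qed simp

lemma thread_norm_le:
  assumes v: "v \<in> threads" and "\<And>j. j \<in> J \<Longrightarrow> (hnorm (H j) (v j))\<^sup>2 \<le> B"
  shows "Re (thread_ip v v) \<le> B"
proof (rule tendsto_upperbound[OF tendsto_thread_norm[OF v]])
  show "\<forall>\<^sub>F j in tails. (hnorm (H j) (v j))\<^sup>2 \<le> B"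
    using eventually_tails_in by eventually_elim (rule assms(2))
qed simp

lemma hilbert_family_threads: "hilbert_family J H threads thread_ip"
proof (rule hilbert_family.intro)
  show "threads \<subseteq> (\<Pi>\<^sub>E j\<in>J. carrier (H j))"
    by (auto simp: threads_def)
next
  fix v w z assume v: "v \<in> threads" and w: "w \<in> threads" and z: "z \<in> threads"
  show "thread_ip (fam_add J H v w) z = thread_ip v z + thread_ip w z"
  proof (rule thread_ip_eqI[OF add_thread[OF v w] z tendsto_add[OF tendsto_thread_ip[OF v z]
      tendsto_thread_ip[OF w z]]])
    fix j assume j: "j \<in> J"
    show "hinner (H j) (v j) (z j) + hinner (H j) (w j) (z j) = hinner (H j) (fam_add J H v w j)
        (z j)"
      using j inner_product_space.hinner_add_left[OF H_ips[OF j] threadsD(1)[OF v j]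
          threadsD(1)[OF w j] threadsD(1)[OF z j]]
      by (simp add: fam_add_def)
  qed
next
  fix v w c assume v: "v \<in> threads" and w: "w \<in> threads"
  show "thread_ip (fam_smult J H c v) w = c * thread_ip v w"
  proof (rule thread_ip_eqI[OF smult_thread[OF v] w tendsto_mult_left[OF tendsto_thread_ip[OF v
      w]]])
    fix j assume j: "j \<in> J"
    show "c * hinner (H j) (v j) (w j) = hinner (H j) (fam_smult J H c v j) (w j)"
      using j inner_product_space.hinner_smult_left[OF H_ips[OF j] threadsD(1)[OF v j]
          threadsD(1)[OF w j]]
      by (simp add: fam_smult_def)
  qed
next
  fix v w assume v: "v \<in> threads" and w: "w \<in> threads"
  show "thread_ip w v = cnj (thread_ip v w)"
  proof (rule thread_ip_eqI[OF w v tendsto_cnj[OF tendsto_thread_ip[OF v w]]])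
    fix j assume j: "j \<in> J"
    show "cnj (hinner (H j) (v j) (w j)) = hinner (H j) (w j) (v j)"
      by (rule inner_product_space.hinner_commute[OF H_ips[OF j] threadsD(1)[OF v j]
          threadsD(1)[OF w j], symmetric])
  qed
next
  fix v assume v: "v \<in> threads"
  obtain j where j: "j \<in> J"
    using directed_nonempty by blast
  show "0 \<le> Re (thread_ip v v)"
    by (rule order_trans[OF zero_le_power2 thread_norm_ge[OF v j]])
next
  fix \<sigma> :: "nat \<Rightarrow> 'j \<Rightarrow> 'v" and l
  let ?d = "\<lambda>v w. fam_add J H v (fam_smult J H (-1) w)"
  assume \<sigma>: "\<And>n. \<sigma> n \<in> threads" and l: "l \<in> (\<Pi>\<^sub>E j\<in>J. carrier (H j))"
    and lim: "\<And>j. j \<in> J \<Longrightarrow> (\<lambda>n. hnorm (H j) (\<sigma> n j \<ominus>\<^bsub>H j\<^esub> l j)) \<longlonglongrightarrow> 0"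
    and cau: "\<And>e. e > 0 \<Longrightarrow> \<exists>N. \<forall>m\<ge>N. \<forall>n\<ge>N. sqrt (Re (thread_ip (?d (\<sigma> m) (\<sigma> n)) (?d (\<sigma> m) (\<sigma> n))))
        < e"
  have lc: "l j \<in> carrier (H j)" if "j \<in> J" for j
    using l that by auto
  note \<sigma>c = threadsD(1)[OF \<sigma>]
  have d: "?d v w j = v j \<ominus>\<^bsub>H j\<^esub> w j" if "j \<in> J" "v j \<in> carrier (H j)" "w j \<in> carrier (H j)"
      for v w j
    using that inner_product_space.minus_conv_smult[OF H_ips[OF that(1)] that(2,3)]
    by (simp add: fam_add_def fam_smult_def)
  \<comment> \<open>The components are Cauchy uniformly in \<open>j\<close>, hence they converge uniformly in \<open>j\<close>.\<close>
  have uniform: "\<exists>N. \<forall>n\<ge>N. \<forall>j\<in>J. hnorm (H j) (\<sigma> n j \<ominus>\<^bsub>H j\<^esub> l j) \<le> e" if e: "e > 0" for e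
  proof -
    obtain N where N: "\<And>m n. m \<ge> N \<Longrightarrow> n \<ge> N \<Longrightarrow>
        sqrt (Re (thread_ip (?d (\<sigma> m) (\<sigma> n)) (?d (\<sigma> m) (\<sigma> n)))) < e"
      using cau[OF e] by blast
    have "hnorm (H j) (\<sigma> n j \<ominus>\<^bsub>H j\<^esub> l j) \<le> e" if n: "n \<ge> N" and j: "j \<in> J" for n j
    proof -
      interpret inner_product_space "H j" by (rule H_ips[OF j])
      have "hnorm (H j) (\<sigma> n j \<ominus>\<^bsub>H j\<^esub> l j) - e \<le> hnorm (H j) (\<sigma> m j \<ominus>\<^bsub>H j\<^esub> l j)" if m: "m \<ge> N" for m
      proof -
        have "hnorm (H j) (\<sigma> n j \<ominus>\<^bsub>H j\<^esub> \<sigma> m j) \<le> sqrt (Re (thread_ip (?d (\<sigma> n) (\<sigma> m)) (?d (\<sigma> n)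
            (\<sigma> m))))"
          using thread_norm_ge[OF threads_combination[OF \<sigma> \<sigma>] j, of n "-1" m] d[where v = "\<sigma> n"
              and w = "\<sigma> m", OF j \<sigma>c[OF j] \<sigma>c[OF j]]
          by (simp add: real_le_rsqrt)
        then show ?thesis
          using N[OF n m] hnorm_triangle_minus[OF \<sigma>c[OF j] \<sigma>c[OF j] lc[OF j], of n m] by linarith
      qed
      then have "hnorm (H j) (\<sigma> n j \<ominus>\<^bsub>H j\<^esub> l j) - e \<le> 0"
        by (intro LIMSEQ_le_const[OF lim[OF j]]) blast
      then show ?thesis
        by simp
    qed
    then show ?thesis
      by blast
  qed
  have "\<phi> j k (l k) = l j" if jk: "j \<in> J" "k \<in> J" "leq j k" for j k
  proof -
    interpret J: hilbert_space "H j" by (rule H_hilbert[OF jk(1)])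
    interpret K: hilbert_space "H k" by (rule H_hilbert[OF jk(2)])
    note \<phi>c = blin_closed[OF \<phi>_blin[OF jk]]
    show ?thesis
    proof (rule J.hinner_eqI[OF \<phi>c[OF lc[OF jk(2)]] lc[OF jk(1)]])
      fix z assume z: "z \<in> carrier (H j)"
      have eq: "\<sigma> n j \<ominus>\<^bsub>H j\<^esub> \<phi> j k (l k) = \<phi> j k (\<sigma> n k \<ominus>\<^bsub>H k\<^esub> l k)" for n
        using blin_minus_vec[OF K.hilbert_space_axioms J.hilbert_space_axioms \<phi>_blin[OF jk] \<sigma>c[OF
            jk(2)] lc[OF jk(2)]]
          threadsD(2)[OF \<sigma> jk] by simp
      have "(\<lambda>n. hnorm (H j) (\<sigma> n j \<ominus>\<^bsub>H j\<^esub> \<phi> j k (l k))) \<longlonglongrightarrow> 0"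
      proof (rule Lim_null_comparison[OF _ lim[OF jk(2)]])
        have "hnorm (H j) (\<sigma> n j \<ominus>\<^bsub>H j\<^esub> \<phi> j k (l k)) \<le> hnorm (H k) (\<sigma> n k \<ominus>\<^bsub>H k\<^esub> l k)" for n
          unfolding eq by (rule \<phi>_le[OF jk K.minus_closed[OF \<sigma>c[OF jk(2)] lc[OF jk(2)]]])
        moreover have "0 \<le> hnorm (H j) (\<sigma> n j \<ominus>\<^bsub>H j\<^esub> \<phi> j k (l k))" for n
          by (intro J.hnorm_nonneg J.minus_closed \<sigma>c[OF jk(1)] \<phi>c lc jk)
        ultimately show "\<forall>\<^sub>F n in sequentially. norm (hnorm (H j) (\<sigma> n j \<ominus>\<^bsub>H j\<^esub> \<phi> j k (l k)))
            \<le> hnorm (H k) (\<sigma> n k \<ominus>\<^bsub>H k\<^esub> l k)"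
          by simp
      qed
      from J.tendsto_hinner[OF \<sigma>c[OF jk(1)] \<phi>c[OF lc[OF jk(2)]] this z]
        J.tendsto_hinner[OF \<sigma>c[OF jk(1)] lc[OF jk(1)] lim[OF jk(1)] z]
      show "hinner (H j) (\<phi> j k (l k)) z = hinner (H j) (l j) z"
        by (rule LIMSEQ_unique)
    qed
  qed
  moreover have "\<exists>B. \<forall>j\<in>J. hnorm (H j) (l j) \<le> B"
  proof -
    obtain n where n: "\<And>j. j \<in> J \<Longrightarrow> hnorm (H j) (\<sigma> n j \<ominus>\<^bsub>H j\<^esub> l j) \<le> 1"
      using uniform[of 1] by auto
    obtain B where B: "\<And>j. j \<in> J \<Longrightarrow> hnorm (H j) (\<sigma> n j) \<le> B"
      using threadsD(3)[OF \<sigma>] by blast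
    have "hnorm (H j) (l j) \<le> B + 1" if j: "j \<in> J" for j
    proof -
      interpret inner_product_space "H j" by (rule H_ips[OF j])
      show ?thesis
        using hnorm_le_add_minus[OF lc[OF j] \<sigma>c[OF j], of n] hnorm_minus_commute[OF lc[OF j] \<sigma>c[OF
            j], of n]
          n[OF j] B[OF j] by linarith
    qed
    then show ?thesis
      by blast
  qed
  ultimately have lS: "l \<in> threads"
    using l by (simp add: threads_def)
  have "(\<lambda>n. sqrt (Re (thread_ip (?d (\<sigma> n) l) (?d (\<sigma> n) l)))) \<longlonglongrightarrow> 0"
  proof (rule LIMSEQ_I)
    fix e :: real assume e: "e > 0"
    obtain N where N: "\<And>n j. n \<ge> N \<Longrightarrow> j \<in> J \<Longrightarrow> hnorm (H j) (\<sigma> n j \<ominus>\<^bsub>H j\<^esub> l j) \<le> e / 2"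
      using uniform[of "e / 2"] e by auto
    have "norm (sqrt (Re (thread_ip (?d (\<sigma> n) l) (?d (\<sigma> n) l))) - 0) < e" if n: "n \<ge> N" for n
    proof -
      note dS = threads_combination[OF \<sigma>[of n] lS, of "-1"]
      have "Re (thread_ip (?d (\<sigma> n) l) (?d (\<sigma> n) l)) \<le> (e / 2)\<^sup>2"
      proof (rule thread_norm_le[OF dS])
        fix j assume j: "j \<in> J"
        show "(hnorm (H j) (?d (\<sigma> n) l j))\<^sup>2 \<le> (e / 2)\<^sup>2"
          unfolding d[where v = "\<sigma> n" and w = l, OF j \<sigma>c[OF j] lc[OF j]]
          by (intro power_mono N[OF n j] inner_product_space.hnorm_nonneg[OF H_ips[OF j]])
            (use d[where v = "\<sigma> n" and w = l, OF j \<sigma>c[OF j] lc[OF j]] threadsD(1)[OF dS j] in simp)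
      qed
      then have "sqrt (Re (thread_ip (?d (\<sigma> n) l) (?d (\<sigma> n) l))) \<le> e / 2"
        using e by (intro real_le_lsqrt) auto
      moreover have "0 \<le> Re (thread_ip (?d (\<sigma> n) l) (?d (\<sigma> n) l))"
        using directed_nonempty thread_norm_ge[OF dS] zero_le_power2 order_trans by blast
      ultimately show ?thesis
        using e by simp
    qed
    then show "\<exists>N. \<forall>n\<ge>N. norm (sqrt (Re (thread_ip (?d (\<sigma> n) l) (?d (\<sigma> n) l))) - 0) < e"
      by blast
  qed
  with lS show "l \<in> threads \<and> (\<lambda>n. sqrt (Re (thread_ip (?d (\<sigma> n) l) (?d (\<sigma> n) l)))) \<longlonglongrightarrow> 0"
    by blast
qed (fact H_hilbert zero_thread add_thread smult_thread thread_norm_ge)+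

end


context small_unitary_reps
begin

section \<open>The order on Hermitian intertwiners\<close>

lemma herm_leD:
  assumes le: "herm_le \<C> A f g" and x: "x \<in> Obj G" and v: "v \<in> carrier (FObj A x)"
  shows "Re (hinner (FObj A x) (cmp f x v) v) \<le> Re (hinner (FObj A x) (cmp g x v) v)"
proof -
  have f: "f \<in> Hom \<C> A A" and g: "g \<in> Hom \<C> A A"
    using le by (auto simp: herm_le_def Hermitian_def)
  obtain X h where h: "h \<in> Hom \<C> A X" and eq: "arr_diff \<C> g f = Star \<C> h \<circ>\<^bsub>\<C>\<^esub> h"
    using le unfolding herm_le_def by blast
  interpret A: hilbert_space "FObj A x" by (rule rep_space(1)[OF HomD(1)[OF h] x])
  interpret X: hilbert_space "FObj X x" by (rule rep_space(1)[OF HomD(2)[OF h] x])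
  note hv = cmp_closed[OF h x v]
  have "cmp g x v \<oplus>\<^bsub>FObj A x\<^esub> (-1) \<odot>\<^bsub>FObj A x\<^esub> cmp f x v = cmp (Star \<C> h) x (cmp h x v)"
    using arg_cong[OF eq, of "\<lambda>t. cmp t x v"] arr_diff_eq[OF f g] comb_arr_Hom(2)[OF g f x v]
      Comp_Hom(2)[OF h Star_Hom(1)[OF h] x v] by simp
  then have "hinner (FObj A x) (cmp g x v \<oplus>\<^bsub>FObj A x\<^esub> (-1) \<odot>\<^bsub>FObj A x\<^esub> cmp f x v) v =
      hinner (FObj X x) (cmp h x v) (cmp h x v)"
    using Star_Hom'[OF h x v hv] by simp
  then have "hinner (FObj A x) (cmp g x v) v - hinner (FObj A x) (cmp f x v) v = hinner (FObj X x)
      (cmp h x v) (cmp h x v)"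
    using cmp_closed[OF f x v] cmp_closed[OF g x v] v by simp
  then have "Re (hinner (FObj A x) (cmp g x v) v) - Re (hinner (FObj A x) (cmp f x v) v) = Re
      (hinner (FObj X x) (cmp h x v) (cmp h x v))"
    by (metis minus_complex.sel(1))
  then show ?thesis
    using X.hinner_nonneg[OF hv] by linarith
qed

text \<open>
  A positive intertwiner \<open>D\<close> is \<open>h\<^sup>* h\<close> for its square root \<open>h\<close>. The operator at an object \<open>x\<close> is
  divided by a bound \<open>c x\<close> before taking the root. For naturality \<open>c\<close> must agree at isomorphic
  objects; it does, because isomorphic objects have the same bounds and the choice of \<open>c x\<close> depends
  only on the set of bounds.
\<close>

lemma positive_intertwiner_factors:
  assumes D: "D \<in> Hom \<C> A A" and self: "Star \<C> D = D"
    and pos: "\<And>x v. x \<in> Obj G \<Longrightarrow> v \<in> carrier (FObj A x) \<Longrightarrow> 0 \<le> Re (hinner (FObj A x) (cmp D x v) v)"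
  shows "\<exists>h\<in>Hom \<C> A A. D = Star \<C> h \<circ>\<^bsub>\<C>\<^esub> h"
proof -
  note A = HomD(1)[OF D]
  define bnd where "bnd x c \<longleftrightarrow> c > 0 \<and> (\<forall>v\<in>carrier (FObj A x). hnorm (FObj A x) (cmp D x v)
      \<le> c * hnorm (FObj A x) v)"
    for x and c :: real
  define c where "c x = (SOME c. bnd x c)" for x
  define T where "T x v = of_real (1 / c x) \<odot>\<^bsub>FObj A x\<^esub> cmp D x v" for x v
  define Z where "Z x = sqrt_iter_lim (FObj A x) (T x)" for x
  define h where "h x v = of_real (sqrt (c x)) \<odot>\<^bsub>FObj A x\<^esub> (v \<ominus>\<^bsub>FObj A x\<^esub> Z x v)" for x v
  have c: "c x > 0" "\<And>v. v \<in> carrier (FObj A x) \<Longrightarrow>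
      hnorm (FObj A x) (cmp D x v) \<le> c x * hnorm (FObj A x) v"
    if x: "x \<in> Obj G" for x
  proof -
    have "\<exists>c. bnd x c"
      using blin_bound[OF rep_space(1)[OF A x] rep_space(1)[OF A x] cmp_blin[OF D x]]
        unfolding bnd_def by metis
    then have "bnd x (c x)"
      unfolding c_def by (rule someI_ex)
    then show "c x > 0" "\<And>v. v \<in> carrier (FObj A x) \<Longrightarrow>
        hnorm (FObj A x) (cmp D x v) \<le> c x * hnorm (FObj A x) v"
      by (auto simp: bnd_def)
  qed
  have T: "positive_contraction (FObj A x) (T x)" if x: "x \<in> Obj G" for x
  proof -
    interpret A: hilbert_space "FObj A x" by (rule rep_space(1)[OF A x])
    note Dc = cmp_closed[OF D x]
    have T_comb: "T x v = of_real (1 / c x) \<odot>\<^bsub>FObj A x\<^esub> cmp D x v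
        \<oplus>\<^bsub>FObj A x\<^esub> 0 \<odot>\<^bsub>FObj A x\<^esub> cmp D x v"
      if "v \<in> carrier (FObj A x)" for v
      unfolding T_def using Dc[OF that] by (intro A.hinner_eqI) auto
    have "blin (FObj A x) (FObj A x) (T x)"
      by (rule iffD2[OF blin_cong[OF A.hilbert_space_axioms T_comb]
            blin_combination[OF A.hilbert_space_axioms A.hilbert_space_axioms cmp_blin[OF D x]
                cmp_blin[OF D x]]])
    moreover have "hinner (FObj A x) (T x v) w = hinner (FObj A x) v (T x w)"
      if "v \<in> carrier (FObj A x)" "w \<in> carrier (FObj A x)" for v w
      using that Dc Star_Hom(2)[OF D x that] by (simp add: T_def self)
    moreover have "0 \<le> Re (hinner (FObj A x) (T x v) v)" if v: "v \<in> carrier (FObj A x)" for v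
      using v Dc[OF v] pos[OF x v] c(1)[OF x] by (simp add: T_def)
    moreover have "hnorm (FObj A x) (T x v) \<le> hnorm (FObj A x) v" if v: "v \<in> carrier (FObj A x)"
        for v
      using Dc[OF v] c[OF x] v by (simp add: T_def norm_divide field_simps)
    ultimately show ?thesis
      by (intro positive_contraction.intro A.hilbert_space_axioms positive_contraction_axioms.intro)
  qed
  have h_int: "intertwines A A h"
    unfolding intertwines_def
  proof (intro conjI ballI)
    fix x assume x: "x \<in> Obj G"
    interpret T: positive_contraction "FObj A x" "T x" by (rule T[OF x])
    have eq: "h x v = of_real (sqrt (c x)) \<odot>\<^bsub>FObj A x\<^esub> v \<oplus>\<^bsub>FObj A x\<^esub> (- of_real (sqrt
        (c x))) \<odot>\<^bsub>FObj A x\<^esub> T.Z v"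
      if "v \<in> carrier (FObj A x)" for v
      unfolding h_def Z_def using that by (intro T.hinner_eqI) (auto simp: algebra_simps)
    show "blin (FObj A x) (FObj A x) (h x)"
      by (rule iffD2[OF blin_cong[OF T.hilbert_space_axioms eq]
            blin_combination[OF T.hilbert_space_axioms T.hilbert_space_axioms blin_id T.Z_blin]])
  next
    fix a v assume a: "a \<in> Arr G" and v: "v \<in> carrier (FObj A (Dom G a))"
    note xy = Dom_closed[OF a] Cod_closed[OF a]
    interpret Tx: positive_contraction "FObj A (Dom G a)" "T (Dom G a)" by (rule T[OF xy(1)])
    interpret Ty: positive_contraction "FObj A (Cod G a)" "T (Cod G a)" by (rule T[OF xy(2)])
    note ab = rep_arr(3)[OF A a]
    have bnd_act: "hnorm (FObj A (Cod G a)) (cmp D (Cod G a) (act A a w)) = hnorm (FObj A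
        (Dom G a)) (cmp D (Dom G a) w)"
      if "w \<in> carrier (FObj A (Dom G a))" for w
      using cmp_natural[OF D a that] hnorm_act[OF A a cmp_closed[OF D xy(1) that]] by simp
    have "bnd (Dom G a) = bnd (Cod G a)"
    proof (rule ext)
      fix c
      have "(\<forall>v\<in>carrier (FObj A (Cod G a)). hnorm (FObj A (Cod G a)) (cmp D (Cod G a) v)
          \<le> c * hnorm (FObj A (Cod G a)) v)
        \<longleftrightarrow> (\<forall>v\<in>carrier (FObj A (Dom G a)). hnorm (FObj A (Dom G a)) (cmp D (Dom G a) v) \<le> c * hnorm
            (FObj A (Dom G a)) v)"
        (is "?L \<longleftrightarrow> ?R")
      proof
        assume ?L
        then show ?R
          using bnd_act hnorm_act[OF A a] act_closed[OF A a] by metis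
      next
        assume R: ?R
        show ?L
        proof
          fix v assume v: "v \<in> carrier (FObj A (Cod G a))"
          have w: "act A (ginv a) v \<in> carrier (FObj A (Dom G a))"
            using act_closed[OF A ginv_Arr(1)[OF a]] v a by simp
          show "hnorm (FObj A (Cod G a)) (cmp D (Cod G a) v) \<le> c * hnorm (FObj A (Cod G a)) v"
            using bnd_act[OF w] hnorm_act[OF A a w] act_ginv(2)[OF A a v] R w by simp
        qed
      qed
      then show "bnd (Dom G a) c = bnd (Cod G a) c"
        by (simp add: bnd_def)
    qed
    then have cc: "c (Cod G a) = c (Dom G a)"
      by (simp add: c_def)
    have TV: "act A a (T (Dom G a) w) = T (Cod G a) (act A a w)"
        if "w \<in> carrier (FObj A (Dom G a))" for w
      unfolding T_def cc cmp_natural[OF D a that]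
      by (rule blin_smult_vec[OF ab cmp_closed[OF D xy(1) that]])
    have ZV: "act A a (Z (Dom G a) v) = Z (Cod G a) (act A a v)"
      unfolding Z_def by (rule Tx.Z_commute[OF Ty.positive_contraction_axioms ab hnorm_act[OF A a]
          TV v])
    have Zc: "Z (Dom G a) v \<in> carrier (FObj A (Dom G a))"
      unfolding Z_def by (rule Tx.Z_closed[OF v])
    show "h (Cod G a) (act A a v) = act A a (h (Dom G a) v)"
      unfolding h_def cc ZV[symmetric]
      by (simp only: blin_smult_vec[OF ab Tx.minus_closed[OF v Zc]]
          blin_minus_vec[OF Tx.hilbert_space_axioms Ty.hilbert_space_axioms ab v Zc])
  qed
  let ?h = "mk_arr A h A"
  have hH: "?h \<in> Hom \<C> A A"
    by (rule mk_arr_in_Hom[OF A A h_int])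
  have hc: "h x v \<in> carrier (FObj A x)" if "x \<in> Obj G" "v \<in> carrier (FObj A x)" for x v
    using cmp_closed[OF hH that] that by simp
  have "Star \<C> ?h = ?h"
  proof (rule Star_eqI[OF hH hH])
    fix x v w assume x: "x \<in> Obj G" and v: "v \<in> carrier (FObj A x)" and w: "w \<in> carrier (FObj A x)"
    interpret T: positive_contraction "FObj A x" "T x" by (rule T[OF x])
    show "hinner (FObj A x) (cmp ?h x w) v = hinner (FObj A x) w (cmp ?h x v)"
      using x v w by (simp add: h_def Z_def T.Z_selfadjoint)
  qed
  moreover have "D = ?h \<circ>\<^bsub>\<C>\<^esub> ?h"
  proof (rule arr_eqI[OF D Comp_Hom(1)[OF hH hH]])
    fix x v assume x: "x \<in> Obj G" and v: "v \<in> carrier (FObj A x)"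
    interpret T: positive_contraction "FObj A x" "T x" by (rule T[OF x])
    let ?u = "v \<ominus>\<^bsub>FObj A x\<^esub> T.Z v"
    let ?s = "complex_of_real (sqrt (c x))"
    have u: "?u \<in> carrier (FObj A x)"
      using v by auto
    have ss: "?s * ?s = of_real (c x)"
      using c(1)[OF x] by (simp flip: of_real_mult)
    have "h x (h x v) = ?s \<odot>\<^bsub>FObj A x\<^esub> (?s \<odot>\<^bsub>FObj A x\<^esub> ?u \<ominus>\<^bsub>FObj A x\<^esub> T.Z (?s \<odot>\<^bsub>FObj A x\<^esub> ?u))"
      by (simp add: h_def Z_def)
    also have "\<dots> = of_real (c x) \<odot>\<^bsub>FObj A x\<^esub> (?u \<ominus>\<^bsub>FObj A x\<^esub> T.Z ?u)"
      unfolding blin_smult_vec[OF T.Z_blin u]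
      using u by (intro T.hinner_eqI) (auto simp: ss[symmetric] algebra_simps)
    also have "\<dots> = of_real (c x) \<odot>\<^bsub>FObj A x\<^esub> T x v"
      by (simp only: T.Z_equation[OF v])
    also have "\<dots> = cmp D x v"
      unfolding T_def using cmp_closed[OF D x v] c(1)[OF x] by (intro T.hinner_eqI) auto
    finally have "h x (h x v) = cmp D x v" .
    then show "cmp D x v = cmp (?h \<circ>\<^bsub>\<C>\<^esub> ?h) x v"
      using Comp_Hom(2)[OF hH hH x v] x v hc[OF x v] by simp
  qed
  ultimately show ?thesis
    using hH by metis
qed

text \<open>Together with \<open>herm_leD\<close>: the order is the pointwise order of quadratic forms.\<close>

lemma herm_leI:
  assumes f: "f \<in> Hermitian \<C> A" and g: "g \<in> Hermitian \<C> A"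
    and le: "\<And>x v. x \<in> Obj G \<Longrightarrow> v \<in> carrier (FObj A x) \<Longrightarrow>
      Re (hinner (FObj A x) (cmp f x v) v) \<le> Re (hinner (FObj A x) (cmp g x v) v)"
  shows "herm_le \<C> A f g"
proof -
  have fH: "f \<in> Hom \<C> A A" and gH: "g \<in> Hom \<C> A A" and fs: "Star \<C> f = f" and gs: "Star \<C> g = g"
    using f g by (auto simp: Hermitian_def)
  let ?D = "comb_arr g (-1) f"
  note D = comb_arr_Hom[OF gH fH, where a = "-1"]
  have self: "Star \<C> ?D = ?D"
  proof (rule Star_eqI[OF D(1) D(1)])
    fix x v w assume x: "x \<in> Obj G" and v: "v \<in> carrier (FObj A x)" and w: "w \<in> carrier (FObj A x)"
    interpret A: hilbert_space "FObj A x" by (rule rep_space(1)[OF HomD(1)[OF fH] x])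
    show "hinner (FObj A x) (cmp ?D x w) v = hinner (FObj A x) w (cmp ?D x v)"
      unfolding D(2)[OF x v] D(2)[OF x w]
      using cmp_closed[OF fH x] cmp_closed[OF gH x] v w Star_Hom(2)[OF fH x w v] Star_Hom(2)[OF gH
          x w v]
      by (simp add: fs gs)
  qed
  have "\<exists>h\<in>Hom \<C> A A. ?D = Star \<C> h \<circ>\<^bsub>\<C>\<^esub> h"
  proof (rule positive_intertwiner_factors[OF D(1) self])
    fix x v assume x: "x \<in> Obj G" and v: "v \<in> carrier (FObj A x)"
    interpret A: hilbert_space "FObj A x" by (rule rep_space(1)[OF HomD(1)[OF fH] x])
    show "0 \<le> Re (hinner (FObj A x) (cmp ?D x v) v)"
      unfolding D(2)[OF x v] using cmp_closed[OF fH x v] cmp_closed[OF gH x v] v le[OF x v] by simp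
  qed
  then show ?thesis
    unfolding herm_le_def arr_diff_eq[OF fH gH] using f g by blast
qed

lemma Star_comp_Hermitian:
  assumes f: "f \<in> Hom \<C> A B"
  shows "Star \<C> f \<circ>\<^bsub>\<C>\<^esub> f \<in> Hermitian \<C> A"
  using URep.Star_Comp[OF f Star_Hom(1)[OF f]] URep.Star_Star[OF f] Comp_Hom(1)[OF f
      Star_Hom(1)[OF f]]
  by (simp add: Hermitian_def)

lemma Ident_Hermitian: "A \<in> Obj \<C> \<Longrightarrow> Ident \<C> A \<in> Hermitian \<C> A"
  using Ident_Hom(1) URep.Star_Ident by (simp add: Hermitian_def)

lemma Star_comp_inner:
  assumes f: "f \<in> Hom \<C> A B" and x: "x \<in> Obj G" and v: "v \<in> carrier (FObj A x)"
  shows "Re (hinner (FObj A x) (cmp (Star \<C> f \<circ>\<^bsub>\<C>\<^esub> f) x v) v) = (hnorm (FObj B x) (cmp f x v))\<^sup>2"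
proof -
  interpret B: hilbert_space "FObj B x" by (rule rep_space(1)[OF HomD(2)[OF f] x])
  show ?thesis
    using Comp_Hom(2)[OF f Star_Hom(1)[OF f] x v] Star_Hom'[OF f x v cmp_closed[OF f x v]]
      B.hnorm_sq[OF cmp_closed[OF f x v]] by simp
qed

lemma contraction_le:
  assumes f: "f \<in> Hom \<C> A B" and con: "contraction \<C> f" and x: "x \<in> Obj G" and v: "v \<in> carrier
      (FObj A x)"
  shows "hnorm (FObj B x) (cmp f x v) \<le> hnorm (FObj A x) v"
proof -
  note A = HomD(1)[OF f]
  interpret A: hilbert_space "FObj A x" by (rule rep_space(1)[OF A x])
  have "herm_le \<C> A (Star \<C> f \<circ>\<^bsub>\<C>\<^esub> f) (Ident \<C> A)"
    using con Hom_Arr[OF f] by (simp add: contraction_def)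
  from herm_leD[OF this x v] have "(hnorm (FObj B x) (cmp f x v))\<^sup>2 \<le> (hnorm (FObj A x) v)\<^sup>2"
    using v by (simp add: Star_comp_inner[OF f x v] Ident_Hom(2)[OF A x v] A.hnorm_sq)
  then show ?thesis
    by (rule power2_le_imp_le) (use v in simp)
qed

section \<open>Limits of codirected diagrams of contractions\<close>

text \<open>The limit is at each object the space of bounded threads.\<close>

lemma ex_l2_limit_URep:
  assumes J: "J \<in> \<I>" and diag: "codirected_diagram \<C> J leq X f"
    and con: "\<And>j k. j \<in> J \<Longrightarrow> k \<in> J \<Longrightarrow> leq j k \<Longrightarrow> contraction \<C> (f j k)"
  shows "\<exists>L p. is_l2_limit \<C> J leq X f L p"
proof -
  interpret dia: codirected_diagram \<C> J leq X f by (rule diag)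
  note X = dia.diagram_obj and f = dia.diagram_arr
  let ?H = "\<lambda>x j. FObj (X j) x" and ?\<phi> = "\<lambda>x j k. cmp (f j k) x"
  have sys: "contraction_system J leq (?H x) (?\<phi> x)" if x: "x \<in> Obj G" for x
  proof (intro contraction_system.intro contraction_system_axioms.intro)
    show "directed_set J leq"
      by (rule dia.directed_set_axioms)
    show "hilbert_space (FObj (X j) x)" if "j \<in> J" for j
      by (rule rep_space(1)[OF X[OF that] x])
    show "blin (FObj (X k) x) (FObj (X j) x) (cmp (f j k) x)" if "j \<in> J" "k \<in> J" "leq j k" for j k
      by (rule cmp_blin[OF f[OF that] x])
    show "hnorm (FObj (X j) x) (cmp (f j k) x v) \<le> hnorm (FObj (X k) x) v"
      if "j \<in> J" "k \<in> J" "leq j k" "v \<in> carrier (FObj (X k) x)" for j k v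
      by (rule contraction_le[OF f[OF that(1-3)] con[OF that(1-3)] x that(4)])
  qed
  define S where "S x = contraction_system.threads J leq (?H x) (?\<phi> x)" for x
  define ip where "ip x = contraction_system.thread_ip J leq (?H x)" for x
  have fam: "hilbert_family J (?H x) (S x) (ip x)" if x: "x \<in> Obj G" for x
    unfolding S_def ip_def by (rule contraction_system.hilbert_family_threads[OF sys[OF x]])
  note S_iff = contraction_system.threads_def[OF sys, folded S_def]
  note SD = contraction_system.threadsD[OF sys, folded S_def]
  note ip_ge = contraction_system.thread_norm_ge[OF sys, folded S_def ip_def]
  note ip_le = contraction_system.thread_norm_le[OF sys, folded S_def ip_def]
  note ip_lim = contraction_system.tendsto_thread_ip[OF sys, folded S_def ip_def]
  note ip_eqI = contraction_system.thread_ip_eqI[OF sys, folded S_def ip_def]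
  have S_act: "(\<lambda>j\<in>J. act (X j) a (v j)) \<in> S (Cod G a)" if a: "a \<in> Arr G" and v: "v \<in> S (Dom G a)"
      for a v
  proof -
    note xy = Dom_closed[OF a] Cod_closed[OF a]
    note v' = SD[OF xy(1) v]
    obtain B where B: "\<And>j. j \<in> J \<Longrightarrow> hnorm (FObj (X j) (Dom G a)) (v j) \<le> B"
      using v'(3) by blast
    have "cmp (f j k) (Cod G a) (act (X k) a (v k)) = act (X j) a (v j)"
        if jk: "j \<in> J" "k \<in> J" "leq j k" for j k
      using cmp_natural[OF f[OF jk] a v'(1)[OF jk(2)]] v'(2)[OF jk] by simp
    moreover have "hnorm (FObj (X j) (Cod G a)) (act (X j) a (v j)) \<le> B" if j: "j \<in> J" for j
      using hnorm_act[OF X[OF j] a v'(1)[OF j]] B[OF j] by simp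
    ultimately show ?thesis
      unfolding S_iff[OF xy(2)] using act_closed[OF X a v'(1)] by auto
  qed
  have "\<exists>L p. represents_family J X S ip L p"
  proof (rule ex_represents_family)
    show "X j \<in> Obj \<C>" if "j \<in> J" for j
      by (rule X[OF that])
    show "hilbert_family J (\<lambda>j. FObj (X j) x) (S x) (ip x)" if "x \<in> Obj G" for x
      by (rule fam[OF that])
    show "\<exists>D\<in>\<U>. S x \<lesssim> D" if x: "x \<in> Obj G" for x
    proof -
      obtain D where D: "D \<in> \<U>" "(\<Pi>\<^sub>E j\<in>J. carrier (FObj (X j) x)) \<lesssim> D"
        using small_PiE[OF J, of "\<lambda>j. carrier (FObj (X j) x)"] rep_space(2)[OF X x] by blast
      have "S x \<lesssim> D"
        by (rule lepoll_trans[OF subset_imp_lepoll[OF hilbert_family.S_subset[OF fam[OF x]]] D(2)])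
      then show ?thesis
        using D(1) by blast
    qed
    show "B \<in> \<U>" if "A \<in> \<U>" "B \<lesssim> A" for A B
      by (rule small_lepoll[OF that])
    show "(\<lambda>j\<in>J. act (X j) a (v j)) \<in> S (Cod G a)" if "a \<in> Arr G" "v \<in> S (Dom G a)" for a v
      by (rule S_act[OF that])
    show "ip (Cod G a) (\<lambda>j\<in>J. act (X j) a (v j)) (\<lambda>j\<in>J. act (X j) a (w j)) = ip (Dom G a) v w"
      if a: "a \<in> Arr G" and v: "v \<in> S (Dom G a)" and w: "w \<in> S (Dom G a)" for a v w
    proof (rule ip_eqI[OF Cod_closed[OF a] S_act[OF a v] S_act[OF a w] ip_lim[OF Dom_closed[OF a]
        v w]])
      fix j assume j: "j \<in> J"
      show "hinner (FObj (X j) (Dom G a)) (v j) (w j) =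
          hinner (FObj (X j) (Cod G a)) ((\<lambda>j\<in>J. act (X j) a (v j)) j) ((\<lambda>j\<in>J. act (X j) a (w j)) j)"
        using act_isometry[OF X[OF j] a SD(1)[OF Dom_closed[OF a] v j] SD(1)[OF Dom_closed[OF a] w
            j]] j by simp
    qed
  qed
  then obtain L p where L: "represents_family J X S ip L p"
    by blast
  note D = represents_familyD[OF L]
  have p_le: "(hnorm (FObj (X j) x) (cmp (p j) x v))\<^sup>2 \<le> (hnorm (FObj L x) v)\<^sup>2"
    if x: "x \<in> Obj G" and v: "v \<in> carrier (FObj L x)" and j: "j \<in> J" for x v j
  proof -
    interpret L: hilbert_space "FObj L x" by (rule rep_space(1)[OF D(1) x])
    show ?thesis
      using ip_ge[OF x D(3)[OF x v] j] D(4)[OF x v v] j by (simp add: L.hnorm_sq[OF v])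
  qed
  have cone: "is_l2_cone \<C> J leq X f L p"
    unfolding is_l2_cone_def is_cone_def
  proof (intro conjI ballI impI exI)
    show "L \<in> Obj \<C>"
      by (rule D(1))
    show "p j \<in> Hom \<C> L (X j)" if "j \<in> J" for j
      by (rule D(2)[OF that])
    show "f j k \<circ>\<^bsub>\<C>\<^esub> p k = p j" if jk: "j \<in> J" "k \<in> J" "leq j k" for j k
    proof (rule arr_eqI[OF Comp_Hom(1)[OF D(2)[OF jk(2)] f[OF jk]] D(2)[OF jk(1)]])
      fix x v assume x: "x \<in> Obj G" and v: "v \<in> carrier (FObj L x)"
      show "cmp (f j k \<circ>\<^bsub>\<C>\<^esub> p k) x v = cmp (p j) x v"
        using Comp_Hom(2)[OF D(2)[OF jk(2)] f[OF jk] x v] SD(2)[OF x D(3)[OF x v] jk] jk by simp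
    qed
    show "herm_upper_bound \<C> L ((\<lambda>j. Star \<C> (p j) \<circ>\<^bsub>\<C>\<^esub> p j) ` J) (Ident \<C> L)"
      unfolding herm_upper_bound_def
    proof (intro conjI ballI Ident_Hermitian D(1))
      fix t assume "t \<in> (\<lambda>j. Star \<C> (p j) \<circ>\<^bsub>\<C>\<^esub> p j) ` J"
      then obtain j where j: "j \<in> J" and t: "t = Star \<C> (p j) \<circ>\<^bsub>\<C>\<^esub> p j"
        by blast
      show "herm_le \<C> L t (Ident \<C> L)"
        unfolding t
      proof (rule herm_leI[OF Star_comp_Hermitian[OF D(2)[OF j]] Ident_Hermitian[OF D(1)]])
        fix x v assume x: "x \<in> Obj G" and v: "v \<in> carrier (FObj L x)"
        interpret L: hilbert_space "FObj L x" by (rule rep_space(1)[OF D(1) x])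
        show "Re (hinner (FObj L x) (cmp (Star \<C> (p j) \<circ>\<^bsub>\<C>\<^esub> p j) x v) v)
            \<le> Re (hinner (FObj L x) (cmp (Ident \<C> L) x v) v)"
          unfolding Star_comp_inner[OF D(2)[OF j] x v] Ident_Hom(2)[OF D(1) x v]
          using p_le[OF x v j] L.hnorm_sq[OF v] by simp
      qed
    qed
  qed
  have univ: "(\<exists>!u. u \<in> Hom \<C> Y L \<and> (\<forall>j \<in> J. p j \<circ>\<^bsub>\<C>\<^esub> u = g j)) \<and>
        (\<forall>u. u \<in> Hom \<C> Y L \<longrightarrow> (\<forall>j \<in> J. p j \<circ>\<^bsub>\<C>\<^esub> u = g j) \<longrightarrow>
           herm_is_sup \<C> Y ((\<lambda>j. Star \<C> (g j) \<circ>\<^bsub>\<C>\<^esub> g j) ` J) (Star \<C> u \<circ>\<^bsub>\<C>\<^esub> u))"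
    if gcone: "is_l2_cone \<C> J leq X f Y g" for Y g
  proof -
    obtain b where b: "herm_upper_bound \<C> Y ((\<lambda>j. Star \<C> (g j) \<circ>\<^bsub>\<C>\<^esub> g j) ` J) b"
      using gcone unfolding is_l2_cone_def by blast
    have Y: "Y \<in> Obj \<C>" and g: "\<And>j. j \<in> J \<Longrightarrow> g j \<in> Hom \<C> Y (X j)"
      and gf: "\<And>j k. j \<in> J \<Longrightarrow> k \<in> J \<Longrightarrow> leq j k \<Longrightarrow> f j k \<circ>\<^bsub>\<C>\<^esub> g k = g j"
      using gcone by (auto simp: is_l2_cone_def is_cone_def)
    have ub: "(hnorm (FObj (X j) x) (cmp (g j) x y))\<^sup>2 \<le> Re (hinner (FObj Y x) (cmp b x y) y)"
      if b: "herm_upper_bound \<C> Y ((\<lambda>j. Star \<C> (g j) \<circ>\<^bsub>\<C>\<^esub> g j) ` J) b"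
        and x: "x \<in> Obj G" and y: "y \<in> carrier (FObj Y x)" and j: "j \<in> J" for b x y j
    proof -
      have "herm_le \<C> Y (Star \<C> (g j) \<circ>\<^bsub>\<C>\<^esub> g j) b"
        using b j by (simp add: herm_upper_bound_def)
      from herm_leD[OF this x y] show ?thesis
        by (simp add: Star_comp_inner[OF g[OF j] x y])
    qed
    have bH: "b \<in> Hom \<C> Y Y"
      using b by (simp add: herm_upper_bound_def Hermitian_def)
    have bound: "\<exists>B. \<forall>y\<in>carrier (FObj Y x). Re (hinner (FObj Y x) (cmp b x y) y) \<le> B * (hnorm
        (FObj Y x) y)\<^sup>2"
      if x: "x \<in> Obj G" for x
    proof -
      interpret Y: hilbert_space "FObj Y x" by (rule rep_space(1)[OF Y x])
      obtain B where B: "B > 0" "\<And>y. y \<in> carrier (FObj Y x) \<Longrightarrow>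
          hnorm (FObj Y x) (cmp b x y) \<le> B * hnorm (FObj Y x) y"
        using blin_bound[OF Y.hilbert_space_axioms Y.hilbert_space_axioms cmp_blin[OF bH x]]
        by metis
      have "Re (hinner (FObj Y x) (cmp b x y) y) \<le> B * (hnorm (FObj Y x) y)\<^sup>2"
          if y: "y \<in> carrier (FObj Y x)" for y
      proof -
        have "Re (hinner (FObj Y x) (cmp b x y) y) \<le> hnorm (FObj Y x) (cmp b x y) * hnorm
            (FObj Y x) y"
          using Y.Cauchy_Schwarz[OF cmp_closed[OF bH x y] y] complex_Re_le_cmod order_trans by blast
        also have "\<dots> \<le> B * hnorm (FObj Y x) y * hnorm (FObj Y x) y"
          using y by (intro mult_right_mono B(2)) auto
        finally show ?thesis
          by (simp add: power2_eq_square mult.assoc)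
      qed
      then show ?thesis
        by blast
    qed
    have gS: "(\<lambda>j\<in>J. cmp (g j) x y) \<in> S x" if x: "x \<in> Obj G" and y: "y \<in> carrier (FObj Y x)" for x y
    proof -
      have "cmp (f j k) x (cmp (g k) x y) = cmp (g j) x y" if jk: "j \<in> J" "k \<in> J" "leq j k" for j k
        using Comp_Hom(2)[OF g[OF jk(2)] f[OF jk] x y] gf[OF jk] by simp
      moreover have "hnorm (FObj (X j) x) (cmp (g j) x y) \<le> sqrt (Re (hinner (FObj Y x)
          (cmp b x y) y))" if j: "j \<in> J" for j
        by (rule real_le_rsqrt[OF ub[OF b x y j]])
      ultimately show ?thesis
        unfolding S_iff[OF x] using cmp_closed[OF g x y] by auto
    qed
    have ipb: "Re (ip x (\<lambda>j\<in>J. cmp (g j) x y) (\<lambda>j\<in>J. cmp (g j) x y)) \<le> Re (hinner (FObj Y x)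
        (cmp b x y) y)"
      if b: "herm_upper_bound \<C> Y ((\<lambda>j. Star \<C> (g j) \<circ>\<^bsub>\<C>\<^esub> g j) ` J) b"
        and x: "x \<in> Obj G" and y: "y \<in> carrier (FObj Y x)" for b x y
      by (rule ip_le[OF x gS[OF x y]]) (simp add: ub[OF b x y])
    have ex1: "\<exists>!u. u \<in> Hom \<C> Y L \<and> (\<forall>j \<in> J. p j \<circ>\<^bsub>\<C>\<^esub> u = g j)"
    proof (rule ex1_mediating[OF L Y g gS])
      show "\<exists>B. \<forall>y\<in>carrier (FObj Y x). Re (ip x (\<lambda>j\<in>J. cmp (g j) x y) (\<lambda>j\<in>J. cmp (g j) x y))
          \<le> B * (hnorm (FObj Y x) y)\<^sup>2" if x: "x \<in> Obj G" for x
        using bound[OF x] ipb[OF b x] order_trans by meson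
    qed
    have "herm_is_sup \<C> Y ((\<lambda>j. Star \<C> (g j) \<circ>\<^bsub>\<C>\<^esub> g j) ` J) (Star \<C> u \<circ>\<^bsub>\<C>\<^esub> u)"
      if u: "u \<in> Hom \<C> Y L" and pu: "\<forall>j \<in> J. p j \<circ>\<^bsub>\<C>\<^esub> u = g j" for u
    proof -
      have tup: "(\<lambda>j\<in>J. cmp (p j) x (cmp u x y)) = (\<lambda>j\<in>J. cmp (g j) x y)"
        if x: "x \<in> Obj G" and y: "y \<in> carrier (FObj Y x)" for x y
      proof (rule restrict_ext)
        fix j assume j: "j \<in> J"
        show "cmp (p j) x (cmp u x y) = cmp (g j) x y"
          using Comp_Hom(2)[OF u D(2)[OF j] x y] pu j by simp
      qed
      have uu: "Re (hinner (FObj Y x) (cmp (Star \<C> u \<circ>\<^bsub>\<C>\<^esub> u) x y) y) =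
          Re (ip x (\<lambda>j\<in>J. cmp (g j) x y) (\<lambda>j\<in>J. cmp (g j) x y))"
        if x: "x \<in> Obj G" and y: "y \<in> carrier (FObj Y x)" for x y
      proof -
        interpret L: hilbert_space "FObj L x" by (rule rep_space(1)[OF D(1) x])
        note uy = cmp_closed[OF u x y]
        show ?thesis
          unfolding Star_comp_inner[OF u x y] L.hnorm_sq[OF uy] D(4)[OF x uy uy] tup[OF x y] ..
      qed
      show ?thesis
        unfolding herm_is_sup_def herm_upper_bound_def
      proof (intro conjI ballI allI impI)
        show "Star \<C> u \<circ>\<^bsub>\<C>\<^esub> u \<in> Hermitian \<C> Y"
          by (rule Star_comp_Hermitian[OF u])
        fix t assume "t \<in> (\<lambda>j. Star \<C> (g j) \<circ>\<^bsub>\<C>\<^esub> g j) ` J"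
        then obtain j where j: "j \<in> J" and t: "t = Star \<C> (g j) \<circ>\<^bsub>\<C>\<^esub> g j"
          by blast
        show "herm_le \<C> Y t (Star \<C> u \<circ>\<^bsub>\<C>\<^esub> u)"
          unfolding t
        proof (rule herm_leI[OF Star_comp_Hermitian[OF g[OF j]] Star_comp_Hermitian[OF u]])
          fix x y assume x: "x \<in> Obj G" and y: "y \<in> carrier (FObj Y x)"
          show "Re (hinner (FObj Y x) (cmp (Star \<C> (g j) \<circ>\<^bsub>\<C>\<^esub> g j) x y) y)
              \<le> Re (hinner (FObj Y x) (cmp (Star \<C> u \<circ>\<^bsub>\<C>\<^esub> u) x y) y)"
            unfolding Star_comp_inner[OF g[OF j] x y] uu[OF x y]
            using ip_ge[OF x gS[OF x y] j] j by simp
        qed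
      next
        fix b' assume b': "b' \<in> Hermitian \<C> Y \<and> (\<forall>a\<in>(\<lambda>j. Star \<C> (g j)
            \<circ>\<^bsub>\<C>\<^esub> g j) ` J. herm_le \<C> Y a b')"
        show "herm_le \<C> Y (Star \<C> u \<circ>\<^bsub>\<C>\<^esub> u) b'"
        proof (rule herm_leI[OF Star_comp_Hermitian[OF u]])
          show "b' \<in> Hermitian \<C> Y"
            using b' by blast
          fix x y assume x: "x \<in> Obj G" and y: "y \<in> carrier (FObj Y x)"
          show "Re (hinner (FObj Y x) (cmp (Star \<C> u \<circ>\<^bsub>\<C>\<^esub> u) x y) y) \<le> Re (hinner (FObj Y x)
              (cmp b' x y) y)"
            unfolding uu[OF x y] by (rule ipb[OF _ x y]) (unfold herm_upper_bound_def, rule b')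
        qed
      qed
    qed
    with ex1 show ?thesis
      by blast
  qed
  show ?thesis
    unfolding is_l2_limit_def
    by (intro exI[of _ L] exI[of _ p] conjI cone allI impI) (use univ in blast)+
qed

end

theorem proposition6p1:
  fixes G :: "('o, 'm) category" and \<I> :: "'j set set" and \<U> :: "'v set set"
  assumes "small_sets \<I> \<U>" and "groupoid G"
  shows "hilbert_star_category \<I> (URep \<U> G)"
proof -
  interpret small_unitary_reps G \<U> \<I>
    using assms by (intro small_unitary_reps.intro unitary_reps.intro
        small_unitary_reps_axioms.intro)
  show ?thesis
    by (intro hilbert_star_category.intro hilbert_star_category_axioms.intro pre_hilbert_URep
        ex_l2_limit_URep)
qed

end
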